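(* Let $b=3/4$, $a\in(0,\pi-3/4)$, $k\ge4$, and let $\beta$ be a positive integer. Let $\tilde{\mathcal C}^k_{a,\beta}$ be the set of all functions $f:\mathbb R\to\mathbb C$ with $\operatorname{supp}(f)\subseteq(-a,a)$ that are $C^k$-smooth and have $\beta$ Fourier decay. Fix $d=L$ to be an odd multiple of three, large enough that all of the following hold: $\beta<\lceil db/2\pi\rceil-1/2$, $s=r=\lceil db/2\pi\rceil<d/8-1$, and $5d/21<\delta=\lfloor db/\pi\rfloor<d/4$; assume $s=r$ is odd. Set $K=d/3$. Then, for any $C^k$-smooth mask $\tilde m:\mathbb R\to\mathbb C$ with $\operatorname{supp}(\tilde m)\subseteq(-b,b)$ and $\mu_2>0$, every $f\in\tilde{\mathcal C}^k_{a,\beta}$ and every noise matrix $\boldsymbol\eta=(\eta_{\omega,\ell})_{\omega,\ell\in\mathcal D}$, the trigonometric polynomial $f_e$ output by Algorithm 2 (described in the context) satisfies $$\min_{\theta\in[0,2\pi]}\left\|e^{i\theta}f-f_e\right\|^2_{L^2([-\pi,\pi])}\le C_{f,m}\left(\frac{1}{\mu_2\,\sigma_{\min}(\mathbf W)\,d^k}+\frac{\|\boldsymbol\eta_{K,d}\|_F}{\mu_2\,\sigma_{\min}(\mathbf W)}+\left(\frac1d\right)^{2k-2}\right),$$ where $C_{f,m}$ is a constant depending only on $f$, $\tilde m$ and $k$, $\sigma_{\min}(\mathbf W)$ is the smallest singular value of the $(2(d/3-\lfloor 3d/4\pi\rfloor)-1)\times\lceil db/2\pi\rceil$ partial Fourier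 matrix $\mathbf W$, and $\boldsymbol\eta_{K,d}=(\eta_{\omega d/K,\ell})_{\omega\in[K]_c,\ell\in\mathcal D}$ is the $K\times d$ matrix obtained by subsampling equispaced rows of $\boldsymbol\eta$.
   Context: **Notation.** $\widehat f(n)=\frac1{2\pi}\int_{-\pi}^{\pi}f(x)e^{-inx}dx$ for $n\in\mathbb Z$. For odd $n$, $[n]_c=[\frac{1-n}{2},\frac{n-1}{2}]\cap\mathbb Z$. $\mathcal D=[d]_c$, $\mathcal S=[s]_c$. For odd $n$, $\mathbf F_n$ is the $n\times n$ matrix with entries $(\mathbf F_n)_{j,k}=\frac1n e^{-2\pi i jk/n}$, $j,k\in[n]_c$. For $\mathbf u=(u_p)_{p\in\mathcal D}$: $\widehat{\mathbf u}=\mathbf F_d\mathbf u$, and $(S_\ell\mathbf u)_p=u_{p+\ell}$ with indices modulo $d$; $\circ$ is the entrywise product. $\arg(0):=0$. $\|\cdot\|_F$ is the Frobenius norm. **Fourier decay.** For a positive integer $\beta$ let $D_n=\max_{|m-n|<\beta/2}|\widehat f(m)|$. The function $f$ has $\beta$ Fourier decay if $D_n\ge D_{n'}$ whenever $|n|\le|n'|$. **Measurements.** For $\omega,\ell\in\mathcal D$, $$Y_{\omega,\ell}=\left|\int_{\mathbb R}f(x)\tilde m\left(x-\tfrac{2\pi}{d}\ell\right)e^{-ix\omega}dx\right|^2+\eta_{\omega,\ell},$$ with $\boldsymbol\eta$ arbitrary. The algorithm sees only the $K\times d$ matrix $\mathbf Y_{K,d}=(Y_{\omega d/K,\ell})_{\omega\in[K]_c,\ell\in\mathcal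 D}$. **Mask constant and $\mathbf W$.** Let $\kappa=K-\delta$, $z_p=\tilde m(2\pi p/d)$ for $p\in\mathcal D$, $\widehat{\mathbf z}=\mathbf F_d\mathbf z$, and $$\mu_2=\min_{\omega\in[2\kappa-1]_c,\ \ell\in[2s-1]_c}\left|\left(\mathbf F_d(\widehat{\mathbf z}\circ S_\ell\overline{\widehat{\mathbf z}})\right)_\omega\right|.$$ $\mathbf W$ is the $(2\kappa-1)\times s$ matrix with entries $W_{j,k}=(\mathbf F_d)_{j,k}=\frac1d e^{-2\pi ijk/d}$, $j\in[2\kappa-1]_c$, $k\in\mathcal S$, and $\mathbf W^\dagger=(\mathbf W^*\mathbf W)^{-1}\mathbf W^*$. **Algorithm 2.** 1. Let $\tilde{\mathbf Y}=\mathbf F_d\mathbf Y_{K,d}^T\mathbf F_K^T$ (rows indexed by $\mathcal D$, columns by $[K]_c$), and let $\mathbf C$ be the $(2\kappa-1)\times(2s-1)$ matrix with entries $C_{\omega,\ell}=\frac1{4\pi^2d}\,\tilde Y_{-\ell,\omega}\big/\left(\mathbf F_d(\widehat{\mathbf z}\circ S_{-\ell}\overline{\widehat{\mathbf z}})\right)_\omega$, $\omega\in[2\kappa-1]_c$, $\ell\in[2s-1]_c$. 2. Let $\mathbf V=\mathbf W^\dagger\mathbf C$ (rows indexed by $\mathcal S$, columns by $[2s-1]_c$), and let $\Lambda(\mathbf V)\in\mathbb C^{d\times d}$ have entries $\Lambda(\mathbf V)_{i,j}=V_{i,j-i}$ if $i\in\mathcal S$ and $|j-i|\le s-1$, and $0$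 otherwise. 3. Let $\mathbf A=\frac12(\Lambda(\mathbf V)+\Lambda(\mathbf V)^* )$ and $a_n=\sqrt{|A_{n,n}|}$. 4. For each $n\in\mathcal S$ run Entry Selection (below) with $\gamma=2s-1$ and the given $\beta$ to get $n_0,\dots,n_b=n$, and let $\alpha_n=\sum_{\ell=0}^{b-1}\arg(A_{n_{\ell+1},n_\ell})$. 5. Output $f_e(x)=\sum_{n\in\mathcal S}a_ne^{i\alpha_n}e^{inx}$. **Entry Selection** (inputs $(a_m)$, $n\in\mathcal S$, parameters $\beta,\gamma$). Let $n_0=\operatorname{argmax}_{m\in\mathcal S}a_m$ (the same for all $n$; ties broken arbitrarily), $b=0$. While $|n-n_b|\ge\gamma$: if $n>n_b$ let $n_{b+1}$ be a maximizer of $a_m$ over $n_b+\gamma-\beta\le m<n_b+\gamma$; if $n<n_b$ let $n_{b+1}$ be a maximizer of $a_m$ over $n_b-\gamma<m\le n_b-\gamma+\beta$; then increase $b$ by one. When the loop ends, if $n_b\ne n$, append $n$ to the sequence as its last term. The final sequence is relabelled $n_0,\dots,n_b=n$. *)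

theory Defs
  imports
    "HOL-Analysis.Analysis"
    "Jordan_Normal_Form.Matrix"
    "Jordan_Normal_Form.Char_Poly"
    "Jordan_Normal_Form.Schur_Decomposition"
    "Jordan_Normal_Form.Gauss_Jordan_Elimination"
begin

primrec C_smooth :: "nat \<Rightarrow> (real \<Rightarrow> complex) \<Rightarrow> bool" where
  "C_smooth 0 f = continuous_on UNIV f"
| "C_smooth (Suc k) f =
     ((\<forall>x. f differentiable at x) \<and> C_smooth k (\<lambda>x. vector_derivative f (at x)))"

definition supp :: "(real \<Rightarrow> complex) \<Rightarrow> real set" where
  "supp f = closure (support_on UNIV f)"

definition fourier_coeff :: "(real \<Rightarrow> complex) \<Rightarrow> int \<Rightarrow> complex" where
  "fourier_coeff f n =
     complex_of_real (1 / (2 * pi)) * (LBINT x:{-pi..pi}. f x * cis (- (of_int n * x)))"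

definition decay_max :: "(real \<Rightarrow> complex) \<Rightarrow> nat \<Rightarrow> int \<Rightarrow> real" where
  "decay_max f \<beta> n =
     Max ((\<lambda>m. cmod (fourier_coeff f m)) ` {m::int. \<bar>real_of_int (m - n)\<bar> < real \<beta> / 2})"

definition fourier_decay :: "nat \<Rightarrow> (real \<Rightarrow> complex) \<Rightarrow> bool" where
  "fourier_decay \<beta> f \<longleftrightarrow> (\<forall>n n'. \<bar>n\<bar> \<le> \<bar>n'\<bar> \<longrightarrow> decay_max f \<beta> n' \<le> decay_max f \<beta> n)"

definition signal_class :: "nat \<Rightarrow> real \<Rightarrow> nat \<Rightarrow> (real \<Rightarrow> complex) set" where
  "signal_class k a \<beta> = {f. supp f \<subseteq> {-a<..<a} \<and> C_smooth k f \<and> fourier_decay \<beta> f}"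

definition L2_norm :: "(real \<Rightarrow> complex) \<Rightarrow> real" where
  "L2_norm g = sqrt (LBINT x:{-pi..pi}. (cmod (g x))\<^sup>2)"


text \<open>
  The centred index set of an odd \<open>n\<close>.  Vectors are functions on the integers that are only
  evaluated on the relevant centred index set.  Matrices are matrices of the library, whose rows
  and columns are numbered from 0; \<open>cmat\<close> and \<open>entry\<close> translate between centred
  and zero-based indices.  All dimensions occurring below are odd.
\<close>

definition cset :: "nat \<Rightarrow> int set" where
  "cset n = {j. (1 - real n) / 2 \<le> of_int j \<and> of_int j \<le> (real n - 1) / 2}"

definition offset :: "nat \<Rightarrow> int" where
  "offset n = (int n - 1) div 2"

definition cmat :: "nat \<Rightarrow> nat \<Rightarrow> (int \<Rightarrow> int \<Rightarrow> complex) \<Rightarrow> complex mat" where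
  "cmat m n g = Matrix.mat m n (\<lambda>(i, j). g (int i - offset m) (int j - offset n))"

definition entry :: "complex mat \<Rightarrow> int \<Rightarrow> int \<Rightarrow> complex" where
  "entry A j k = A $$ (nat (j + offset (dim_row A)), nat (k + offset (dim_col A)))"

definition frobenius_norm :: "complex mat \<Rightarrow> real" where
  "frobenius_norm A = sqrt (\<Sum>i<dim_row A. \<Sum>j<dim_col A. (cmod (A $$ (i, j)))\<^sup>2)"

text \<open>
  For a matrix with at least as many rows as columns, the singular values are the square roots of
  the eigenvalues of \<open>A\<^sup>* A\<close>.
\<close>

definition singular_values :: "complex mat \<Rightarrow> real set" where
  "singular_values A =
     {\<sigma>. 0 \<le> \<sigma> \<and> eigenvalue (mat_adjoint A * A) (complex_of_real (\<sigma>\<^sup>2))}"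

definition sigma_min :: "complex mat \<Rightarrow> real" where
  "sigma_min A = Min (singular_values A)"

definition left_pinv :: "complex mat \<Rightarrow> complex mat" where
  "left_pinv A = the (mat_inverse (mat_adjoint A * A)) * mat_adjoint A"


definition dft_coeff :: "nat \<Rightarrow> int \<Rightarrow> int \<Rightarrow> complex" where
  "dft_coeff n j k = complex_of_real (1 / real n) * cis (- (2 * pi * of_int (j * k) / real n))"

definition dft_mat :: "nat \<Rightarrow> complex mat" where
  "dft_mat n = cmat n n (dft_coeff n)"

definition dft :: "nat \<Rightarrow> (int \<Rightarrow> complex) \<Rightarrow> int \<Rightarrow> complex" where
  "dft d u j = (\<Sum>k\<in>cset d. dft_coeff d j k * u k)"

text \<open>The index \<open>p + l\<close> is reduced modulo \<open>d\<close> to its representative in \<open>cset d\<close>.\<close>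

definition shift :: "nat \<Rightarrow> int \<Rightarrow> (int \<Rightarrow> complex) \<Rightarrow> int \<Rightarrow> complex" where
  "shift d l u p = u ((p + l + offset d) mod int d - offset d)"

definition measurement ::
  "nat \<Rightarrow> (real \<Rightarrow> complex) \<Rightarrow> (real \<Rightarrow> complex) \<Rightarrow> (int \<Rightarrow> int \<Rightarrow> complex) \<Rightarrow> int \<Rightarrow> int \<Rightarrow> complex"
  where
  "measurement d m f \<eta> \<omega> l =
     complex_of_real
       ((cmod (LBINT x. f x * m (x - 2 * pi / real d * of_int l) * cis (- (x * of_int \<omega>))))\<^sup>2)
     + \<eta> \<omega> l"

text \<open>Used only when \<open>K\<close> divides \<open>d\<close>, so that the integer division is exact.\<close>

definition subsample :: "nat \<Rightarrow> nat \<Rightarrow> (int \<Rightarrow> int \<Rightarrow> complex) \<Rightarrow> complex mat" where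
  "subsample K d M = cmat K d (\<lambda>\<omega> l. M (\<omega> * int d div int K) l)"

definition mask_samples :: "nat \<Rightarrow> (real \<Rightarrow> complex) \<Rightarrow> int \<Rightarrow> complex" where
  "mask_samples d m p = m (2 * pi * of_int p / real d)"

definition mask_transform :: "nat \<Rightarrow> (real \<Rightarrow> complex) \<Rightarrow> int \<Rightarrow> int \<Rightarrow> complex" where
  "mask_transform d m l \<omega> =
     (let zh = dft d (mask_samples d m)
      in dft d (\<lambda>p. zh p * shift d l (\<lambda>q. cnj (zh q)) p) \<omega>)"

definition mu2 :: "nat \<Rightarrow> nat \<Rightarrow> nat \<Rightarrow> (real \<Rightarrow> complex) \<Rightarrow> real" where
  "mu2 d \<kappa> s m =
     Min ((\<lambda>(\<omega>, l). cmod (mask_transform d m l \<omega>)) ` (cset (2 * \<kappa> - 1) \<times> cset (2 * s - 1)))"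

definition W_mat :: "nat \<Rightarrow> nat \<Rightarrow> nat \<Rightarrow> complex mat" where
  "W_mat d \<kappa> s = cmat (2 * \<kappa> - 1) s (dft_coeff d)"


text \<open>
  \<open>selection_path a \<beta> \<gamma> n c ns\<close>: started at the index \<open>c\<close>, entry selection with
  target \<open>n\<close> can produce the sequence \<open>ns\<close> (whose head is \<open>c\<close>).  Ties between
  maximizers make this a relation rather than a function.
\<close>

inductive selection_path :: "(int \<Rightarrow> real) \<Rightarrow> int \<Rightarrow> int \<Rightarrow> int \<Rightarrow> int \<Rightarrow> int list \<Rightarrow> bool"
  for a :: "int \<Rightarrow> real" and \<beta> \<gamma> n :: int where
  reached: "selection_path a \<beta> \<gamma> n c [c]"
    if "\<bar>n - c\<bar> < \<gamma>" "c = n"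
| final: "selection_path a \<beta> \<gamma> n c [c, n]"
    if "\<bar>n - c\<bar> < \<gamma>" "c \<noteq> n"
| right: "selection_path a \<beta> \<gamma> n c (c # ns)"
    if "\<bar>n - c\<bar> \<ge> \<gamma>" "n > c"
      "is_arg_max a (\<lambda>m. c + \<gamma> - \<beta> \<le> m \<and> m < c + \<gamma>) c'"
      "selection_path a \<beta> \<gamma> n c' ns"
| left: "selection_path a \<beta> \<gamma> n c (c # ns)"
    if "\<bar>n - c\<bar> \<ge> \<gamma>" "n < c"
      "is_arg_max a (\<lambda>m. c - \<gamma> < m \<and> m \<le> c - \<gamma> + \<beta>) c'"
      "selection_path a \<beta> \<gamma> n c' ns"

definition alg_C ::
  "nat \<Rightarrow> nat \<Rightarrow> nat \<Rightarrow> nat \<Rightarrow> (real \<Rightarrow> complex) \<Rightarrow> complex mat \<Rightarrow> complex mat" where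
  "alg_C d K \<kappa> s m Y =
     (let Yt = dft_mat d * transpose_mat Y * transpose_mat (dft_mat K)
      in cmat (2 * \<kappa> - 1) (2 * s - 1)
           (\<lambda>\<omega> l. complex_of_real (1 / (4 * pi\<^sup>2 * real d)) * entry Yt (- l) \<omega>
                     / mask_transform d m (- l) \<omega>))"

definition Lambda_mat :: "nat \<Rightarrow> nat \<Rightarrow> complex mat \<Rightarrow> complex mat" where
  "Lambda_mat d s V =
     cmat d d (\<lambda>i j. if i \<in> cset s \<and> \<bar>j - i\<bar> \<le> int s - 1 then entry V i (j - i) else 0)"

definition alg_A ::
  "nat \<Rightarrow> nat \<Rightarrow> nat \<Rightarrow> nat \<Rightarrow> (real \<Rightarrow> complex) \<Rightarrow> complex mat \<Rightarrow> complex mat" where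
  "alg_A d K \<kappa> s m Y =
     (let V = left_pinv (W_mat d \<kappa> s) * alg_C d K \<kappa> s m Y;
          L = Lambda_mat d s V
      in (1 / 2) \<cdot>\<^sub>m (L + mat_adjoint L))"

definition alg_magnitude :: "complex mat \<Rightarrow> int \<Rightarrow> real" where
  "alg_magnitude A n = sqrt (cmod (entry A n n))"

definition path_phase :: "complex mat \<Rightarrow> int list \<Rightarrow> real" where
  "path_phase A ns = (\<Sum>i<length ns - 1. Arg (entry A (ns ! Suc i) (ns ! i)))"

text \<open>
  \<open>fe\<close> is an output of the algorithm for some way of breaking ties.  The starting index
  \<open>n0\<close> is common to all target indices.
\<close>

definition alg2_output ::
  "nat \<Rightarrow> nat \<Rightarrow> nat \<Rightarrow> nat \<Rightarrow> nat \<Rightarrow> (real \<Rightarrow> complex) \<Rightarrow> complex mat \<Rightarrow> (real \<Rightarrow> complex) \<Rightarrow> bool"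
  where
  "alg2_output d K \<kappa> s \<beta> m Y fe \<longleftrightarrow>
     (let A = alg_A d K \<kappa> s m Y; a = alg_magnitude A in
      \<exists>n0 ns.
        is_arg_max a (\<lambda>n. n \<in> cset s) n0 \<and>
        (\<forall>n\<in>cset s. selection_path a (int \<beta>) (2 * int s - 1) n n0 (ns n)) \<and>
        fe = (\<lambda>x. \<Sum>n\<in>cset s.
                complex_of_real (a n) * cis (path_phase A (ns n)) * cis (of_int n * x)))"

end

theory Submission
  imports Defs
begin

text \<open>
  Write \<open>x\<^sub>n\<close> for the Fourier coefficients of \<open>f\<close>. Expanding \<open>f\<close> and the mask into absolutely
  convergent Fourier series turns each measurement, up to \<open>O(d\<^sup>-\<^sup>k)\<close>, into the squared modulus of a
  circular convolution of the truncated sequence \<open>x\<close> with the discrete Fourier transform of the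
  mask samples. The narrow support of the samples makes the deconvolution formula of the algorithm
  exact for such data, even after subsampling the frequencies: the aliases of the band of width
  \<open>2\<kappa> - 1\<close> fall where the ambiguity function of the mask vanishes. Hence the noise enters only through
  Parseval's identity, \<open>\<mu>\<^sub>2\<close> and the bound \<open>1/\<sigma>\<close> on the pseudo-inverse of \<open>W\<close>, and each entry of the
  lifted matrix near \<open>x\<^sub>i\<close> times the conjugate of \<open>x\<^sub>j\<close> has error of order
  \<open>(\<parallel>\<eta>\<parallel> + d\<^sup>1\<^sup>-\<^sup>k) / (d\<^sup>2\<mu>\<^sub>2\<sigma>)\<close>. Since the step length \<open>2s - 1\<close> exceeds the diameter of the index set, entry
  selection uses at most one step, from the largest reconstructed magnitude, so synchronization costs
  only a constant factor per coefficient; \<open>s \<le> d\<close> coefficients are summed.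
\<close>

subsection \<open>Trigonometric polynomials and Bessel's inequality\<close>

text \<open>The discrete identities are exact, so the approximation error sits in one place, the
  replacement of the measurement by \<open>model_field\<close>. Two errors occur there: coefficients
  of f outside the index set, and aliases of the mask. In each, the decay of one function is used
  uniformly while the absolute summability of the other controls the sum, which keeps the full rate
  d^-k. An error \<epsilon> in every one of the K times d measurements has Frobenius norm at most d
  \<epsilon>; this is the extra factor d in the entry error.

  Recovering phases is ill-conditioned at small coefficients, and the square root is not Lipschitz
  at 0. Both obstacles disappear when squared errors are estimated: these are linear in the entry
  error.

  The definition of \<open>sigma_min\<close> by eigenvalues does not directly bound the norm of W v
  from below. A minimizer of the Rayleigh quotient is obtained by compactness and shown to be an
  eigenvector, which links the two.\<close>

lemma set_integrable_continuous_pi: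
  fixes f :: "real \<Rightarrow> 'a::{banach, second_countable_topology}"
  assumes "continuous_on UNIV f"
  shows "set_integrable lborel {-pi..pi} f"
  unfolding set_integrable_def
  by (rule borel_integrable_compact) (auto intro: continuous_on_subset[OF assms])

lemma set_integrable_bounded_pi:
  fixes f :: "real \<Rightarrow> 'a::{banach, second_countable_topology}"
  assumes "f \<in> borel_measurable borel" "\<And>x. x \<in> {-pi..pi} \<Longrightarrow> norm (f x) \<le> B"
  shows "set_integrable lborel {-pi..pi} f"
  unfolding set_integrable_def
proof (rule Bochner_Integration.integrable_bound)
  show "integrable lborel (\<lambda>x::real. indicat_real {-pi..pi} x * B)"
    by (intro integrable_mult_left integrable_real_indicator) auto
qed (use assms in \<open>auto simp: indicator_def intro!: AE_I2 order_trans[OF _ abs_ge_self]\<close>)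

lemma cis_derivative:
  "((\<lambda>x. cis (c * x)) has_vector_derivative (\<i> * of_real c * cis (c * x))) (at x within S)"
proof -
  have "((\<lambda>x. exp (\<i> * of_real (c * x))) has_vector_derivative
      (of_real c * \<i> * exp (\<i> * of_real (c * x)))) (at x within S)"
    by (auto intro!: derivative_eq_intros has_vector_derivative_real_field)
  thus ?thesis by (simp add: cis_conv_exp mult_ac)
qed

lemma cis_int_pi: "cis (of_int n * pi) = cis (of_int n * (- pi))"
proof -
  have "cis (of_int n * pi) = cis (of_int n * (- pi)) * cis (2 * pi * of_int n)"
    unfolding cis_mult by (rule arg_cong[where f = cis]) (simp add: algebra_simps)
  thus ?thesis by simp
qed

lemma integral_cis:
  "(LBINT x:{-pi..pi}. cis (of_int n * x)) = (if n = 0 then of_real (2 * pi) else 0)"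
proof (cases "n = 0")
  case True
  then show ?thesis
    by (simp add: set_lebesgue_integral_def scaleR_conv_of_real)
next
  case False
  let ?F = "\<lambda>x. cis (of_int n * x) / (\<i> * of_int n)"
  have "(LBINT x. indicat_real {-pi..pi} x *\<^sub>R cis (of_int n * x)) = ?F pi - ?F (-pi)"
  proof (rule integral_FTC_Icc)
    fix x
    have "(?F has_vector_derivative (\<i> * of_real (of_int n) * cis (of_int n * x)) / (\<i> * of_int n)) (at x within {-pi..pi})"
      by (intro has_vector_derivative_divide cis_derivative)
    thus "(?F has_vector_derivative cis (of_int n * x)) (at x within {-pi..pi})"
      using False by simp
  qed (auto intro!: continuous_intros)
  also have "\<dots> = 0" by (simp add: cis_int_pi del: mult_minus_right)
  finally show ?thesis using False by (simp add: set_lebesgue_integral_def)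
qed

lemma set_integral_sum_pi:
  fixes f :: "'i \<Rightarrow> real \<Rightarrow> 'a::{banach, second_countable_topology}"
  assumes "\<And>i. i \<in> A \<Longrightarrow> set_integrable lborel {-pi..pi} (f i)"
  shows "(LBINT x:{-pi..pi}. (\<Sum>i\<in>A. f i x)) = (\<Sum>i\<in>A. LBINT x:{-pi..pi}. f i x)"
  using assms unfolding set_lebesgue_integral_def set_integrable_def scaleR_sum_right
  by (rule Bochner_Integration.integral_sum)

lemma set_integral_of_real:
  "(LBINT x:A. complex_of_real (f x)) = complex_of_real (LBINT x:A. f x)"
  unfolding set_lebesgue_integral_def
  by (simp flip: integral_complex_of_real add: scaleR_conv_of_real)

lemma trig_norm_expand:
  fixes c :: "int \<Rightarrow> complex"
  shows "complex_of_real ((cmod (\<Sum>n\<in>A. c n * cis (of_int n * x)))\<^sup>2)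
      = (\<Sum>n\<in>A. \<Sum>k\<in>A. c n * cnj (c k) * cis (of_int (n - k) * x))"
proof -
  have "cis (of_int (n - k) * x) = cis (of_int n * x) * cnj (cis (of_int k * x))" for n k
    by (simp add: cis_cnj cis_mult algebra_simps)
  thus ?thesis by (simp add: complex_norm_square sum_product mult_ac del: of_real_power)
qed

lemma trig_poly_parseval:
  fixes c :: "int \<Rightarrow> complex"
  assumes "finite A"
  shows "(LBINT x:{-pi..pi}. (cmod (\<Sum>n\<in>A. c n * cis (of_int n * x)))\<^sup>2)
           = 2 * pi * (\<Sum>n\<in>A. (cmod (c n))\<^sup>2)"
proof -
  have "complex_of_real (LBINT x:{-pi..pi}. (cmod (\<Sum>n\<in>A. c n * cis (of_int n * x)))\<^sup>2)
      = (LBINT x:{-pi..pi}. complex_of_real ((cmod (\<Sum>n\<in>A. c n * cis (of_int n * x)))\<^sup>2))"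
    by (simp only: set_integral_of_real)
  also have "\<dots> = (LBINT x:{-pi..pi}. (\<Sum>n\<in>A. \<Sum>k\<in>A. c n * cnj (c k) * cis (of_int (n - k) * x)))"
    unfolding trig_norm_expand ..
  also have "\<dots> = (\<Sum>n\<in>A. \<Sum>k\<in>A. c n * cnj (c k) * (LBINT x:{-pi..pi}. cis (of_int (n - k) * x)))"
    by (subst set_integral_sum_pi set_integral_mult_right,
        (intro set_integrable_continuous_pi continuous_intros)?)+ simp
  also have "\<dots> = (\<Sum>n\<in>A. \<Sum>k\<in>A. if k = n then of_real (2 * pi) * (c n * cnj (c n)) else 0)"
    unfolding integral_cis by (intro sum.cong refl) auto
  also have "\<dots> = of_real (2 * pi * (\<Sum>n\<in>A. (cmod (c n))\<^sup>2))"
    using assms by (simp add: complex_norm_square sum_distrib_left del: of_real_power)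
  finally show ?thesis using of_real_eq_iff by blast
qed

text \<open>The function is only assumed bounded and measurable because it will be a difference
  quotient, which may be discontinuous at its base point. Expanding the nonnegative integral of |g -
  P|^2, with P the Fourier projection of g, gives the bound.\<close>

lemma bessel:
  assumes g: "g \<in> borel_measurable borel" and B: "\<And>x. x \<in> {-pi..pi} \<Longrightarrow> cmod (g x) \<le> B"
    and A: "finite A"
  shows "(\<Sum>n\<in>A. (cmod (fourier_coeff g n))\<^sup>2) \<le> (LBINT x:{-pi..pi}. (cmod (g x))\<^sup>2) / (2 * pi)"
proof -
  define c where "c = fourier_coeff g"
  define P where "P x = (\<Sum>n\<in>A. c n * cis (of_int n * x))" for x
  have Pc: "continuous_on UNIV P" unfolding P_def by (intro continuous_intros)
  hence Pm[measurable]: "P \<in> borel_measurable borel" by (rule borel_measurable_continuous_onI)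
  have gm[measurable]: "g \<in> borel_measurable borel" by fact
  have [measurable]: "(\<lambda>x. cnj (P x)) \<in> borel_measurable borel"
    by (intro borel_measurable_continuous_onI continuous_intros Pc)
  have Pb: "cmod (P x) \<le> (\<Sum>n\<in>A. cmod (c n))" for x
    unfolding P_def by (rule sum_norm_le) (simp add: norm_mult)
  have B0: "0 \<le> B" using B[of 0] norm_ge_zero[of "g 0"] by (smt (verit) atLeastAtMost_iff pi_gt_zero)
  have i1: "set_integrable lborel {-pi..pi} (\<lambda>x. (cmod (g x))\<^sup>2)"
    by (rule set_integrable_bounded_pi[where B = "B\<^sup>2"]) (auto intro!: power_mono B)
  have i2: "set_integrable lborel {-pi..pi} (\<lambda>x. (cmod (P x))\<^sup>2)"
    by (intro set_integrable_continuous_pi continuous_intros Pc)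
  have [measurable]: "(\<lambda>x. cis (- (of_int n * x))) \<in> borel_measurable borel" for n
    by (intro borel_measurable_continuous_onI continuous_intros)
  have i4: "set_integrable lborel {-pi..pi} (\<lambda>x. g x * cis (- (of_int n * x)))" for n
    by (rule set_integrable_bounded_pi[where B = B]) (auto simp: norm_mult B)
  have i3: "set_integrable lborel {-pi..pi} (\<lambda>x. g x * cnj (P x))"
    by (rule set_integrable_bounded_pi[where B = "B * (\<Sum>n\<in>A. cmod (c n))"])
       (auto simp: norm_mult intro!: mult_mono B Pb B0)
  have i5: "set_integrable lborel {-pi..pi} (\<lambda>x. Re (g x * cnj (P x)))"
    using integrable_Re[OF i3[unfolded set_integrable_def]] by (simp add: set_integrable_def)
  have gP: "(LBINT x:{-pi..pi}. g x * cnj (P x)) = of_real (2 * pi * (\<Sum>n\<in>A. (cmod (c n))\<^sup>2))"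
  proof -
    have "(LBINT x:{-pi..pi}. g x * cnj (P x))
        = (LBINT x:{-pi..pi}. (\<Sum>n\<in>A. cnj (c n) * (g x * cis (- (of_int n * x)))))"
      unfolding P_def by (simp add: sum_distrib_left cis_cnj mult_ac)
    also have "\<dots> = (\<Sum>n\<in>A. cnj (c n) * (LBINT x:{-pi..pi}. g x * cis (- (of_int n * x))))"
      by (subst set_integral_sum_pi) (use i4 in auto)
    also have "\<dots> = (\<Sum>n\<in>A. cnj (c n) * (of_real (2 * pi) * c n))"
      by (simp add: c_def fourier_coeff_def)
    also have "\<dots> = of_real (2 * pi * (\<Sum>n\<in>A. (cmod (c n))\<^sup>2))"
      by (simp add: complex_norm_square sum_distrib_left mult_ac del: of_real_power)
    finally show ?thesis .
  qed
  have "0 \<le> (LBINT x:{-pi..pi}. (cmod (g x - P x))\<^sup>2)"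
    unfolding set_lebesgue_integral_def by (intro integral_nonneg_AE AE_I2) auto
  also have "\<dots> = (LBINT x:{-pi..pi}. ((cmod (g x))\<^sup>2 - 2 * Re (g x * cnj (P x))) + (cmod (P x))\<^sup>2)"
    unfolding cmod_power2 by (simp add: power2_eq_square algebra_simps)
  also have "\<dots> = ((LBINT x:{-pi..pi}. (cmod (g x))\<^sup>2) - 2 * (LBINT x:{-pi..pi}. Re (g x * cnj (P x))))
       + (LBINT x:{-pi..pi}. (cmod (P x))\<^sup>2)"
    using i1 i2 i5 by (simp add: set_integral_add set_integral_diff del: times_complex.sel)
  also have "(LBINT x:{-pi..pi}. Re (g x * cnj (P x))) = Re (LBINT x:{-pi..pi}. g x * cnj (P x))"
    using integral_Re[OF i3[unfolded set_integrable_def]] by (simp add: set_lebesgue_integral_def)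
  also have "(LBINT x:{-pi..pi}. (cmod (P x))\<^sup>2) = 2 * pi * (\<Sum>n\<in>A. (cmod (c n))\<^sup>2)"
    unfolding P_def by (rule trig_poly_parseval[OF A])
  finally show ?thesis unfolding gP by (simp add: c_def field_simps)
qed

subsection \<open>Fourier series of compactly supported smooth functions\<close>

text \<open>Bessel bounds the squares along any enumeration without repetitions, hence the injection
  \<open>h\<close>: the telescoped Fourier sums have one boundary term running to each end of the
  integers.\<close>

lemma fourier_coeff_tendsto_0:
  assumes g: "g \<in> borel_measurable borel" and B: "\<And>x. x \<in> {-pi..pi} \<Longrightarrow> cmod (g x) \<le> B"
    and h: "inj h"
  shows "(\<lambda>N::nat. fourier_coeff g (h N)) \<longlonglongrightarrow> 0"
proof -
  have "summable (\<lambda>N. (cmod (fourier_coeff g (h N)))\<^sup>2)"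
  proof (rule bounded_imp_summable)
    fix n
    have "(\<Sum>N\<le>n. (cmod (fourier_coeff g (h N)))\<^sup>2) = (\<Sum>k\<in>h ` {..n}. (cmod (fourier_coeff g k))\<^sup>2)"
      by (subst sum.reindex) (auto intro: inj_on_subset[OF h])
    also have "\<dots> \<le> (LBINT x:{-pi..pi}. (cmod (g x))\<^sup>2) / (2 * pi)"
      by (rule bessel[OF g B]) auto
    finally show "(\<Sum>N\<le>n. (cmod (fourier_coeff g (h N)))\<^sup>2) \<le> (LBINT x:{-pi..pi}. (cmod (g x))\<^sup>2) / (2 * pi)" .
  qed auto
  hence "(\<lambda>N. (cmod (fourier_coeff g (h N)))\<^sup>2) \<longlonglongrightarrow> 0" by (rule summable_LIMSEQ_zero)
  hence "(\<lambda>N. cmod (fourier_coeff g (h N))) \<longlonglongrightarrow> 0"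
    using tendsto_real_sqrt[of _ 0 sequentially] by fastforce
  thus ?thesis by (rule tendsto_norm_zero_cancel)
qed

section \<open>Chords and arcs on the unit circle; convergence of Fourier partial sums\<close>

text \<open>A weak form of Jordan's inequality. Up to pi/3 the difference sin t - t/2 increases
  because cos t \<ge> 1/2; beyond it, sin u \<ge> sin (pi/3) exceeds pi/4, the largest value of
  u/2.\<close>

lemma half_le_sin:
  assumes "0 \<le> u" "u \<le> pi / 2"
  shows "u / 2 \<le> sin u"
proof (cases "u \<le> pi / 3")
  case True
  have "(\<lambda>t. sin t - t / 2) 0 \<le> (\<lambda>t. sin t - t / 2) u"
  proof (rule DERIV_nonneg_imp_nondecreasing[OF assms(1)])
    fix t assume "0 \<le> t" "t \<le> u"
    hence "cos (pi / 3) \<le> cos t" using True by (intro cos_monotone_0_pi_le) auto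
    moreover have "((\<lambda>t. sin t - t / 2) has_real_derivative cos t - 1 / 2) (at t)"
      by (auto intro!: derivative_eq_intros)
    ultimately show "\<exists>y. ((\<lambda>t. sin t - t / 2) has_real_derivative y) (at t) \<and> 0 \<le> y"
      by (auto simp: cos_60)
  qed
  thus ?thesis by simp
next
  case False
  have "sin (pi / 3) \<le> sin u" using False assms by (intro sin_monotone_2pi_le) auto
  moreover have "sqrt 3 \<ge> 1.7" by (rule real_le_rsqrt) (simp add: power2_eq_square)
  moreover have "pi < 3.2" using pi_approx by simp
  ultimately show ?thesis using assms by (simp add: sin_60)
qed

lemma cmod_cis_diff: "cmod (cis x - cis y) = 2 * \<bar>sin ((x - y) / 2)\<bar>"
proof -
  have "(cmod (cis x - cis y))\<^sup>2 = (cos x - cos y)\<^sup>2 + (sin x - sin y)\<^sup>2"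
    by (simp add: cmod_power2)
  also have "\<dots> = 2 - 2 * cos (x - y)"
  proof -
    have "(cos x - cos y)\<^sup>2 + (sin x - sin y)\<^sup>2 = ((sin x)\<^sup>2 + (cos x)\<^sup>2) + ((sin y)\<^sup>2 + (cos y)\<^sup>2) - 2 * (cos x * cos y + sin x * sin y)"
      by (simp add: power2_eq_square algebra_simps)
    thus ?thesis by (simp add: cos_diff)
  qed
  also have "cos (x - y) = 1 - 2 * (sin ((x - y) / 2))\<^sup>2"
  proof -
    have "2 * ((x - y) / 2) = x - y" by (simp only: mult_2 field_sum_of_halves)
    with cos_double_sin[of "(x - y) / 2"] show ?thesis by (simp only:)
  qed
  finally have "(cmod (cis x - cis y))\<^sup>2 = (2 * \<bar>sin ((x - y) / 2)\<bar>)\<^sup>2" by (simp add: power2_eq_square)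
  thus ?thesis by (rule power2_eq_imp_eq) auto
qed

text \<open>The minimum is the length of the shorter arc between the two points, so chord and arc
  stay comparable across the cut at pi. With u half the distance, the claim is sin u \<ge> min(u, pi
  - u)/2.\<close>

lemma cmod_cis_diff_ge:
  assumes "\<bar>x - y\<bar> \<le> 2 * pi"
  shows "cmod (cis x - cis y) \<ge> min \<bar>x - y\<bar> (2 * pi - \<bar>x - y\<bar>) / 2"
proof -
  define u where "u = \<bar>x - y\<bar> / 2"
  have u: "0 \<le> u" "u \<le> pi" using assms by (auto simp: u_def)
  have "\<bar>sin ((x - y) / 2)\<bar> = sin u"
  proof -
    have "\<bar>sin ((x - y) / 2)\<bar> = \<bar>sin u\<bar>"
    proof (cases "x \<le> y")
      case True
      have "u = - ((x - y) / 2)" using True by (simp add: u_def field_simps)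
      hence "sin u = - sin ((x - y) / 2)" by (simp only: sin_minus)
      thus ?thesis by simp
    qed (simp add: u_def)
    thus ?thesis using sin_ge_zero[OF u] by simp
  qed
  moreover have "sin u \<ge> min u (pi - u) / 2"
  proof (cases "u \<le> pi / 2")
    case True then show ?thesis using half_le_sin[of u] u by auto
  next
    case False then show ?thesis using half_le_sin[of "pi - u"] u by auto
  qed
  ultimately show ?thesis unfolding cmod_cis_diff by (auto simp: u_def min_def field_simps split: if_splits)
qed

text \<open>
  Writing \<open>f - f(x)\<close> as \<open>g\<close> times \<open>cis y - cis x\<close> with \<open>g\<close> bounded makes the partial Fourier sums
  telescope, and the two boundary terms vanish by Bessel's inequality for \<open>g\<close>.
\<close>

lemma fourier_partial_sums_tendsto:
  assumes cont: "continuous_on UNIV f" and lip: "\<And>x y. cmod (f x - f y) \<le> L * \<bar>x - y\<bar>"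
    and zero: "f pi = 0" "f (-pi) = 0" and x: "x \<in> {-pi..pi}"
  shows "(\<lambda>N::nat. \<Sum>n\<in>{- int N..int N}. fourier_coeff f n * cis (of_int n * x)) \<longlonglongrightarrow> f x"
proof -
  define g where "g y = (f y - f x) / (cis y - cis x)" for y
  have [measurable]: "f \<in> borel_measurable borel" "cis \<in> borel_measurable borel"
    "(\<lambda>y. cis (- (of_int n * y))) \<in> borel_measurable borel" for n
    using cont by (auto intro!: borel_measurable_continuous_onI continuous_intros)
  have gm[measurable]: "g \<in> borel_measurable borel" unfolding g_def by measurable
  have L0: "0 \<le> L" using order_trans[OF norm_ge_zero lip[of 1 0]] by simp
  \<comment> \<open>The bound must follow the shorter arc, which may cross the cut: that route goes
    from y to one endpoint and from the other endpoint to x, and f vanishes at both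
    endpoints.\<close>
  have lip2: "cmod (f y - f x) \<le> L * min \<bar>y - x\<bar> (2 * pi - \<bar>y - x\<bar>)" if y: "y \<in> {-pi..pi}" for y
  proof -
    have "cmod (f y - f x) \<le> cmod (f y) + cmod (f x)" by (rule norm_triangle_ineq4)
    also have "\<dots> \<le> L * (2 * pi - \<bar>y - x\<bar>)"
    proof (cases "x \<le> y")
      case True
      have "cmod (f y) \<le> L * \<bar>y - pi\<bar>" "cmod (f x) \<le> L * \<bar>x - (-pi)\<bar>"
        using lip[of y pi] lip[of x "-pi"] zero by auto
      thus ?thesis using True x y by (simp add: algebra_simps)
    next
      case False
      have "cmod (f x) \<le> L * \<bar>x - pi\<bar>" "cmod (f y) \<le> L * \<bar>y - (-pi)\<bar>"
        using lip[of x pi] lip[of y "-pi"] zero by auto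
      thus ?thesis using False x y by (simp add: algebra_simps)
    qed
    finally show ?thesis using lip[of y x] by (simp add: min_def)
  qed
  have gB: "cmod (g y) \<le> 2 * L" if y: "y \<in> {-pi..pi}" for y
  proof -
    have "\<bar>y - x\<bar> \<le> 2 * pi" using x y by (auto simp: abs_le_iff)
    from cmod_cis_diff_ge[OF this]
    have "min \<bar>y - x\<bar> (2 * pi - \<bar>y - x\<bar>) \<le> 2 * cmod (cis y - cis x)" by simp
    hence "L * min \<bar>y - x\<bar> (2 * pi - \<bar>y - x\<bar>) \<le> L * (2 * cmod (cis y - cis x))"
      by (intro mult_left_mono L0)
    hence "cmod (f y - f x) \<le> 2 * L * cmod (cis y - cis x)" using lip2[OF y] by linarith
    thus ?thesis using L0 unfolding g_def norm_divide
      by (cases "cmod (cis y - cis x) = 0") (auto simp: divide_le_eq)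
  qed
  \<comment> \<open>Where cis y = cis x the quotient is 0 by the convention on division; the arc
    bound forces f y = f x there, so the factorization holds at every point.\<close>
  have geq: "f y - f x = g y * (cis y - cis x)" if y: "y \<in> {-pi..pi}" for y
  proof (cases "cis y = cis x")
    case True
    moreover have "\<bar>y - x\<bar> \<le> 2 * pi" using x y by (auto simp: abs_le_iff)
    ultimately have "min \<bar>y - x\<bar> (2 * pi - \<bar>y - x\<bar>) \<le> 0" using cmod_cis_diff_ge[of y x] by simp
    hence "L * min \<bar>y - x\<bar> (2 * pi - \<bar>y - x\<bar>) \<le> 0" using L0 by (intro mult_nonneg_nonpos)
    hence "cmod (f y - f x) \<le> 0" using lip2[OF y] by linarith
    hence "f y - f x = 0" by simp
    thus ?thesis using True by simp
  qed (simp add: g_def)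
  \<comment> \<open>Coefficient n of g times (cis y - cis x) is coefficient n - 1 of g minus cis x
    times coefficient n. The phase of index n + 1 makes both parts, after multiplication by cis (n
    x), values of one sequence.\<close>
  define u where "u n = cis (of_int (n + 1) * x) * fourier_coeff g n" for n :: int
  have ig: "set_integrable lborel {-pi..pi} (\<lambda>y. g y * cis (- (of_int n * y)))" for n
    by (rule set_integrable_bounded_pi[where B = "2 * L"]) (auto simp: norm_mult gB)
  have if': "set_integrable lborel {-pi..pi} (\<lambda>y. f y * cis (- (of_int n * y)))" for n
    by (intro set_integrable_continuous_pi continuous_intros cont)
  have ic: "set_integrable lborel {-pi..pi} (\<lambda>y. f x * cis (- (of_int n * y)))" for n
    by (intro set_integrable_continuous_pi continuous_intros)
  have step: "fourier_coeff f n * cis (of_int n * x) = (if n = 0 then f x else 0) + (u (n - 1) - u n)" for n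
  proof -
    have "(LBINT y:{-pi..pi}. f y * cis (- (of_int n * y))) - (LBINT y:{-pi..pi}. f x * cis (- (of_int n * y)))
        = (LBINT y:{-pi..pi}. f y * cis (- (of_int n * y)) - f x * cis (- (of_int n * y)))"
      using if' ic by (simp add: set_integral_diff)
    also have "\<dots> = (LBINT y:{-pi..pi}. g y * cis (- (of_int (n - 1) * y)) - cis x * (g y * cis (- (of_int n * y))))"
    proof (rule set_lebesgue_integral_cong)
      show "\<forall>y. y \<in> {-pi..pi} \<longrightarrow> f y * cis (- (of_int n * y)) - f x * cis (- (of_int n * y))
        = g y * cis (- (of_int (n - 1) * y)) - cis x * (g y * cis (- (of_int n * y)))"
      proof (intro allI impI)
        fix y assume y: "y \<in> {-pi..pi}"
        have e: "cis (- (of_int (n - 1) * y)) = cis y * cis (- (of_int n * y))"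
          by (simp add: cis_mult algebra_simps)
        show "f y * cis (- (of_int n * y)) - f x * cis (- (of_int n * y))
          = g y * cis (- (of_int (n - 1) * y)) - cis x * (g y * cis (- (of_int n * y)))"
          unfolding e using arg_cong[OF geq[OF y], of "\<lambda>z. z * cis (- (of_int n * y))"]
          by (simp add: algebra_simps)
      qed
    qed auto
    also have "\<dots> = (LBINT y:{-pi..pi}. g y * cis (- (of_int (n - 1) * y))) - cis x * (LBINT y:{-pi..pi}. g y * cis (- (of_int n * y)))"
      using ig[of n] ig[of "n - 1"] by (simp add: set_integral_diff)
    finally have "fourier_coeff f n - f x * (LBINT y:{-pi..pi}. cis (of_int (- n) * y)) / of_real (2 * pi)
       = fourier_coeff g (n - 1) - cis x * fourier_coeff g n"
      by (simp add: fourier_coeff_def divide_simps)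
    hence A: "fourier_coeff f n = (if n = 0 then f x else 0) + (fourier_coeff g (n - 1) - cis x * fourier_coeff g n)"
      unfolding integral_cis by (auto simp: algebra_simps split: if_splits)
    have E: "cis (of_int (n + 1) * x) = cis x * cis (of_int n * x)"
      by (simp add: cis_mult algebra_simps)
    show ?thesis unfolding u_def diff_add_cancel A E by (auto simp: algebra_simps)
  qed
  have tele: "(\<Sum>n\<in>{- int N..int N}. u (n - 1) - u n) = u (- int N - 1) - u (int N)" for N
  proof (induction N)
    case (Suc N)
    have e: "{- int (Suc N)..int (Suc N)} = insert (int (Suc N)) (insert (- int (Suc N)) {- int N..int N})"
      by auto
    have h: "- int N - 1 = - 1 - int N" by simp
    show ?case unfolding e using Suc[unfolded h] by (simp add: algebra_simps)
  qed simp
  have S: "(\<Sum>n\<in>{- int N..int N}. fourier_coeff f n * cis (of_int n * x)) = f x + (u (- int N - 1) - u (int N))" for N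
    unfolding step sum.distrib tele by simp
  have u0: "(\<lambda>N. u (h N)) \<longlonglongrightarrow> 0" if h: "inj h" for h :: "nat \<Rightarrow> int"
  proof (rule tendsto_norm_zero_cancel)
    show "(\<lambda>N. cmod (u (h N))) \<longlonglongrightarrow> 0"
      using tendsto_norm_zero[OF fourier_coeff_tendsto_0[OF gm gB h]] by (simp add: u_def norm_mult)
  qed
  have "(\<lambda>N. u (- int N - 1)) \<longlonglongrightarrow> 0" by (rule u0) (simp add: inj_def)
  moreover have "(\<lambda>N. u (int N)) \<longlonglongrightarrow> 0" by (rule u0) (simp add: inj_def)
  ultimately have "(\<lambda>N. f x + (u (- int N - 1) - u (int N))) \<longlonglongrightarrow> f x + (0 - 0)"
    by (intro tendsto_add tendsto_diff tendsto_const)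
  thus ?thesis unfolding S by simp
qed

section \<open>Supports, smoothness and decay of Fourier coefficients\<close>

lemma supp_zero: "x \<notin> supp f \<Longrightarrow> f x = 0"
  using closure_subset[of "support_on UNIV f"] by (auto simp: supp_def support_on_def)

lemma supp_vector_derivative: "supp (\<lambda>x. vector_derivative f (at x)) \<subseteq> supp f"
proof -
  have o: "open (- supp f)" by (simp add: supp_def open_Compl)
  have "vector_derivative f (at x) = 0" if x: "x \<notin> supp f" for x
  proof -
    have "(f has_vector_derivative 0) (at x)"
    proof (rule has_vector_derivative_transform_within_open[OF _ o])
      show "((\<lambda>_. 0) has_vector_derivative 0) (at x)" by (rule has_vector_derivative_const)
      show "x \<in> - supp f" using x by simp
      show "0 = f y" if "y \<in> - supp f" for y using supp_zero[of y f] that by simp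
    qed
    thus ?thesis by (rule vector_derivative_at)
  qed
  hence "support_on UNIV (\<lambda>x. vector_derivative f (at x)) \<subseteq> supp f"
    unfolding support_on_def by blast
  moreover have "closed (supp f)" by (simp add: supp_def)
  ultimately have "closure (support_on UNIV (\<lambda>x. vector_derivative f (at x))) \<subseteq> supp f"
    by (rule closure_minimal)
  thus ?thesis by (simp only: supp_def)
qed

lemma C_smooth_continuous: "C_smooth k f \<Longrightarrow> continuous_on UNIV f"
  by (cases k) (simp_all add: continuous_on_eq_continuous_within differentiable_imp_continuous_within)

lemma C_smooth_mono: "C_smooth k f \<Longrightarrow> j \<le> k \<Longrightarrow> C_smooth j f"
proof (induction j arbitrary: k f)
  case 0
  then show ?case by (simp add: C_smooth_continuous)
next
  case (Suc j)
  then show ?case by (cases k) auto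
qed

lemma compact_support_bounded:
  assumes "continuous_on UNIV f" "supp f \<subseteq> {-pi<..<pi}"
  obtains B where "0 \<le> B" "\<And>x. cmod (f x) \<le> B"
proof -
  have "compact (f ` {-pi..pi})"
    using assms(1) by (intro compact_continuous_image) (auto intro: continuous_on_subset)
  then obtain B where B: "\<And>y. y \<in> f ` {-pi..pi} \<Longrightarrow> cmod y \<le> B"
    by (meson compact_imp_bounded bounded_iff)
  have B0: "0 \<le> B" using order_trans[OF norm_ge_zero B[of "f 0"]] by simp
  moreover have "cmod (f x) \<le> B" for x
  proof (cases "x \<in> {-pi..pi}")
    case False
    hence "f x = 0" using assms(2) by (intro supp_zero) auto
    thus ?thesis using B0 by simp
  qed (use B in auto)
  ultimately show ?thesis using that by blast
qed

lemma fourier_coeff_bound: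
  assumes "continuous_on UNIV f" "\<And>x. x \<in> {-pi..pi} \<Longrightarrow> cmod (f x) \<le> B"
  shows "cmod (fourier_coeff f n) \<le> B"
proof -
  let ?g = "\<lambda>x. f x * cis (- (of_int n * x))"
  have c: "continuous_on UNIV ?g" by (intro continuous_intros assms(1))
  have "cmod (LBINT x:{-pi..pi}. ?g x) \<le> (LBINT x:{-pi..pi}. cmod (?g x))"
    by (rule set_integral_norm_bound[OF set_integrable_continuous_pi[OF c]])
  also have "\<dots> \<le> (LBINT x:{-pi..pi}. B)"
  proof (rule set_integral_mono)
    show "set_integrable lborel {-pi..pi} (\<lambda>x. cmod (?g x))"
      by (rule set_integrable_continuous_pi[OF continuous_on_norm[OF c]])
    show "set_integrable lborel {-pi..pi} (\<lambda>x. B)"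
      by (rule set_integrable_continuous_pi[OF continuous_on_const])
  qed (use assms(2) in \<open>simp add: norm_mult\<close>)
  also have "\<dots> = 2 * pi * B" by (simp add: set_lebesgue_integral_def)
  finally have "cmod (LBINT x:{-pi..pi}. ?g x) / (2 * pi) \<le> B"
    by (simp add: field_simps)
  thus ?thesis by (simp add: fourier_coeff_def norm_mult norm_divide)
qed

text \<open>Integration by parts, carried out as the fundamental theorem for f times a character;
  the boundary terms vanish since the support lies inside the open interval.\<close>

lemma fourier_coeff_derivative:
  assumes f: "C_smooth (Suc 0) f" and supp: "supp f \<subseteq> {-pi<..<pi}"
  shows "fourier_coeff (\<lambda>x. vector_derivative f (at x)) n = \<i> * of_int n * fourier_coeff f n"
proof -
  let ?D = "\<lambda>x. vector_derivative f (at x)"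
  have c: "continuous_on UNIV f" using C_smooth_continuous f by blast
  have cD: "continuous_on UNIV ?D" using f by simp
  let ?F = "\<lambda>x. f x * cis (- (of_int n * x))"
  let ?F' = "\<lambda>x. ?D x * cis (- (of_int n * x)) - \<i> * of_int n * ?F x"
  have "(LBINT x. indicat_real {-pi..pi} x *\<^sub>R ?F' x) = ?F pi - ?F (-pi)"
  proof (rule integral_FTC_Icc)
    fix x
    have "(f has_vector_derivative ?D x) (at x)"
      using f by (simp add: vector_derivative_works[symmetric])
    hence "(f has_vector_derivative ?D x) (at x within {-pi..pi})"
      by (rule has_vector_derivative_at_within)
    moreover have "((\<lambda>x. cis (- (of_int n * x))) has_vector_derivative
        (- (\<i> * of_int n * cis (- (of_int n * x))))) (at x within {-pi..pi})"
      using cis_derivative[of "- of_int n" x] by simp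
    ultimately have "(?F has_vector_derivative (f x * (- (\<i> * of_int n * cis (- (of_int n * x)))) + ?D x * cis (- (of_int n * x)))) (at x within {-pi..pi})"
      by (rule has_vector_derivative_mult)
    thus "(?F has_vector_derivative ?F' x) (at x within {-pi..pi})"
      by (simp add: algebra_simps)
  qed (auto intro!: continuous_intros continuous_on_subset[OF c] continuous_on_subset[OF cD])
  also have "\<dots> = 0"
  proof -
    have "f pi = 0" "f (-pi) = 0" using supp by (auto intro!: supp_zero)
    thus ?thesis by simp
  qed
  finally have "(LBINT x:{-pi..pi}. ?F' x) = 0" by (simp only: set_lebesgue_integral_def)
  moreover have "(LBINT x:{-pi..pi}. ?F' x)
      = (LBINT x:{-pi..pi}. ?D x * cis (- (of_int n * x))) - (LBINT x:{-pi..pi}. \<i> * of_int n * ?F x)"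
    by (intro set_integral_diff set_integrable_continuous_pi continuous_intros c cD)
  ultimately have "(LBINT x:{-pi..pi}. ?D x * cis (- (of_int n * x))) = \<i> * of_int n * (LBINT x:{-pi..pi}. ?F x)"
    by simp
  thus ?thesis by (simp add: fourier_coeff_def)
qed

text \<open>Each derivative yields one factor |n| and does not enlarge the support. The product form
  needs no exception at n = 0.\<close>

lemma fourier_coeff_decay:
  assumes "C_smooth k f" "supp f \<subseteq> {-pi<..<pi}"
  obtains C where "0 \<le> C" "\<And>n. cmod (fourier_coeff f n) * \<bar>of_int n\<bar> ^ k \<le> C"
proof -
  have "\<exists>C\<ge>0. \<forall>n. cmod (fourier_coeff f n) * \<bar>of_int n\<bar> ^ k \<le> C"
    using assms
  proof (induction k arbitrary: f)
    case 0
    then obtain B where "0 \<le> B" "\<And>x. cmod (f x) \<le> B" using compact_support_bounded by auto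
    thus ?case using fourier_coeff_bound[of f B] 0 by auto
  next
    case (Suc k)
    let ?D = "\<lambda>x. vector_derivative f (at x)"
    obtain C where C: "C \<ge> 0" "\<And>n. cmod (fourier_coeff ?D n) * \<bar>of_int n\<bar> ^ k \<le> C"
    proof -
      have "C_smooth k ?D" "supp ?D \<subseteq> {-pi<..<pi}"
        using Suc.prems order_trans[OF supp_vector_derivative[of f]] by simp_all
      from Suc.IH[OF this] show ?thesis using that by blast
    qed
    have "cmod (fourier_coeff f n) * \<bar>of_int n\<bar> ^ Suc k = cmod (fourier_coeff ?D n) * \<bar>of_int n\<bar> ^ k" for n
    proof -
      have "fourier_coeff ?D n = \<i> * of_int n * fourier_coeff f n"
        by (rule fourier_coeff_derivative[OF C_smooth_mono[OF Suc.prems(1)] Suc.prems(2)]) simp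
      hence "cmod (fourier_coeff ?D n) = \<bar>of_int n\<bar> * cmod (fourier_coeff f n)"
        by (simp only: norm_mult norm_ii norm_of_int mult_1)
      thus ?thesis by (simp only: power_Suc mult_ac)
    qed
    thus ?case using C by (intro exI[of _ C] conjI allI) (simp_all only:)
  qed
  thus ?thesis using that by blast
qed

lemma C_smooth_lipschitz:
  assumes f: "C_smooth (Suc 0) f" and supp: "supp f \<subseteq> {-pi<..<pi}"
  obtains L where "\<And>x y. cmod (f x - f y) \<le> L * \<bar>x - y\<bar>"
proof -
  let ?D = "\<lambda>x. vector_derivative f (at x)"
  obtain B where B: "0 \<le> B" "\<And>x. cmod (?D x) \<le> B"
    using compact_support_bounded[of ?D] f supp supp_vector_derivative[of f] by auto
  have "norm (f x - f y) \<le> B * norm (x - y)" for x y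
  proof (rule differentiable_bound)
    fix z
    have "(f has_vector_derivative ?D z) (at z)"
      using f by (simp add: vector_derivative_works[symmetric])
    thus "(f has_derivative (\<lambda>h. h *\<^sub>R ?D z)) (at z within UNIV)" by (simp add: has_vector_derivative_def)
    have "onorm (\<lambda>h::real. h *\<^sub>R ?D z) \<le> cmod (?D z)"
      by (rule onorm_le) simp
    thus "onorm (\<lambda>h::real. h *\<^sub>R ?D z) \<le> B" using B(2)[of z] by linarith
  qed auto
  thus ?thesis using that by auto
qed

section \<open>Absolutely convergent Fourier series and their tails\<close>

text \<open>Comparison with the telescoping differences 1/m - 1/(m + 1), once for each sign of
  n.\<close>

lemma sum_inverse_squares_ints_le:
  assumes "finite F" "1 \<le> N" "\<And>n. n \<in> F \<Longrightarrow> int N < \<bar>n\<bar>"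
  shows "(\<Sum>n\<in>F. 1 / (of_int n)\<^sup>2) \<le> 2 / real N"
proof -
  define M where "M = Max ((\<lambda>n. nat \<bar>n\<bar>) ` F)"
  have M: "nat \<bar>n\<bar> \<le> M" if "n \<in> F" for n
    unfolding M_def using assms(1) that by (intro Max_ge) auto
  have pos: "(\<Sum>n\<in>{N<..M}. 1 / (real n)\<^sup>2) \<le> 1 / real N" 
  proof (cases "N \<le> M")
    case True
    have "(\<Sum>n\<in>{N<..M}. 1 / (real n)\<^sup>2) \<le> 1 / real N - 1 / real M"
      using True
    proof (induction M rule: dec_induct)
      case (step m)
      have "{N<..Suc m} = insert (Suc m) {N<..m}" using step by auto
      hence "(\<Sum>n\<in>{N<..Suc m}. 1 / (real n)\<^sup>2) = 1 / (real (Suc m))\<^sup>2 + (\<Sum>n\<in>{N<..m}. 1 / (real n)\<^sup>2)"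
        by simp
      moreover have "1 / (real (Suc m))\<^sup>2 \<le> 1 / real m - 1 / real (Suc m)"
      proof -
        have "0 < real m" using step assms by simp
        hence "1 / (real (Suc m) * real (Suc m)) \<le> 1 / (real m * real (Suc m))"
          by (intro divide_left_mono mult_right_mono) auto
        also have "\<dots> = 1 / real m - 1 / real (Suc m)" using \<open>0 < real m\<close> by (simp add: field_simps)
        finally show ?thesis by (simp add: power2_eq_square)
      qed
      ultimately show ?case using step by linarith
    qed simp
    also have "\<dots> \<le> 1 / real N" by simp
    finally show ?thesis .
  qed simp
  have "(\<Sum>n\<in>F. 1 / (of_int n)\<^sup>2) \<le> (\<Sum>n\<in>int ` {N<..M} \<union> (\<lambda>n. - int n) ` {N<..M}. 1 / (real_of_int n)\<^sup>2)"
  proof (rule sum_mono2)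
    show "F \<subseteq> int ` {N<..M} \<union> (\<lambda>n. - int n) ` {N<..M}"
    proof
      fix n assume n: "n \<in> F"
      show "n \<in> int ` {N<..M} \<union> (\<lambda>n. - int n) ` {N<..M}"
      proof (cases "0 \<le> n")
        case True
        hence "nat n \<in> {N<..M}" using assms(3)[OF n] M[OF n] by auto
        thus ?thesis using True by (intro UnI1 image_eqI[of _ _ "nat n"]) auto
      next
        case False
        hence "nat (-n) \<in> {N<..M}" using assms(3)[OF n] M[OF n] by auto
        thus ?thesis using False by (intro UnI2 image_eqI[of _ _ "nat (-n)"]) auto
      qed
    qed
  qed auto
  also have "\<dots> \<le> (\<Sum>n\<in>int ` {N<..M}. 1 / (real_of_int n)\<^sup>2) + (\<Sum>n\<in>(\<lambda>n. - int n) ` {N<..M}. 1 / (real_of_int n)\<^sup>2)"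
    by (subst sum.union_disjoint) auto
  also have "\<dots> = (\<Sum>n\<in>{N<..M}. 1 / (real n)\<^sup>2) + (\<Sum>n\<in>{N<..M}. 1 / (real n)\<^sup>2)"
    by (subst (1 2) sum.reindex) (auto simp: inj_on_def)
  finally show ?thesis using pos by simp
qed

text \<open>The indices -1, 0, 1 contribute 2, since 1/0 = 0, and the rest at most 2; the constant
  is rounded up.\<close>

lemma sum_inverse_squares_ints_le_5:
  assumes "finite F"
  shows "(\<Sum>n\<in>F. 1 / (real_of_int n)\<^sup>2) \<le> 5"
proof -
  have "(\<Sum>n\<in>F. 1 / (real_of_int n)\<^sup>2) \<le> (\<Sum>n\<in>{-1,0,1} \<union> (F - {-1,0,1}). 1 / (real_of_int n)\<^sup>2)"
    using assms by (intro sum_mono2) auto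
  also have "\<dots> = (\<Sum>n\<in>{-1,0,1}. 1 / (real_of_int n)\<^sup>2) + (\<Sum>n\<in>F - {-1,0,1}. 1 / (real_of_int n)\<^sup>2)"
    using assms by (intro sum.union_disjoint) auto
  also have "(\<Sum>n\<in>F - {-1,0,1}. 1 / (real_of_int n)\<^sup>2) \<le> 2 / real 1"
    using assms by (intro sum_inverse_squares_ints_le) auto
  finally show ?thesis by simp
qed

text \<open>Symmetric intervals eventually contain every finite set of integers. Once summability is
  known, their limit therefore has to be the unordered sum.\<close>

lemma has_sum_symmetric_partial_sums:
  fixes g :: "int \<Rightarrow> complex"
  assumes "g summable_on UNIV" "(\<lambda>N::nat. \<Sum>n\<in>{- int N..int N}. g n) \<longlonglongrightarrow> L"
  shows "(g has_sum L) UNIV"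
proof -
  have "(g has_sum infsum g UNIV) UNIV" using assms(1) by (rule has_sum_infsum)
  hence lim: "(sum g \<longlongrightarrow> infsum g UNIV) (finite_subsets_at_top UNIV)" by (simp add: has_sum_def)
  have "filterlim (\<lambda>N::nat. {- int N..int N}) (finite_subsets_at_top UNIV) sequentially"
    unfolding filterlim_finite_subsets_at_top
  proof (intro allI impI)
    fix X :: "int set" assume "finite X \<and> X \<subseteq> UNIV"
    hence fin: "finite X" by simp
    define M where "M = Max ((\<lambda>n. nat \<bar>n\<bar>) ` X)"
    have M: "nat \<bar>n\<bar> \<le> M" if "n \<in> X" for n
      unfolding M_def using fin that by (intro Max_ge) auto
    have "X \<subseteq> {- int N..int N}" if "N \<ge> M" for N
    proof
      fix n assume "n \<in> X"
      from M[OF this] that show "n \<in> {- int N..int N}" by auto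
    qed
    thus "\<forall>\<^sub>F N in sequentially. finite {- int N..int N} \<and> X \<subseteq> {- int N..int N} \<and> {- int N..int N} \<subseteq> UNIV"
      unfolding eventually_sequentially by (intro exI[of _ M]) simp
  qed
  from filterlim_compose[OF lim this] have "infsum g UNIV = L" by (rule LIMSEQ_unique[OF _ assms(2)])
  thus ?thesis using \<open>(g has_sum infsum g UNIV) UNIV\<close> by simp
qed

text \<open>Of the k powers of |n|, two are kept for summability and k - 2 are traded for powers of
  N.\<close>

lemma fourier_coeff_le:
  assumes "cmod (fourier_coeff f n) * \<bar>of_int n\<bar> ^ k \<le> C" "0 < real N" "real N \<le> \<bar>of_int n\<bar>" "2 \<le> k"
  shows "cmod (fourier_coeff f n) \<le> C / real N ^ (k - 2) * (1 / (of_int n)\<^sup>2)"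
proof -
  have n: "0 < \<bar>real_of_int n\<bar>" using assms by linarith
  have k: "k = (k - 2) + 2" using assms by simp
  have "cmod (fourier_coeff f n) * (real N ^ (k - 2) * (of_int n)\<^sup>2)
      \<le> cmod (fourier_coeff f n) * (\<bar>of_int n\<bar> ^ (k - 2) * (of_int n)\<^sup>2)"
    using assms by (intro mult_left_mono mult_right_mono power_mono) auto
  also have "\<dots> = cmod (fourier_coeff f n) * \<bar>of_int n\<bar> ^ k"
    by (subst k, subst power_add) simp
  also have "\<dots> \<le> C" by fact
  finally show ?thesis using n assms by (simp add: field_simps)
qed

lemma fourier_coeff_abs_summable:
  assumes "C_smooth k f" "supp f \<subseteq> {-pi<..<pi}" "2 \<le> k"
  shows "(\<lambda>n. cmod (fourier_coeff f n)) summable_on UNIV"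
proof -
  obtain C where C: "0 \<le> C" "\<And>n. cmod (fourier_coeff f n) * \<bar>of_int n\<bar> ^ k \<le> C"
    using fourier_coeff_decay[OF assms(1,2)] by blast
  have "sum (\<lambda>n. cmod (fourier_coeff f n)) F \<le> cmod (fourier_coeff f 0) + C * 5" if F: "finite F" for F
  proof -
    \<comment> \<open>The term at 0 is added separately because the majorant 1/n^2 evaluates to 0
      there.\<close>
    have "sum (\<lambda>n. cmod (fourier_coeff f n)) F
        \<le> (\<Sum>n\<in>F. (if n = 0 then cmod (fourier_coeff f 0) else 0) + C * (1 / (of_int n)\<^sup>2))"
    proof (rule sum_mono)
      fix n
      show "cmod (fourier_coeff f n) \<le> (if n = 0 then cmod (fourier_coeff f 0) else 0) + C * (1 / (of_int n)\<^sup>2)"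
        using fourier_coeff_le[OF C(2), of 1 n] C(1) assms(3) by (cases "n = 0") auto
    qed
    also have "\<dots> = (\<Sum>n\<in>F. if n = 0 then cmod (fourier_coeff f 0) else 0) + C * (\<Sum>n\<in>F. 1 / (of_int n)\<^sup>2)"
      by (simp add: sum.distrib sum_distrib_left)
    also have "(\<Sum>n\<in>F. if n = 0 then cmod (fourier_coeff f 0) else 0) \<le> cmod (fourier_coeff f 0)"
      using F by simp
    also have "C * (\<Sum>n\<in>F. 1 / (real_of_int n)\<^sup>2) \<le> C * 5"
      using C(1) sum_inverse_squares_ints_le_5[OF F] by (intro mult_left_mono)
    finally show ?thesis by simp
  qed
  thus ?thesis
    by (intro nonneg_bounded_partial_sums_imp_summable_on[where C = "cmod (fourier_coeff f 0) + C * 5"]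
        eventually_finite_subsets_at_top_weakI) auto
qed

lemma fourier_series:
  assumes "C_smooth k f" "supp f \<subseteq> {-pi<..<pi}" "2 \<le> k" "x \<in> {-pi..pi}"
  shows "((\<lambda>n. fourier_coeff f n * cis (of_int n * x)) has_sum f x) UNIV"
proof (rule has_sum_symmetric_partial_sums)
  show "(\<lambda>n. fourier_coeff f n * cis (of_int n * x)) summable_on UNIV"
    by (rule abs_summable_summable) (use fourier_coeff_abs_summable[OF assms(1-3)] in \<open>simp add: norm_mult\<close>)
  obtain L where "\<And>x y. cmod (f x - f y) \<le> L * \<bar>x - y\<bar>"
    using C_smooth_lipschitz[OF C_smooth_mono[OF assms(1)] assms(2)] assms(3) by auto
  moreover have "f pi = 0" "f (-pi) = 0" using assms(2) by (auto intro!: supp_zero)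
  ultimately show "(\<lambda>N::nat. \<Sum>n\<in>{- int N..int N}. fourier_coeff f n * cis (of_int n * x)) \<longlonglongrightarrow> f x"
    using C_smooth_continuous[OF assms(1)] assms(4) by (intro fourier_partial_sums_tendsto) auto
qed

text \<open>The tail of 1/n^2 adds one power of 1/N to the k - 2 from
  \<open>fourier_coeff_le\<close>. Squaring the exponent k - 1 later gives the term with exponent 2k
  - 2.\<close>

lemma fourier_series_truncation:
  assumes "C_smooth k f" "supp f \<subseteq> {-pi<..<pi}" "2 \<le> k" "x \<in> {-pi..pi}" "1 \<le> N"
    and C: "\<And>n. cmod (fourier_coeff f n) * \<bar>of_int n\<bar> ^ k \<le> C"
  shows "cmod (f x - (\<Sum>n\<in>{- int N..int N}. fourier_coeff f n * cis (of_int n * x))) \<le> 2 * C / real N ^ (k - 1)"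
proof -
  let ?g = "\<lambda>n. fourier_coeff f n * cis (of_int n * x)"
  have C0: "0 \<le> C" using order_trans[OF _ C[of 0]] by simp
  have "(?g has_sum (f x - sum ?g {- int N..int N})) (UNIV - {- int N..int N})"
    by (rule has_sum_Diff[OF fourier_series[OF assms(1-4)] has_sum_finite]) auto
  moreover have "(\<lambda>n. cmod (?g n)) summable_on (UNIV - {- int N..int N})"
    using summable_on_subset[OF fourier_coeff_abs_summable[OF assms(1-3)], of "UNIV - {- int N..int N}"]
    by (simp add: norm_mult)
  moreover have "infsum (\<lambda>n. cmod (?g n)) (UNIV - {- int N..int N}) \<le> 2 * C / real N ^ (k - 1)"
  proof (rule infsum_le_finite_sums)
    fix F assume F: "finite F" "F \<subseteq> UNIV - {- int N..int N}"
    have out: "int N < \<bar>n\<bar>" if "n \<in> F" for n using F(2) that by fastforce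
    have "(\<Sum>n\<in>F. cmod (?g n)) \<le> (\<Sum>n\<in>F. C / real N ^ (k - 2) * (1 / (of_int n)\<^sup>2))"
    proof (rule sum_mono)
      fix n assume "n \<in> F"
      hence "real N \<le> \<bar>of_int n\<bar>" using out[of n] by linarith
      thus "cmod (?g n) \<le> C / real N ^ (k - 2) * (1 / (of_int n)\<^sup>2)"
        using fourier_coeff_le[OF C] assms(3,5) by (simp add: norm_mult)
    qed
    also have "\<dots> \<le> C / real N ^ (k - 2) * (2 / real N)"
      unfolding sum_distrib_left[symmetric]
      using C0 by (intro mult_left_mono sum_inverse_squares_ints_le F assms out) auto
    also have "\<dots> = 2 * C / real N ^ (k - 1)"
    proof -
      have "k - 1 = Suc (k - 2)" using assms(3) by simp
      thus ?thesis by (simp add: mult_ac)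
    qed
    finally show "(\<Sum>n\<in>F. cmod (?g n)) \<le> 2 * C / real N ^ (k - 1)" .
  qed fact
  ultimately show ?thesis
    using norm_infsum_bound[of ?g "UNIV - {- int N..int N}"] infsumI by fastforce
qed

text \<open>The Fourier series represents the 2 pi periodic continuation of f, whereas the integral
  runs over the real line with a window around t that may protrude beyond pi. For |x| < b one has |t
  + x| < pi + b < 2 pi - a, and up to there f and its continuation agree. Dominated convergence then
  applies, as the partial sums are bounded by the sum of the moduli of the coefficients.\<close>

lemma measurement_fourier_expansion:
  assumes f: "C_smooth k f" "supp f \<subseteq> {-a<..<a}" and m: "C_smooth k m" "supp m \<subseteq> {-b<..<b}"
    and "2 \<le> k" "0 < a" "0 < b" "a + b < pi" "\<bar>t\<bar> \<le> pi"
  shows "((\<lambda>n. fourier_coeff f n * cis (- (t * of_int (\<omega> - n))) * fourier_coeff m (\<omega> - n))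
     has_sum ((LBINT x. f x * m (x - t) * cis (- (x * of_int \<omega>))) / of_real (2 * pi))) UNIV"
    (is "(?h has_sum _) _")
proof (rule has_sum_symmetric_partial_sums)
  have sf: "supp f \<subseteq> {-pi<..<pi}" and sm: "supp m \<subseteq> {-pi<..<pi}" using assms by auto
  note cf = C_smooth_continuous[OF f(1)] and cm = C_smooth_continuous[OF m(1)]
  obtain B where B: "0 \<le> B" "\<And>x. cmod (m x) \<le> B" using compact_support_bounded[OF cm sm] by blast
  note fs = fourier_coeff_abs_summable[OF f(1) sf assms(5)]
  define M where "M = infsum (\<lambda>n. cmod (fourier_coeff f n)) UNIV"
  have M0: "0 \<le> M" unfolding M_def by (simp add: infsum_nonneg)
  have mB: "cmod (fourier_coeff m n) \<le> B" for n by (rule fourier_coeff_bound[OF cm B(2)])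
  show "?h summable_on UNIV"
  proof (rule abs_summable_summable, rule summable_on_comparison_test)
    show "(\<lambda>n. cmod (fourier_coeff f n) * B) summable_on UNIV" by (intro summable_on_cmult_left fs)
  qed (auto simp: norm_mult intro: mult_left_mono mB)
  define S where "S N y = (\<Sum>n\<in>{- int N..int N}. fourier_coeff f n * cis (of_int n * y))" for N :: nat and y :: real
  have Sc: "continuous_on UNIV (S N)" for N unfolding S_def by (intro continuous_intros)
  have S_bound: "cmod (S N y) \<le> M" for N y
  proof -
    have "cmod (S N y) \<le> (\<Sum>n\<in>{- int N..int N}. cmod (fourier_coeff f n))"
      unfolding S_def by (rule sum_norm_le) (simp add: norm_mult)
    also have "\<dots> \<le> M" unfolding M_def by (intro finite_sum_le_infsum fs) auto
    finally show ?thesis .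
  qed
  have S_lim0: "(\<lambda>N. S N y) \<longlonglongrightarrow> f y" if y: "y \<in> {-pi..pi}" for y
  proof -
    obtain L where "\<And>x y. cmod (f x - f y) \<le> L * \<bar>x - y\<bar>"
      using C_smooth_lipschitz[OF C_smooth_mono[OF f(1)] sf] assms(5) by auto
    moreover have "f pi = 0" "f (-pi) = 0" using sf by (auto intro!: supp_zero)
    ultimately show ?thesis unfolding S_def using cf y by (intro fourier_partial_sums_tendsto) auto
  qed
  have S_per: "S N (y + 2 * pi) = S N y" for N y
  proof -
    have "cis (of_int n * (y + 2 * pi)) = cis (of_int n * y)" for n
    proof -
      have "cis (of_int n * (y + 2 * pi)) = cis (of_int n * y) * cis (2 * pi * of_int n)"
        by (simp add: cis_mult algebra_simps)
      thus ?thesis by simp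
    qed
    thus ?thesis by (simp add: S_def)
  qed
  have f0: "f y = 0" if "a \<le> \<bar>y\<bar>" for y
    using that subsetD[OF f(2), of y] by (intro supp_zero) auto
  have S_lim: "(\<lambda>N. S N y) \<longlonglongrightarrow> f y" if y: "\<bar>y\<bar> < 2 * pi - a" for y
  proof -
    consider "\<bar>y\<bar> \<le> pi" | "pi < y" | "y < - pi" by linarith
    thus ?thesis
    proof cases
      case 1
      hence "y \<in> {-pi..pi}" by (auto simp: abs_le_iff)
      thus ?thesis by (rule S_lim0)
    next
      \<comment> \<open>Moving y back by one period changes nothing: y and its translate both lie
        outside the support of f.\<close>
      case 2
      hence "(\<lambda>N. S N (y - 2 * pi)) \<longlonglongrightarrow> f (y - 2 * pi)" using y assms(6) by (intro S_lim0) auto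
      moreover have "f (y - 2 * pi) = f y" using 2 y assms by (simp add: f0)
      ultimately show ?thesis using S_per[of _ "y - 2 * pi"] by simp
    next
      case 3
      hence "(\<lambda>N. S N (y + 2 * pi)) \<longlonglongrightarrow> f (y + 2 * pi)" using y assms(6) by (intro S_lim0) auto
      moreover have "f (y + 2 * pi) = f y" using 3 y assms by (simp add: f0)
      ultimately show ?thesis using S_per[of _ y] by simp
    qed
  qed
  have m0: "m x = 0" if "b \<le> \<bar>x\<bar>" for x
    using that subsetD[OF m(2), of x] by (intro supp_zero) auto
  define w where "w x = m x * cis (- ((t + x) * of_int \<omega>))" for x
  have wc: "continuous_on UNIV w" unfolding w_def by (intro continuous_intros cm)
  have "(LBINT x. f x * m (x - t) * cis (- (x * of_int \<omega>))) = (LBINT x. f (t + x) * w x)"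
    by (subst lborel_integral_real_affine[of 1 _ t]) (auto simp: w_def mult_ac)
  also have "\<dots> = (LBINT x:{-pi..pi}. f (t + x) * w x)"
    unfolding set_lebesgue_integral_def
    using assms by (intro Bochner_Integration.integral_cong) (auto simp: w_def m0 indicator_def)
  finally have I: "(LBINT x. f x * m (x - t) * cis (- (x * of_int \<omega>))) = (LBINT x:{-pi..pi}. f (t + x) * w x)" .
  have "(\<lambda>N. LBINT x:{-pi..pi}. S N (t + x) * w x) \<longlonglongrightarrow> (LBINT x:{-pi..pi}. f (t + x) * w x)"
    unfolding set_lebesgue_integral_def
  proof (rule Bochner_Integration.integral_dominated_convergence[where w = "\<lambda>x. indicat_real {-pi..pi} x * (M * B)"])
    have "continuous_on UNIV (\<lambda>x. f (t + x) * w x)" "continuous_on UNIV (\<lambda>x. S N (t + x) * w x)" for N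
      by (intro continuous_intros wc continuous_on_compose2[OF cf] continuous_on_compose2[OF Sc]; simp)+
    from this[THEN borel_measurable_continuous_onI]
    have [measurable]: "(\<lambda>x. f (t + x) * w x) \<in> borel_measurable borel"
      "(\<lambda>x. S N (t + x) * w x) \<in> borel_measurable borel" for N by auto
    show "(\<lambda>x. indicat_real {-pi..pi} x *\<^sub>R (f (t + x) * w x)) \<in> borel_measurable lborel" by measurable
    show "(\<lambda>x. indicat_real {-pi..pi} x *\<^sub>R (S N (t + x) * w x)) \<in> borel_measurable lborel" for N by measurable
    show "integrable lborel (\<lambda>x. indicat_real {-pi..pi} x * (M * B))"
      by (intro integrable_mult_left integrable_real_indicator) auto
    show "AE x in lborel. (\<lambda>N. indicat_real {-pi..pi} x *\<^sub>R (S N (t + x) * w x))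
       \<longlonglongrightarrow> indicat_real {-pi..pi} x *\<^sub>R (f (t + x) * w x)"
    proof (rule AE_I2)
      fix x
      show "(\<lambda>N. indicat_real {-pi..pi} x *\<^sub>R (S N (t + x) * w x))
       \<longlonglongrightarrow> indicat_real {-pi..pi} x *\<^sub>R (f (t + x) * w x)"
      proof (cases "b \<le> \<bar>x\<bar>")
        case False
        thus ?thesis using assms by (intro tendsto_intros S_lim) auto
      qed (simp add: w_def m0)
    qed
    show "AE x in lborel. norm (indicat_real {-pi..pi} x *\<^sub>R (S N (t + x) * w x)) \<le> indicat_real {-pi..pi} x * (M * B)" for N
    proof (rule AE_I2)
      fix x
      have "norm (S N (t + x) * w x) \<le> M * B"
        unfolding norm_mult by (intro mult_mono S_bound M0) (auto simp: w_def norm_mult B)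
      thus "norm (indicat_real {-pi..pi} x *\<^sub>R (S N (t + x) * w x)) \<le> indicat_real {-pi..pi} x * (M * B)"
        by (simp add: indicator_def)
    qed
  qed
  moreover have "(LBINT x:{-pi..pi}. S N (t + x) * w x) = of_real (2 * pi) * (\<Sum>n\<in>{- int N..int N}. ?h n)" for N
  proof -
    have "(LBINT x:{-pi..pi}. S N (t + x) * w x)
      = (LBINT x:{-pi..pi}. (\<Sum>n\<in>{- int N..int N}. fourier_coeff f n * cis (- (t * of_int (\<omega> - n))) * (m x * cis (- (of_int (\<omega> - n) * x)))))"
    proof (intro set_lebesgue_integral_cong allI impI)
      fix x
      have "cis (of_int n * (t + x)) * cis (- ((t + x) * of_int \<omega>)) = cis (- (t * of_int (\<omega> - n))) * cis (- (of_int (\<omega> - n) * x))" for n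
        unfolding cis_mult by (rule arg_cong[where f = cis]) (simp add: algebra_simps)
      hence "fourier_coeff f n * cis (of_int n * (t + x)) * w x
         = fourier_coeff f n * cis (- (t * of_int (\<omega> - n))) * (m x * cis (- (of_int (\<omega> - n) * x)))" for n
        unfolding w_def by (metis (no_types, lifting) mult.assoc mult.left_commute)
      thus "S N (t + x) * w x = (\<Sum>n\<in>{- int N..int N}. fourier_coeff f n * cis (- (t * of_int (\<omega> - n))) * (m x * cis (- (of_int (\<omega> - n) * x))))"
        unfolding S_def sum_distrib_right by (intro sum.cong refl)
    qed auto
    also have "\<dots> = (\<Sum>n\<in>{- int N..int N}. fourier_coeff f n * cis (- (t * of_int (\<omega> - n))) * (LBINT x:{-pi..pi}. m x * cis (- (of_int (\<omega> - n) * x))))"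
      by (subst set_integral_sum_pi) (auto intro!: set_integrable_continuous_pi continuous_intros cm)
    also have "\<dots> = of_real (2 * pi) * (\<Sum>n\<in>{- int N..int N}. ?h n)"
      unfolding sum_distrib_left by (intro sum.cong refl) (simp add: fourier_coeff_def)
    finally show ?thesis .
  qed
  ultimately have "(\<lambda>N. of_real (2 * pi) * (\<Sum>n\<in>{- int N..int N}. ?h n) / of_real (2 * pi)) \<longlonglongrightarrow>
     (LBINT x:{-pi..pi}. f (t + x) * w x) / of_real (2 * pi)" by (intro tendsto_divide) auto
  thus "(\<lambda>N. \<Sum>n\<in>{- int N..int N}. ?h n) \<longlonglongrightarrow> (LBINT x. f x * m (x - t) * cis (- (x * of_int \<omega>))) / of_real (2 * pi)"
    unfolding I by simp
qed

subsection \<open>Smallest singular value and left pseudo-inverse\<close>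

unbundle no vec_syntax

definition vec_norm2 :: "complex vec \<Rightarrow> real" where
  "vec_norm2 v = (\<Sum>i<dim_vec v. (cmod (v $ i))\<^sup>2)"

lemma vec_norm2_nonneg: "0 \<le> vec_norm2 v"
  by (simp add: vec_norm2_def sum_nonneg)

lemma vec_norm2_eq_0: "vec_norm2 v = 0 \<longleftrightarrow> v = 0\<^sub>v (dim_vec v)"
proof
  assume "v = 0\<^sub>v (dim_vec v)"
  thus "vec_norm2 v = 0" by (metis (no_types, lifting) vec_norm2_def index_zero_vec(1) lessThan_iff norm_zero power_zero_numeral sum.neutral)
qed (auto simp: vec_norm2_def sum_nonneg_eq_0_iff)

lemma vec_norm2_smult: "vec_norm2 (c \<cdot>\<^sub>v v) = (cmod c)\<^sup>2 * vec_norm2 v"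
  by (simp add: vec_norm2_def norm_mult power_mult_distrib sum_distrib_left)

lemma cscalar_prod_sum:
  "dim_vec w = dim_vec v \<Longrightarrow> v \<bullet>c w = (\<Sum>i<dim_vec v. v $ i * cnj (w $ i))"
  by (simp add: scalar_prod_def lessThan_atLeast0 conjugate_complex_def)

lemma cscalar_prod_self: "v \<bullet>c v = of_real (vec_norm2 v)"
  by (simp add: cscalar_prod_sum vec_norm2_def complex_norm_square del: of_real_power)

lemma vec_norm2_add:
  assumes "v \<in> carrier_vec n" "w \<in> carrier_vec n"
  shows "vec_norm2 (v + of_real t \<cdot>\<^sub>v w) = vec_norm2 v + 2 * t * Re (v \<bullet>c w) + t\<^sup>2 * vec_norm2 w"
proof -
  have "(cmod (a + of_real t * b))\<^sup>2 = (cmod a)\<^sup>2 + 2 * t * Re (a * cnj b) + t\<^sup>2 * (cmod b)\<^sup>2" for a b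
    unfolding cmod_power2 by (simp add: power2_eq_square algebra_simps)
  moreover have "dim_vec v = n" "dim_vec w = n" using assms by auto
  ultimately show ?thesis
    by (simp add: vec_norm2_def cscalar_prod_sum sum.distrib sum_distrib_left distrib_left)
qed

lemma dim_mat_adjoint [simp]: "dim_row (mat_adjoint A) = dim_col A" "dim_col (mat_adjoint A) = dim_row A"
  by (simp_all add: mat_adjoint_def)

lemma mat_adjoint_carrier [simp]: "A \<in> carrier_mat m n \<Longrightarrow> mat_adjoint A \<in> carrier_mat n m"
  by (intro carrier_matI) auto

lemma mat_adjoint_index:
  "i < dim_col A \<Longrightarrow> j < dim_row A \<Longrightarrow> mat_adjoint A $$ (i, j) = cnj (A $$ (j, i) :: complex)"
  by (simp add: mat_adjoint_def mat_of_rows_def conjugate_complex_def)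

lemma mult_mat_vec_index_sum:
  "i < dim_row A \<Longrightarrow> dim_col A = dim_vec v \<Longrightarrow> (A *\<^sub>v v) $ i = (\<Sum>j<dim_vec v. A $$ (i, j) * v $ j)"
  by (simp add: scalar_prod_def lessThan_atLeast0)

lemma mat_adjoint_cscalar_prod:
  fixes A :: "complex mat"
  assumes A: "A \<in> carrier_mat m n" and u: "u \<in> carrier_vec m" and w: "w \<in> carrier_vec n"
  shows "u \<bullet>c (A *\<^sub>v w) = (mat_adjoint A *\<^sub>v u) \<bullet>c w"
proof -
  have d: "dim_row A = m" "dim_col A = n" "dim_vec u = m" "dim_vec w = n" using assms by auto
  have "u \<bullet>c (A *\<^sub>v w) = (\<Sum>i<m. \<Sum>j<n. u $ i * cnj (A $$ (i, j)) * cnj (w $ j))"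
    using d by (simp add: cscalar_prod_sum mult_mat_vec_index_sum sum_distrib_left mult_ac del: index_mult_mat_vec)
  also have "\<dots> = (\<Sum>j<n. \<Sum>i<m. u $ i * cnj (A $$ (i, j)) * cnj (w $ j))" by (rule sum.swap)
  also have "\<dots> = (mat_adjoint A *\<^sub>v u) \<bullet>c w"
    using d by (simp add: cscalar_prod_sum mult_mat_vec_index_sum mat_adjoint_index sum_distrib_left mult_ac del: index_mult_mat_vec)
  finally show ?thesis .
qed

text \<open>Vectors whose dimension is a variable are encoded as functions on the naturals vanishing
  from n on, so that the product topology is available. The sphere is a closed subset of a product
  of compact discs and singletons.\<close>

lemma compact_unit_coordinate_sphere:
  "compact {f :: nat \<Rightarrow> complex. (\<forall>i\<ge>n. f i = 0) \<and> (\<Sum>i<n. (cmod (f i))\<^sup>2) = 1}"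
proof -
  define S where "S = (\<lambda>i. if i < n then cball 0 1 else {0 :: complex})"
  have "compactin (product_topology (\<lambda>i. euclidean) UNIV) (Pi\<^sub>E UNIV S)"
    unfolding compactin_PiE by (auto simp: S_def)
  hence "compact (Pi\<^sub>E UNIV S)"
    by (simp add: euclidean_product_topology)
  moreover have "closed {f :: nat \<Rightarrow> complex. (\<Sum>i<n. (cmod (f i))\<^sup>2) = 1}"
    by (intro closed_Collect_eq continuous_intros continuous_on_product_coordinates)
  ultimately have "compact (Pi\<^sub>E UNIV S \<inter> {f. (\<Sum>i<n. (cmod (f i))\<^sup>2) = 1})"
    by (rule compact_Int_closed)
  also have "Pi\<^sub>E UNIV S \<inter> {f. (\<Sum>i<n. (cmod (f i))\<^sup>2) = 1}
      = {f. (\<forall>i\<ge>n. f i = 0) \<and> (\<Sum>i<n. (cmod (f i))\<^sup>2) = 1}"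
  proof -
    have "cmod (f i) \<le> 1" if "(\<Sum>i<n. (cmod (f i))\<^sup>2) = 1" "i < n" for f i
    proof -
      have "(cmod (f i))\<^sup>2 \<le> (\<Sum>i<n. (cmod (f i))\<^sup>2)" using that by (intro member_le_sum) auto
      hence "(cmod (f i))\<^sup>2 \<le> 1\<^sup>2" using that by simp
      thus ?thesis by (rule power2_le_imp_le) simp
    qed
    note bound = this
    have mem: "f \<in> Pi\<^sub>E UNIV S \<longleftrightarrow> (\<forall>i<n. cmod (f i) \<le> 1) \<and> (\<forall>i\<ge>n. f i = 0)" for f
      by (auto simp: S_def PiE_UNIV_domain Pi_iff not_less)
    show ?thesis
    proof (rule Set.set_eqI)
      fix f
      show "f \<in> Pi\<^sub>E UNIV S \<inter> {f. (\<Sum>i<n. (cmod (f i))\<^sup>2) = 1}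
        \<longleftrightarrow> f \<in> {f. (\<forall>i\<ge>n. f i = 0) \<and> (\<Sum>i<n. (cmod (f i))\<^sup>2) = 1}"
        using bound[of f] mem[of f] by blast
    qed
  qed
  finally show ?thesis .
qed

text \<open>The minimum is attained on the compact unit sphere; homogeneity carries the inequality
  to all vectors.\<close>

lemma rayleigh_minimizer:
  assumes A: "A \<in> carrier_mat m n" and n: "0 < n"
  obtains v where "v \<in> carrier_vec n" "vec_norm2 v = 1"
    "\<And>w. w \<in> carrier_vec n \<Longrightarrow> vec_norm2 (A *\<^sub>v v) * vec_norm2 w \<le> vec_norm2 (A *\<^sub>v w)"
proof -
  define T where "T = {f :: nat \<Rightarrow> complex. (\<forall>i\<ge>n. f i = 0) \<and> (\<Sum>i<n. (cmod (f i))\<^sup>2) = 1}"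
  define q where "q f = (\<Sum>i<m. (cmod (\<Sum>j<n. A $$ (i, j) * f j))\<^sup>2)" for f :: "nat \<Rightarrow> complex"
  have q: "vec_norm2 (A *\<^sub>v v) = q (\<lambda>i. v $ i)" if "v \<in> carrier_vec n" for v
    using A that by (auto simp: vec_norm2_def q_def mult_mat_vec_index_sum simp del: index_mult_mat_vec)
  have "(\<lambda>i. if i = 0 then 1 else 0) \<in> T" using n by (auto simp: T_def sum.delta if_distrib[of cmod] if_distrib[of "\<lambda>x. x\<^sup>2"] cong: if_cong)
  hence "T \<noteq> {}" by blast
  moreover have "compact T" unfolding T_def by (rule compact_unit_coordinate_sphere)
  moreover have "continuous_on T q"
    unfolding q_def
    by (intro continuous_intros continuous_on_subset[OF continuous_on_product_coordinates]) auto
  ultimately obtain f where f: "f \<in> T" "\<And>g. g \<in> T \<Longrightarrow> q f \<le> q g"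
    using continuous_attains_inf by metis
  define v where "v = Matrix.vec n f"
  have qv: "vec_norm2 (A *\<^sub>v v) = q f" 
    by (subst q) (auto simp: v_def q_def)
  show ?thesis
  proof
    show "v \<in> carrier_vec n" by (simp add: v_def)
    show "vec_norm2 v = 1" using f(1) by (simp add: v_def vec_norm2_def T_def)
    fix w :: "complex vec" assume w: "w \<in> carrier_vec n"
    show "vec_norm2 (A *\<^sub>v v) * vec_norm2 w \<le> vec_norm2 (A *\<^sub>v w)"
    proof (cases "vec_norm2 w = 0")
      case True thus ?thesis by (simp add: vec_norm2_nonneg)
    next
      case False
      hence pos: "0 < vec_norm2 w" using vec_norm2_nonneg[of w] by simp
      define c where "c = 1 / sqrt (vec_norm2 w)"
      have c: "c\<^sup>2 * vec_norm2 w = 1" using pos by (simp add: c_def power_divide)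
      define g where "g i = (if i < n then of_real c * w $ i else 0)" for i
      have "(\<Sum>i<n. (cmod (g i))\<^sup>2) = c\<^sup>2 * vec_norm2 w"
        using w by (auto simp: g_def vec_norm2_def norm_mult power_mult_distrib sum_distrib_left)
      hence "g \<in> T" by (simp add: T_def c) (simp add: g_def)
      hence "q f \<le> q g" by (rule f)
      also have "q g = q (\<lambda>i. (of_real c \<cdot>\<^sub>v w) $ i)"
        using w by (auto simp: q_def g_def)
      also have "\<dots> = vec_norm2 (A *\<^sub>v (of_real c \<cdot>\<^sub>v w))" using w by (simp add: q)
      also have "\<dots> = c\<^sup>2 * vec_norm2 (A *\<^sub>v w)"
        using A w by (simp add: mult_mat_vec vec_norm2_smult)
      finally have "q f * vec_norm2 w \<le> c\<^sup>2 * vec_norm2 (A *\<^sub>v w) * vec_norm2 w"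
        using pos by simp
      also have "\<dots> = vec_norm2 (A *\<^sub>v w)" using c by (metis mult.commute mult.left_commute mult.right_neutral)
      finally show ?thesis by (simp add: qv)
    qed
  qed
qed

lemma linear_coefficient_zero:
  fixes r s :: real
  assumes "\<And>t. 0 \<le> 2 * t * r + t\<^sup>2 * s"
  shows "r = 0"
proof (rule ccontr)
  assume r: "r \<noteq> 0"
  \<comment> \<open>This t minimizes the parabola obtained by enlarging s to the positive number |s|
    + 1; the minimum is negative unless r = 0.\<close>
  define t where "t = - r / (\<bar>s\<bar> + 1)"
  have p: "0 < \<bar>s\<bar> + 1" by simp
  have "2 * t * r + t\<^sup>2 * s \<le> 2 * t * r + t\<^sup>2 * (\<bar>s\<bar> + 1)" by (simp add: mult_left_mono)
  also have "\<dots> = - (r\<^sup>2 / (\<bar>s\<bar> + 1))"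
  proof -
    have "t * (\<bar>s\<bar> + 1) = - r" using p by (simp add: t_def)
    moreover have "t\<^sup>2 * (\<bar>s\<bar> + 1) = t * (t * (\<bar>s\<bar> + 1))" by (simp add: power2_eq_square)
    ultimately have "t\<^sup>2 * (\<bar>s\<bar> + 1) = - t * r" by simp
    thus ?thesis by (simp add: t_def power2_eq_square)
  qed
  also have "\<dots> < 0" using r p by simp
  finally show False using assms[of t] by simp
qed

text \<open>The minimum of the Rayleigh quotient is an eigenvalue by first-order optimality, so no
  diagonalization is required.\<close>

lemma rayleigh_minimum_eigenvalue:
  assumes A: "A \<in> carrier_mat m n" and n: "0 < n"
  obtains \<rho> where "0 \<le> \<rho>" "eigenvalue (mat_adjoint A * A) (complex_of_real \<rho>)"
    "\<And>w. w \<in> carrier_vec n \<Longrightarrow> \<rho> * vec_norm2 w \<le> vec_norm2 (A *\<^sub>v w)"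
proof -
  obtain v where v: "v \<in> carrier_vec n" "vec_norm2 v = 1"
    "\<And>w. w \<in> carrier_vec n \<Longrightarrow> vec_norm2 (A *\<^sub>v v) * vec_norm2 w \<le> vec_norm2 (A *\<^sub>v w)"
    using rayleigh_minimizer[OF A n] by blast
  define \<rho> where "\<rho> = vec_norm2 (A *\<^sub>v v)"
  let ?B = "mat_adjoint A * A"
  \<comment> \<open>The direction of variation is the eigenvalue residual itself. The linear
    coefficient of the variation is then the squared norm of g, and its vanishing is the eigenvalue
    equation.\<close>
  define g where "g = ?B *\<^sub>v v - of_real \<rho> \<cdot>\<^sub>v v"
  have B: "?B \<in> carrier_mat n n" by (rule mult_carrier_mat[OF mat_adjoint_carrier[OF A] A])
  have g: "g \<in> carrier_vec n" using B v by (simp add: g_def)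
  have Bv: "?B *\<^sub>v v \<in> carrier_vec n" using B v by simp
  have Av: "A *\<^sub>v w \<in> carrier_vec m" if "w \<in> carrier_vec n" for w using A that by simp
  have "0 \<le> 2 * t * Re (g \<bullet>c g) + t\<^sup>2 * (vec_norm2 (A *\<^sub>v g) - \<rho> * vec_norm2 g)" for t
  proof -
    have "\<rho> * vec_norm2 (v + of_real t \<cdot>\<^sub>v g) \<le> vec_norm2 (A *\<^sub>v (v + of_real t \<cdot>\<^sub>v g))"
      unfolding \<rho>_def by (rule v) (use v g in simp)
    also have "A *\<^sub>v (v + of_real t \<cdot>\<^sub>v g) = A *\<^sub>v v + of_real t \<cdot>\<^sub>v (A *\<^sub>v g)"
      using A v g by (simp add: mult_add_distrib_mat_vec mult_mat_vec)
    also have "vec_norm2 \<dots> = \<rho> + 2 * t * Re ((A *\<^sub>v v) \<bullet>c (A *\<^sub>v g)) + t\<^sup>2 * vec_norm2 (A *\<^sub>v g)"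
      using vec_norm2_add[OF Av Av, of v g] v g by (simp add: \<rho>_def)
    also have "vec_norm2 (v + of_real t \<cdot>\<^sub>v g) = 1 + 2 * t * Re (v \<bullet>c g) + t\<^sup>2 * vec_norm2 g"
      using vec_norm2_add[OF v(1) g] v by simp
    also have "(A *\<^sub>v v) \<bullet>c (A *\<^sub>v g) = (?B *\<^sub>v v) \<bullet>c g"
      using mat_adjoint_cscalar_prod[OF A Av[OF v(1)] g] assoc_mult_mat_vec[OF mat_adjoint_carrier[OF A] A v(1)] by simp
    finally have "0 \<le> 2 * t * (Re ((?B *\<^sub>v v) \<bullet>c g) - \<rho> * Re (v \<bullet>c g)) + t\<^sup>2 * (vec_norm2 (A *\<^sub>v g) - \<rho> * vec_norm2 g)"
      by (simp add: algebra_simps)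
    also have "Re ((?B *\<^sub>v v) \<bullet>c g) - \<rho> * Re (v \<bullet>c g) = Re (g \<bullet>c g)"
    proof -
      have "g \<bullet>c g = (?B *\<^sub>v v) \<bullet>c g - (of_real \<rho> \<cdot>\<^sub>v v) \<bullet>c g"
        by (subst (1) g_def) (use minus_scalar_prod_distrib[OF Bv, of "of_real \<rho> \<cdot>\<^sub>v v" "conjugate g"] v g in simp)
      thus ?thesis using v g by simp
    qed
    finally show ?thesis .
  qed
  hence "Re (g \<bullet>c g) = 0" by (rule linear_coefficient_zero)
  hence "vec_norm2 g = 0" by (simp add: cscalar_prod_self)
  hence g0: "g = 0\<^sub>v n" using g by (auto simp: vec_norm2_eq_0)
  have eq: "?B *\<^sub>v v = of_real \<rho> \<cdot>\<^sub>v v"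
  proof (rule eq_vecI)
    fix i assume "i < dim_vec (of_real \<rho> \<cdot>\<^sub>v v)"
    hence i: "i < n" using v by simp
    have "g $ i = (?B *\<^sub>v v) $ i - (of_real \<rho> \<cdot>\<^sub>v v) $ i"
      unfolding g_def using i v(1) by (intro index_minus_vec) simp
    thus "(?B *\<^sub>v v) $ i = (of_real \<rho> \<cdot>\<^sub>v v) $ i" using g0 i by simp
  qed (use A Bv v in auto)
  have "v \<noteq> 0\<^sub>v n" using v(2) by (auto simp: vec_norm2_def)
  hence "eigenvector ?B v (of_real \<rho>)" using eq v(1) B by (auto simp: eigenvector_def)
  hence "eigenvalue ?B (of_real \<rho>)" by (auto simp: eigenvalue_def)
  thus ?thesis using that[of \<rho>] v(3) vec_norm2_nonneg by (simp add: \<rho>_def)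
qed

text \<open>Makes the \<open>Min\<close> in \<open>sigma_min\<close> meaningful: squaring embeds the
  singular values into the roots of the characteristic polynomial.\<close>

lemma finite_singular_values: "finite (singular_values A)"
proof -
  let ?B = "mat_adjoint A * A"
  have B: "?B \<in> carrier_mat (dim_col A) (dim_col A)" by auto
  have "char_poly ?B \<noteq> 0" using degree_monic_char_poly[OF B] by auto
  hence "finite {x. poly (char_poly ?B) x = 0}" by (rule poly_roots_finite)
  moreover have "(\<lambda>\<sigma>. complex_of_real (\<sigma>\<^sup>2)) ` singular_values A \<subseteq> {x. poly (char_poly ?B) x = 0}"
    using eigenvalue_root_char_poly[OF B] by (auto simp: singular_values_def simp del: of_real_power)
  ultimately have "finite ((\<lambda>\<sigma>. complex_of_real (\<sigma>\<^sup>2)) ` singular_values A)" by (rule rev_finite_subset)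
  moreover have "inj_on (\<lambda>\<sigma>. complex_of_real (\<sigma>\<^sup>2)) (singular_values A)"
    by (auto simp: inj_on_def singular_values_def power2_eq_iff_nonneg simp del: of_real_power)
  ultimately show ?thesis by (rule finite_imageD)
qed

lemma sqrt_in_singular_values:
  assumes "0 \<le> \<rho>" "eigenvalue (mat_adjoint A * A) (complex_of_real \<rho>)"
  shows "sqrt \<rho> \<in> singular_values A"
  using assms by (simp only: singular_values_def mem_Collect_eq real_sqrt_pow2 real_sqrt_ge_zero simp_thms)

lemma sigma_min_in_singular_values:
  assumes A: "A \<in> carrier_mat m n" and n: "0 < n"
  shows "sigma_min A \<in> singular_values A"
proof -
  obtain \<rho> where \<rho>: "0 \<le> \<rho>" "eigenvalue (mat_adjoint A * A) (complex_of_real \<rho>)"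
    "\<And>w. w \<in> carrier_vec n \<Longrightarrow> \<rho> * vec_norm2 w \<le> vec_norm2 (A *\<^sub>v w)"
    using rayleigh_minimum_eigenvalue[OF A n] by blast
  have "singular_values A \<noteq> {}" using sqrt_in_singular_values[OF \<rho>(1,2)] by blast
  thus ?thesis unfolding sigma_min_def by (rule Min_in[OF finite_singular_values])
qed

text \<open>The square root of the Rayleigh minimum is a singular value, so the smallest singular
  value cannot exceed it.\<close>

lemma sigma_min_bound:
  assumes A: "A \<in> carrier_mat m n" and n: "0 < n" and w: "w \<in> carrier_vec n"
  shows "(sigma_min A)\<^sup>2 * vec_norm2 w \<le> vec_norm2 (A *\<^sub>v w)"
proof -
  obtain \<rho> where l: "0 \<le> \<rho>" "eigenvalue (mat_adjoint A * A) (complex_of_real \<rho>)"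
    "\<And>w. w \<in> carrier_vec n \<Longrightarrow> \<rho> * vec_norm2 w \<le> vec_norm2 (A *\<^sub>v w)"
    using rayleigh_minimum_eigenvalue[OF A n] by blast
  have "sqrt \<rho> \<in> singular_values A" using l(1,2) by (rule sqrt_in_singular_values)
  hence "sigma_min A \<le> sqrt \<rho>" unfolding sigma_min_def by (intro Min_le finite_singular_values)
  moreover have "0 \<le> sigma_min A"
    using sigma_min_in_singular_values[OF A n] by (simp add: singular_values_def)
  ultimately have "(sigma_min A)\<^sup>2 \<le> (sqrt \<rho>)\<^sup>2" by (intro power_mono)
  hence "(sigma_min A)\<^sup>2 * vec_norm2 w \<le> \<rho> * vec_norm2 w"
    using l by (intro mult_right_mono vec_norm2_nonneg) simp
  thus ?thesis using l(3)[OF w] by linarith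
qed

lemma adjoint_mult_injective:
  fixes A :: "complex mat"
  assumes A: "A \<in> carrier_mat m n" and w: "w \<in> carrier_vec n"
    and inj: "\<And>v. v \<in> carrier_vec n \<Longrightarrow> A *\<^sub>v v = 0\<^sub>v m \<Longrightarrow> v = 0\<^sub>v n"
    and z: "(mat_adjoint A * A) *\<^sub>v w = 0\<^sub>v n"
  shows "w = 0\<^sub>v n"
proof (rule inj[OF w])
  have Aw: "A *\<^sub>v w \<in> carrier_vec m" using A w by simp
  have "(A *\<^sub>v w) \<bullet>c (A *\<^sub>v w) = ((mat_adjoint A * A) *\<^sub>v w) \<bullet>c w"
    using mat_adjoint_cscalar_prod[OF A Aw w] assoc_mult_mat_vec[OF mat_adjoint_carrier[OF A] A w] by simp
  also have "\<dots> = 0" unfolding z using w by simp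
  finally have "vec_norm2 (A *\<^sub>v w) = 0" by (simp add: cscalar_prod_self)
  thus "A *\<^sub>v w = 0\<^sub>v m" using Aw by (metis vec_norm2_eq_0 carrier_vecD)
qed

lemma sigma_min_pos:
  assumes A: "A \<in> carrier_mat m n" and n: "0 < n"
    and inj: "\<And>v. v \<in> carrier_vec n \<Longrightarrow> A *\<^sub>v v = 0\<^sub>v m \<Longrightarrow> v = 0\<^sub>v n"
  shows "0 < sigma_min A"
proof -
  have s: "0 \<le> sigma_min A" "eigenvalue (mat_adjoint A * A) (complex_of_real ((sigma_min A)\<^sup>2))"
    using sigma_min_in_singular_values[OF A n] by (auto simp: singular_values_def)
  have "sigma_min A \<noteq> 0"
  proof
    assume "sigma_min A = 0"
    with s(2) obtain v where "eigenvector (mat_adjoint A * A) v 0" by (auto simp: eigenvalue_def)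
    hence v: "v \<in> carrier_vec n" "v \<noteq> 0\<^sub>v n" "(mat_adjoint A * A) *\<^sub>v v = 0 \<cdot>\<^sub>v v"
      using A by (auto simp: eigenvector_def)
    moreover have "0 \<cdot>\<^sub>v v = 0\<^sub>v n" using v(1) by auto
    ultimately show False using adjoint_mult_injective[OF A v(1) inj] by auto
  qed
  thus ?thesis using s(1) by simp
qed

text \<open>Injectivity makes the Gram matrix invertible, so \<open>the\<close> is applied to an
  actual inverse. The last equation is the normal equation, from which the norm bound is
  derived.\<close>

lemma left_pinv_left_inverse:
  assumes A: "A \<in> carrier_mat m n"
    and inj: "\<And>v. v \<in> carrier_vec n \<Longrightarrow> A *\<^sub>v v = 0\<^sub>v m \<Longrightarrow> v = 0\<^sub>v n"
  shows "left_pinv A \<in> carrier_mat n m" "left_pinv A * A = 1\<^sub>m n"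
    "(mat_adjoint A * A) * left_pinv A = mat_adjoint A"
proof -
  let ?B = "mat_adjoint A * A"
  have A': "mat_adjoint A \<in> carrier_mat n m" using A by simp
  have B: "?B \<in> carrier_mat n n" by (rule mult_carrier_mat[OF A' A])
  have "det ?B \<noteq> 0" using det_0_iff_vec_prod_zero[OF B] adjoint_mult_injective[OF A _ inj] by blast
  hence "?B \<in> Units (ring_mat TYPE(complex) n ())" by (rule det_non_zero_imp_unit[OF B])
  then obtain C where C: "mat_inverse ?B = Some C"
    using mat_inverse(1)[OF B, where b = "()"] by (cases "mat_inverse ?B") auto
  note C' = mat_inverse(2)[OF B C]
  have P: "left_pinv A = C * mat_adjoint A" by (simp add: left_pinv_def C)
  show "left_pinv A \<in> carrier_mat n m" unfolding P by (rule mult_carrier_mat[OF _ A']) (use C' in simp)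
  show "left_pinv A * A = 1\<^sub>m n" unfolding P using C' A A' by (subst assoc_mult_mat[of C n n _ m _ n]) auto
  show "?B * left_pinv A = mat_adjoint A" unfolding P using C' A A' B
    by (subst assoc_mult_mat[of ?B n n C n "mat_adjoint A" m, symmetric]) auto
qed

text \<open>The hypothesis says that v - w is orthogonal to w; the claim is Pythagoras.\<close>

lemma vec_norm2_le_if_cscalar_prod:
  assumes "v \<in> carrier_vec n" "w \<in> carrier_vec n" "v \<bullet>c w = of_real (vec_norm2 w)"
  shows "vec_norm2 w \<le> vec_norm2 v"
proof -
  have "vec_norm2 (v + of_real (-1) \<cdot>\<^sub>v w) = vec_norm2 v - vec_norm2 w"
    using vec_norm2_add[OF assms(1,2), of "-1"] assms(3) by simp
  thus ?thesis using vec_norm2_nonneg[of "v + of_real (-1) \<cdot>\<^sub>v w"] by simp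
qed

text \<open>By the normal equation, A applied to the pseudo-inverse solution w is the orthogonal
  projection of e onto the range of A. Hence \<sigma> |w| \<le> |A w| \<le> |e|.\<close>

lemma left_pinv_bound:
  assumes A: "A \<in> carrier_mat m n" and n: "0 < n"
    and inj: "\<And>v. v \<in> carrier_vec n \<Longrightarrow> A *\<^sub>v v = 0\<^sub>v m \<Longrightarrow> v = 0\<^sub>v n"
    and e: "e \<in> carrier_vec m"
  shows "(sigma_min A)\<^sup>2 * vec_norm2 (left_pinv A *\<^sub>v e) \<le> vec_norm2 e"
proof -
  note P = left_pinv_left_inverse[OF A inj]
  have A': "mat_adjoint A \<in> carrier_mat n m" using A by simp
  define w where "w = left_pinv A *\<^sub>v e"
  have w: "w \<in> carrier_vec n" using P(1) e by (simp add: w_def)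
  have Aw: "A *\<^sub>v w \<in> carrier_vec m" using A w by simp
  have "(mat_adjoint A * A) *\<^sub>v w = mat_adjoint A *\<^sub>v e"
    unfolding w_def using P(3) A A' e
    by (subst assoc_mult_mat_vec[OF _ P(1) e, symmetric]) auto
  hence "mat_adjoint A *\<^sub>v (A *\<^sub>v w) = mat_adjoint A *\<^sub>v e"
    using assoc_mult_mat_vec[OF A' A w] by simp
  hence "e \<bullet>c (A *\<^sub>v w) = (A *\<^sub>v w) \<bullet>c (A *\<^sub>v w)"
    using mat_adjoint_cscalar_prod[OF A Aw w] mat_adjoint_cscalar_prod[OF A e w] by simp
  hence "vec_norm2 (A *\<^sub>v w) \<le> vec_norm2 e"
    by (intro vec_norm2_le_if_cscalar_prod[OF e Aw]) (simp add: cscalar_prod_self)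
  thus ?thesis using sigma_min_bound[OF A n w] by (simp add: w_def)
qed

subsection \<open>Centred matrices and partial Fourier matrices\<close>

lemma cset_odd: "odd n \<Longrightarrow> cset n = {- offset n..offset n}"
  by (auto simp: cset_def offset_def elim!: oddE)

lemma int_odd_offset: "odd n \<Longrightarrow> int n = 2 * offset n + 1"
  by (auto simp: offset_def elim!: oddE)

lemma offset_nonneg: "odd n \<Longrightarrow> 0 \<le> offset n"
  by (auto simp: offset_def elim!: oddE)

lemma finite_cset [simp]: "finite (cset n)"
proof -
  have "cset n \<subseteq> {- int n..int n}" by (auto simp: cset_def)
  thus ?thesis by (rule finite_subset) simp
qed

lemma cset_uminus: "j \<in> cset n \<Longrightarrow> - j \<in> cset n"
  by (auto simp: cset_def)

lemma cset_reindex: "odd n \<Longrightarrow> (\<Sum>i<n. g (int i - offset n)) = (\<Sum>j\<in>cset n. g j)"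
  using int_odd_offset[of n]
  by (intro sum.reindex_bij_witness[of _ "\<lambda>j. nat (j + offset n)" "\<lambda>i. int i - offset n"])
     (auto simp: cset_odd)

lemma card_cset: "odd n \<Longrightarrow> card (cset n) = n"
  using cset_reindex[of n "\<lambda>_. 1 :: nat"] by simp

lemma cset_of_index: "odd n \<Longrightarrow> i < n \<Longrightarrow> int i - offset n \<in> cset n"
  using int_odd_offset[of n] by (auto simp: cset_odd)

lemma dim_cmat [simp]: "dim_row (cmat m n g) = m" "dim_col (cmat m n g) = n"
  by (simp_all add: cmat_def)

lemma cmat_carrier [simp]: "cmat m n g \<in> carrier_mat m n"
  by (simp add: cmat_def)

lemma entry_cmat: "odd m \<Longrightarrow> odd n \<Longrightarrow> i \<in> cset m \<Longrightarrow> j \<in> cset n \<Longrightarrow> entry (cmat m n g) i j = g i j"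
  using int_odd_offset[of m] int_odd_offset[of n]
  by (auto simp: entry_def cmat_def cset_odd)

lemma cmat_entry: "A \<in> carrier_mat m n \<Longrightarrow> A = cmat m n (entry A)"
  by (rule eq_matI) (auto simp: cmat_def entry_def)

lemma cmat_cong:
  assumes "odd m" "odd n" "\<And>i j. i \<in> cset m \<Longrightarrow> j \<in> cset n \<Longrightarrow> g i j = h i j"
  shows "cmat m n g = cmat m n h"
  using assms by (intro eq_matI) (auto simp: cmat_def cset_of_index)

lemma cmat_mult:
  assumes "odd p"
  shows "cmat m p g * cmat p n h = cmat m n (\<lambda>i j. \<Sum>k\<in>cset p. g i k * h k j)"
proof (rule eq_matI)
  fix i j assume "i < dim_row (cmat m n (\<lambda>i j. \<Sum>k\<in>cset p. g i k * h k j))"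
    "j < dim_col (cmat m n (\<lambda>i j. \<Sum>k\<in>cset p. g i k * h k j))"
  hence ij: "i < m" "j < n" by auto
  have "(cmat m p g * cmat p n h) $$ (i, j)
      = (\<Sum>k<p. g (int i - offset m) (int k - offset p) * h (int k - offset p) (int j - offset n))"
    using ij by (simp add: cmat_def scalar_prod_def lessThan_atLeast0)
  also have "\<dots> = (\<Sum>k\<in>cset p. g (int i - offset m) k * h k (int j - offset n))"
    by (rule cset_reindex[OF assms])
  finally show "(cmat m p g * cmat p n h) $$ (i, j) = cmat m n (\<lambda>i j. \<Sum>k\<in>cset p. g i k * h k j) $$ (i, j)"
    using ij by (simp add: cmat_def)
qed auto

lemma cmat_add: "cmat m n g + cmat m n h = cmat m n (\<lambda>i j. g i j + h i j)"
  by (rule eq_matI) (auto simp: cmat_def)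

lemma cmat_transpose: "transpose_mat (cmat m n g) = cmat n m (\<lambda>i j. g j i)"
  by (rule eq_matI) (auto simp: cmat_def)

lemma cmat_adjoint: "mat_adjoint (cmat m n g) = cmat n m (\<lambda>i j. cnj (g j i))"
  by (rule eq_matI) (auto simp: mat_adjoint_index, auto simp: cmat_def)

lemma frobenius_norm_cmat:
  assumes "odd m" "odd n"
  shows "(frobenius_norm (cmat m n g))\<^sup>2 = (\<Sum>i\<in>cset m. \<Sum>j\<in>cset n. (cmod (g i j))\<^sup>2)"
proof -
  let ?F = "\<lambda>i j. (cmod (g i j))\<^sup>2"
  have "(frobenius_norm (cmat m n g))\<^sup>2 = (\<Sum>i<m. \<Sum>j<n. ?F (int i - offset m) (int j - offset n))"
    by (simp add: frobenius_norm_def sum_nonneg cmat_def)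
  also have "\<dots> = (\<Sum>i<m. \<Sum>j\<in>cset n. ?F (int i - offset m) j)"
    by (intro sum.cong refl) (rule cset_reindex[OF assms(2), of "\<lambda>j. ?F _ j"])
  also have "\<dots> = (\<Sum>i\<in>cset m. \<Sum>j\<in>cset n. ?F i j)"
    by (rule cset_reindex[OF assms(1), of "\<lambda>i. \<Sum>j\<in>cset n. ?F i j"])
  finally show ?thesis .
qed

text \<open>The part W H is recovered exactly, and E passes through the pseudo-inverse column by
  column. An entry is bounded by the norm of its column, so each entry pays only for the error in
  one column and not for the whole matrix.\<close>

lemma left_pinv_recovery:
  assumes odd: "odd m" "odd n" "odd q"
    and inj: "\<And>v. v \<in> carrier_vec n \<Longrightarrow> cmat m n w *\<^sub>v v = 0\<^sub>v m \<Longrightarrow> v = 0\<^sub>v n"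
    and p: "p \<in> cset n" and l: "l \<in> cset q"
  shows "(sigma_min (cmat m n w))\<^sup>2 *
      (cmod (entry (left_pinv (cmat m n w) * cmat m q (\<lambda>\<omega> l. (\<Sum>p\<in>cset n. w \<omega> p * H p l) + E \<omega> l)) p l - H p l))\<^sup>2
    \<le> (\<Sum>\<omega>\<in>cset m. (cmod (E \<omega> l))\<^sup>2)"
proof -
  let ?W = "cmat m n w"
  define P where "P = left_pinv ?W"
  have W: "?W \<in> carrier_mat m n" by simp
  have P: "P \<in> carrier_mat n m" unfolding P_def by (rule left_pinv_left_inverse(1)[OF W inj])
  have PW: "P * ?W = 1\<^sub>m n" unfolding P_def by (rule left_pinv_left_inverse(2)[OF W inj])
  have n: "0 < n" using odd by (simp add: odd_pos)
  have "P * cmat m q (\<lambda>\<omega> l. (\<Sum>p\<in>cset n. w \<omega> p * H p l) + E \<omega> l) = P * (?W * cmat n q H + cmat m q E)"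
    by (simp add: cmat_mult[OF odd(2)] cmat_add)
  also have "\<dots> = P * (?W * cmat n q H) + P * cmat m q E"
    by (rule mult_add_distrib_mat[OF P]) (rule mult_carrier_mat[OF W cmat_carrier], simp)
  also have "P * (?W * cmat n q H) = (P * ?W) * cmat n q H"
    by (rule assoc_mult_mat[OF P W cmat_carrier, symmetric])
  also have "\<dots> = cmat n q H" by (simp add: PW)
  also have "P * cmat m q E = cmat n q (\<lambda>p l. \<Sum>\<omega>\<in>cset m. entry P p \<omega> * E \<omega> l)"
    by (subst cmat_entry[OF P]) (rule cmat_mult[OF odd(1)])
  finally have "entry (P * cmat m q (\<lambda>\<omega> l. (\<Sum>p\<in>cset n. w \<omega> p * H p l) + E \<omega> l)) p l - H p l
      = (\<Sum>\<omega>\<in>cset m. entry P p \<omega> * E \<omega> l)"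
    using odd p l by (simp add: cmat_add entry_cmat)
  moreover have "(sigma_min ?W)\<^sup>2 * (cmod (\<Sum>\<omega>\<in>cset m. entry P p \<omega> * E \<omega> l))\<^sup>2 \<le> (\<Sum>\<omega>\<in>cset m. (cmod (E \<omega> l))\<^sup>2)"
  proof -
    define e where "e = Matrix.vec m (\<lambda>i. E (int i - offset m) l)"
    have e: "e \<in> carrier_vec m" by (simp add: e_def)
    define i where "i = nat (p + offset n)"
    have i: "i < n" "int i - offset n = p" using p int_odd_offset[OF odd(2)] odd by (auto simp: i_def cset_odd)
    have dim: "dim_row P = n" "dim_col P = m" using P by auto
    have "(P *\<^sub>v e) $ i = (\<Sum>k<m. P $$ (i, k) * e $ k)"
      using dim i by (subst mult_mat_vec_index_sum) (auto simp: e_def)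
    also have "\<dots> = (\<Sum>k<m. entry P p (int k - offset m) * E (int k - offset m) l)"
      by (intro sum.cong refl) (simp add: e_def entry_def dim i_def)
    also have "\<dots> = (\<Sum>\<omega>\<in>cset m. entry P p \<omega> * E \<omega> l)" by (rule cset_reindex[OF odd(1)])
    finally have Pi: "(P *\<^sub>v e) $ i = (\<Sum>\<omega>\<in>cset m. entry P p \<omega> * E \<omega> l)" .
    have "(cmod ((P *\<^sub>v e) $ i))\<^sup>2 \<le> vec_norm2 (P *\<^sub>v e)"
      unfolding vec_norm2_def by (rule member_le_sum) (use i dim in auto)
    hence "(sigma_min ?W)\<^sup>2 * (cmod ((P *\<^sub>v e) $ i))\<^sup>2 \<le> (sigma_min ?W)\<^sup>2 * vec_norm2 (P *\<^sub>v e)"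
      by (intro mult_left_mono) auto
    also have "\<dots> \<le> vec_norm2 e" unfolding P_def by (rule left_pinv_bound[OF W n inj e])
    also have "\<dots> = (\<Sum>\<omega>\<in>cset m. (cmod (E \<omega> l))\<^sup>2)"
      unfolding cset_reindex[OF odd(1), symmetric] by (simp add: vec_norm2_def e_def)
    finally show ?thesis by (simp add: Pi)
  qed
  ultimately show ?thesis by (simp add: P_def)
qed

section \<open>Roots of unity: injectivity of the partial Fourier matrix and character sums\<close>

lemma cis_2pi_int_eq_1:
  assumes "0 < n"
  shows "cis (2 * pi * of_int q / real n) = 1 \<longleftrightarrow> int n dvd q"
proof
  assume "cis (2 * pi * of_int q / real n) = 1"
  hence "cos (2 * pi * of_int q / real n) = 1" by (simp add: complex_eq_iff)
  then obtain k :: int where "2 * pi * of_int q / real n = of_int k * 2 * pi"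
    using cos_one_2pi_int by auto
  hence "real_of_int q = of_int (k * int n)" using assms by (simp add: field_simps)
  hence "q = k * int n" by (rule of_int_eq_iff[THEN iffD1])
  thus "int n dvd q" by simp
next
  assume "int n dvd q"
  then obtain k where "q = int n * k" by blast
  hence "2 * pi * of_int q / real n = 2 * pi * of_int k" using assms by simp
  thus "cis (2 * pi * of_int q / real n) = 1" by simp
qed

text \<open>A Vandermonde argument. After a nonzero factor for the centred indexing is removed, a
  kernel vector holds the coefficients of a polynomial of degree below s. It vanishes at 2 \<kappa>
  - 1 \<ge> s nodes, which are distinct roots of unity because 2 \<kappa> - 1 \<le> d.\<close>

lemma W_mat_injective:
  assumes odd: "odd s" and "s \<le> 2 * \<kappa> - 1" "2 * \<kappa> - 1 \<le> d" "0 < \<kappa>"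
    and v: "v \<in> carrier_vec s" and z: "W_mat d \<kappa> s *\<^sub>v v = 0\<^sub>v (2 * \<kappa> - 1)"
  shows "v = 0\<^sub>v s"
proof (rule ccontr)
  assume nz: "v \<noteq> 0\<^sub>v s"
  define c where "c j = cis (- (2 * pi * of_int j / real d))" for j
  have d: "0 < d" using assms by simp
  define p where "p = (\<Sum>i<s. monom (v $ i) i)"
  have coeff: "coeff p i = v $ i" if "i < s" for i
    using that by (simp add: p_def coeff_sum sum.delta)
  obtain i where i: "i < s" "v $ i \<noteq> 0" using nz v by (auto simp: vec_eq_iff)
  have p0: "p \<noteq> 0" using coeff[OF i(1)] i(2) by auto
  have "degree p \<le> s - 1"
    unfolding p_def by (intro degree_sum_le) (auto intro: order_trans[OF degree_monom_le])
  hence deg: "degree p < s" using odd by (cases s) auto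
  have root: "poly p (c j) = 0" if j: "j \<in> cset (2 * \<kappa> - 1)" for j
  proof -
    have o: "odd (2 * \<kappa> - 1)" using assms by simp
    define r where "r = nat (j + offset (2 * \<kappa> - 1))"
    have r: "r < 2 * \<kappa> - 1" "int r - offset (2 * \<kappa> - 1) = j"
      using j int_odd_offset[OF o] o by (auto simp: r_def cset_odd)
    have "0 = (W_mat d \<kappa> s *\<^sub>v v) $ r" using r by (simp add: z)
    also have "\<dots> = (\<Sum>k<s. dft_coeff d j (int k - offset s) * v $ k)"
      using r v by (subst mult_mat_vec_index_sum) (auto simp: W_mat_def cmat_def)
    also have "\<dots> = (\<Sum>k<s. (of_real (1 / real d) * cis (2 * pi * of_int (j * offset s) / real d)) * (v $ k * c j ^ k))"
    proof (rule sum.cong[OF refl])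
      fix k
      have "cis (- (2 * pi * of_int (j * (int k - offset s)) / real d))
          = cis (2 * pi * of_int (j * offset s) / real d) * c j ^ k"
        unfolding c_def Complex.DeMoivre cis_mult
        by (rule arg_cong[where f = cis]) (simp add: algebra_simps diff_divide_distrib)
      thus "dft_coeff d j (int k - offset s) * v $ k
          = (of_real (1 / real d) * cis (2 * pi * of_int (j * offset s) / real d)) * (v $ k * c j ^ k)"
        by (simp add: dft_coeff_def)
    qed
    also have "\<dots> = (of_real (1 / real d) * cis (2 * pi * of_int (j * offset s) / real d)) * poly p (c j)"
      by (simp add: p_def poly_sum poly_monom sum_distrib_left)
    finally show ?thesis using d by simp
  qed
  have inj: "inj_on c (cset (2 * \<kappa> - 1))"
  proof (rule inj_onI)
    fix j k assume jk: "j \<in> cset (2 * \<kappa> - 1)" "k \<in> cset (2 * \<kappa> - 1)" "c j = c k"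
    have "cis (2 * pi * of_int (k - j) / real d) = c j * cis (2 * pi * of_int k / real d)"
      unfolding c_def cis_mult by (rule arg_cong[where f = cis]) (simp add: algebra_simps diff_divide_distrib)
    also have "\<dots> = c k * cis (2 * pi * of_int k / real d)" by (simp only: jk(3))
    also have "\<dots> = 1" unfolding c_def cis_mult by simp
    finally have "int d dvd k - j" using cis_2pi_int_eq_1[OF d] by blast
    moreover have "\<bar>k - j\<bar> < int d"
      using jk assms int_odd_offset[of "2 * \<kappa> - 1"] by (auto simp: cset_odd)
    ultimately show "j = k" using zdvd_imp_le[of "int d" "\<bar>k - j\<bar>"] by auto
  qed
  have "2 * \<kappa> - 1 = card (c ` cset (2 * \<kappa> - 1))" using card_image[OF inj] card_cset[of "2 * \<kappa> - 1"] assms by simp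
  also have "\<dots> \<le> card {x. poly p x = 0}" using root by (intro card_mono poly_roots_finite p0) auto
  also have "\<dots> \<le> degree p" by (rule card_poly_roots_bound[OF p0])
  finally show False using deg assms by linarith
qed

text \<open>For a nontrivial character, multiplying the sum by z 1 - 1 makes it telescope over the
  centred range, and periodicity identifies the two ends.\<close>

lemma sum_cis_cset:
  assumes "odd n"
  shows "(\<Sum>j\<in>cset n. cis (2 * pi * of_int (j * q) / real n)) = (if int n dvd q then of_nat n else 0)"
proof -
  have n: "0 < n" using assms by (simp add: odd_pos)
  define z where "z j = cis (2 * pi * of_int (j * q) / real n)" for j :: int
  have z1: "z (j + 1) = z j * z 1" for j
    unfolding z_def cis_mult by (rule arg_cong[where f = cis]) (simp add: algebra_simps add_divide_distrib)
  have per: "z (offset n + 1) = z (- offset n)"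
  proof -
    have "2 * pi * of_int ((offset n + 1) * q) / real n = 2 * pi * of_int (- offset n * q) / real n + 2 * pi * of_int q"
      using arg_cong[OF int_odd_offset[OF assms], of real_of_int] n by (simp add: field_simps)
    hence "z (offset n + 1) = z (- offset n) * cis (2 * pi * of_int q)" unfolding z_def cis_mult by simp
    thus ?thesis by simp
  qed
  show ?thesis
  proof (cases "int n dvd q")
    case True
    have "z j = 1" for j
    proof -
      have "int n dvd j * q" using True by simp
      thus ?thesis unfolding z_def using cis_2pi_int_eq_1[OF n] by blast
    qed
    hence "(\<Sum>j\<in>cset n. z j) = of_nat n" using assms by (simp add: card_cset)
    thus ?thesis using True by (simp add: z_def)
  next
    case False
    have tele: "(\<Sum>j\<in>{a..a + int k}. z (j + 1) - z j) = z (a + int k + 1) - z a" for a k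
    proof (induction k)
      case (Suc k)
      have "{a..a + int (Suc k)} = insert (a + int (Suc k)) {a..a + int k}" by auto
      thus ?case using Suc by (simp add: add_ac)
    qed simp
    have "(z 1 - 1) * (\<Sum>j\<in>cset n. z j) = (\<Sum>j\<in>cset n. z (j + 1) - z j)"
      unfolding z1 by (simp add: sum_distrib_left algebra_simps)
    also have "\<dots> = z (offset n + 1) - z (- offset n)"
      using tele[of "- offset n" "nat (2 * offset n)"] offset_nonneg[OF assms] by (simp add: cset_odd[OF assms])
    also have "\<dots> = 0" by (simp add: per)
    finally have "(z 1 - 1) * (\<Sum>j\<in>cset n. z j) = 0" .
    moreover have "z 1 \<noteq> 1" unfolding z_def using cis_2pi_int_eq_1[OF n, of q] False by simp
    ultimately show ?thesis using False by (simp add: z_def)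
  qed
qed

lemma sum_scaled_cis_cset:
  assumes "odd n"
  shows "(\<Sum>j\<in>cset n. c * cis (2 * pi * of_int (j * q) / real n)) = (if int n dvd q then c * of_nat n else 0)"
  unfolding sum_distrib_left[symmetric] sum_cis_cset[OF assms] by simp

lemma cis_add_2pi_int: "cis (x + 2 * pi * of_int n) = cis x"
  by (simp flip: cis_mult)

subsection \<open>Discrete deconvolution\<close>

lemma dft_coeff_period: "0 < d \<Longrightarrow> dft_coeff d (j + int d * r) k = dft_coeff d j k"
proof -
  assume d: "0 < d"
  have "- (2 * pi * of_int ((j + int d * r) * k) / real d)
      = - (2 * pi * of_int (j * k) / real d) + 2 * pi * of_int (- (r * k))"
    using d by (simp add: field_simps)
  thus ?thesis unfolding dft_coeff_def by (simp only: cis_add_2pi_int)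
qed

lemma dft_period: "0 < d \<Longrightarrow> dft d u (j + int d * r) = dft d u j"
  by (simp add: dft_def dft_coeff_period)

lemma shift_periodic:
  assumes "0 < d" "\<And>j r. u (j + int d * r) = u j"
  shows "shift d l u p = u (p + l)"
proof -
  have "(p + l + offset d) mod int d = p + l + offset d - int d * ((p + l + offset d) div int d)"
    by (simp add: minus_mult_div_eq_mod)
  hence "(p + l + offset d) mod int d - offset d = p + l + int d * (- ((p + l + offset d) div int d))"
    by simp
  thus ?thesis unfolding shift_def by (simp only: assms(2))
qed

lemma mask_transform_eq:
  assumes "0 < d"
  shows "mask_transform d m l \<omega>
    = (\<Sum>k\<in>cset d. dft_coeff d \<omega> k * (dft d (mask_samples d m) k * cnj (dft d (mask_samples d m) (k + l))))"
proof -
  have "shift d l (\<lambda>q. cnj (dft d (mask_samples d m) q)) p = cnj (dft d (mask_samples d m) (p + l))" for p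
    by (rule shift_periodic[OF assms]) (simp add: dft_period[OF assms])
  thus ?thesis by (simp add: mask_transform_def Let_def dft_def[of d "\<lambda>p. _ p * _ p"])
qed

text \<open>
  The narrow support of the samples \<open>z\<close> makes the subsampled sum alias-free: it takes the same
  value for every admissible subsampling \<open>N\<close>, in particular for \<open>N = d\<close>.
\<close>

lemma subsampled_ambiguity:
  fixes z :: "int \<Rightarrow> complex"
  assumes N: "odd N" "d = N * r" "0 < d"
    and z: "\<And>p p'. p \<in> cset d \<Longrightarrow> p' \<in> cset d \<Longrightarrow> z p \<noteq> 0 \<Longrightarrow> z p' \<noteq> 0 \<Longrightarrow> \<bar>p' - p\<bar> \<le> \<delta>"
    and \<omega>: "\<bar>\<omega>\<bar> + \<delta> < int N"
  shows "(\<Sum>j\<in>cset N. dft_coeff N \<omega> j * (dft d z (j * int r - p) * cnj (dft d z (j * int r - p + l))))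
    = cis (- (2 * pi * of_int (\<omega> * p) / real d)) * of_real (1 / (real d)\<^sup>2) *
      (\<Sum>p1\<in>cset d. \<Sum>p2\<in>cset d. if p2 - p1 = \<omega> then z p1 * cnj (z p2) * cis (2 * pi * of_int (l * p2) / real d) else 0)"
proof -
  have N0: "0 < N" using N by (cases N) auto
  have r0: "0 < r" using N by (cases r) auto
  have dr: "real d = real N * real r" using N by simp
  let ?c = "complex_of_real (1 / (real d)\<^sup>2)"
  have prod: "dft d z q * cnj (dft d z (q + l)) = ?c * (\<Sum>p1\<in>cset d. \<Sum>p2\<in>cset d. z p1 * cnj (z p2) *
      cis (2 * pi * of_int (l * p2) / real d) * cis (2 * pi * of_int (q * (p2 - p1)) / real d))" for q
  proof -
    have e: "dft_coeff d q p1 * z p1 * cnj (dft_coeff d (q + l) p2 * z p2)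
      = ?c * (z p1 * cnj (z p2) * cis (2 * pi * of_int (l * p2) / real d) * cis (2 * pi * of_int (q * (p2 - p1)) / real d))" for p1 p2
    proof -
      have "cis (- (2 * pi * of_int (q * p1) / real d)) * cis (2 * pi * of_int ((q + l) * p2) / real d)
         = cis (2 * pi * of_int (l * p2) / real d) * cis (2 * pi * of_int (q * (p2 - p1)) / real d)"
        unfolding cis_mult by (rule arg_cong[where f = cis]) (simp add: algebra_simps diff_divide_distrib add_divide_distrib)
      moreover have "?c = of_real (1 / real d) * of_real (1 / real d)" by (simp add: power2_eq_square)
      ultimately show ?thesis unfolding dft_coeff_def by (simp add: cis_cnj mult_ac)
    qed
    show ?thesis unfolding dft_def[of d z] cnj_sum sum_product e by (simp add: sum_distrib_left)
  qed
  \<comment> \<open>Summation over j retains the pairs whose difference p2 - p1 is congruent to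
    \<omega> modulo N, and the displacement by p survives only as a phase.\<close>
  have inner: "(\<Sum>j\<in>cset N. dft_coeff N \<omega> j * cis (2 * pi * of_int ((j * int r - p) * (p2 - p1)) / real d))
     = cis (- (2 * pi * of_int ((p2 - p1) * p) / real d)) * (if int N dvd (p2 - p1 - \<omega>) then 1 else 0)" for p1 p2
  proof -
    have e: "dft_coeff N \<omega> j * cis (2 * pi * of_int ((j * int r - p) * (p2 - p1)) / real d)
      = cis (- (2 * pi * of_int ((p2 - p1) * p) / real d)) * of_real (1 / real N) * cis (2 * pi * of_int (j * (p2 - p1 - \<omega>)) / real N)" for j
    proof -
      have "cis (- (2 * pi * of_int (\<omega> * j) / real N)) * cis (2 * pi * of_int ((j * int r - p) * (p2 - p1)) / real d)
        = cis (- (2 * pi * of_int ((p2 - p1) * p) / real d)) * cis (2 * pi * of_int (j * (p2 - p1 - \<omega>)) / real N)"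
        unfolding cis_mult
      proof (rule arg_cong[where f = cis])
        have "2 * pi * of_int ((j * int r - p) * (p2 - p1)) / real d
          = 2 * pi * (of_int (j * (p2 - p1)) / real N - of_int (p * (p2 - p1)) / real d)"
          using N0 r0 unfolding dr by (simp add: field_simps)
        thus "- (2 * pi * of_int (\<omega> * j) / real N) + 2 * pi * of_int ((j * int r - p) * (p2 - p1)) / real d
          = - (2 * pi * of_int ((p2 - p1) * p) / real d) + 2 * pi * of_int (j * (p2 - p1 - \<omega>)) / real N"
          by (simp add: algebra_simps diff_divide_distrib add_divide_distrib)
      qed
      thus ?thesis by (simp add: dft_coeff_def mult_ac)
    qed
    show ?thesis unfolding e sum_scaled_cis_cset[OF N(1)] using N0 by simp
  qed
  \<comment> \<open>Here aliases are excluded: for samples within the support, p2 - p1 - \<omega>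
    has modulus below N, so a multiple of N must be 0.\<close>
  have dvd_iff: "int N dvd (p2 - p1 - \<omega>) \<longleftrightarrow> p2 - p1 = \<omega>" if "\<bar>p2 - p1\<bar> \<le> \<delta>" for p1 p2
  proof
    assume a: "int N dvd p2 - p1 - \<omega>"
    have "\<bar>p2 - p1 - \<omega>\<bar> < int N" using that \<omega> by linarith
    with a show "p2 - p1 = \<omega>" using zdvd_imp_le[of "int N" "\<bar>p2 - p1 - \<omega>\<bar>"] by auto
  qed simp
  have "(\<Sum>j\<in>cset N. dft_coeff N \<omega> j * (dft d z (j * int r - p) * cnj (dft d z (j * int r - p + l))))
     = ?c * (\<Sum>j\<in>cset N. \<Sum>p1\<in>cset d. \<Sum>p2\<in>cset d. z p1 * cnj (z p2) * cis (2 * pi * of_int (l * p2) / real d) *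
        (dft_coeff N \<omega> j * cis (2 * pi * of_int ((j * int r - p) * (p2 - p1)) / real d)))"
    unfolding prod sum_distrib_left by (intro sum.cong refl) (simp only: mult_ac)
  also have "\<dots> = ?c * (\<Sum>p1\<in>cset d. \<Sum>p2\<in>cset d. \<Sum>j\<in>cset N. z p1 * cnj (z p2) * cis (2 * pi * of_int (l * p2) / real d) *
        (dft_coeff N \<omega> j * cis (2 * pi * of_int ((j * int r - p) * (p2 - p1)) / real d)))"
    by (subst sum.swap, subst (2) sum.swap) (rule refl)
  also have "\<dots> = ?c * (\<Sum>p1\<in>cset d. \<Sum>p2\<in>cset d. cis (- (2 * pi * of_int (\<omega> * p) / real d)) *
      (if p2 - p1 = \<omega> then z p1 * cnj (z p2) * cis (2 * pi * of_int (l * p2) / real d) else 0))"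
  proof (intro arg_cong[where f = "\<lambda>x. ?c * x"] sum.cong refl)
    fix p1 p2 assume p: "p1 \<in> cset d" "p2 \<in> cset d"
    show "(\<Sum>j\<in>cset N. z p1 * cnj (z p2) * cis (2 * pi * of_int (l * p2) / real d) *
        (dft_coeff N \<omega> j * cis (2 * pi * of_int ((j * int r - p) * (p2 - p1)) / real d)))
      = cis (- (2 * pi * of_int (\<omega> * p) / real d)) *
      (if p2 - p1 = \<omega> then z p1 * cnj (z p2) * cis (2 * pi * of_int (l * p2) / real d) else 0)"
    proof (cases "z p1 = 0 \<or> z p2 = 0")
      case False
      hence "int N dvd (p2 - p1 - \<omega>) \<longleftrightarrow> p2 - p1 = \<omega>" using z[OF p] by (intro dvd_iff) auto
      thus ?thesis unfolding sum_distrib_left[symmetric] inner by auto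
    qed auto
  qed
  also have "\<dots> = cis (- (2 * pi * of_int (\<omega> * p) / real d)) * ?c *
      (\<Sum>p1\<in>cset d. \<Sum>p2\<in>cset d. if p2 - p1 = \<omega> then z p1 * cnj (z p2) * cis (2 * pi * of_int (l * p2) / real d) else 0)"
    by (simp only: sum_distrib_left[symmetric] mult_ac)
  finally show ?thesis .
qed

text \<open>Apart from the phase, the right-hand side of \<open>subsampled_ambiguity\<close> does
  not involve N. Using it for N and again for the full grid with p = 0, and comparing, identifies
  the subsampled sum.\<close>

lemma subsampled_mask_transform:
  assumes N: "odd d" "d = N * r" and \<omega>: "\<bar>\<omega>\<bar> + \<delta> < int N"
    and z: "\<And>p p'. p \<in> cset d \<Longrightarrow> p' \<in> cset d \<Longrightarrow> mask_samples d m p \<noteq> 0 \<Longrightarrow> mask_samples d m p' \<noteq> 0 \<Longrightarrow> \<bar>p' - p\<bar> \<le> \<delta>"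
  shows "(\<Sum>j\<in>cset N. dft_coeff N \<omega> j * (dft d (mask_samples d m) (j * int r - p) * cnj (dft d (mask_samples d m) (j * int r - p + l))))
    = cis (- (2 * pi * of_int (\<omega> * p) / real d)) * mask_transform d m l \<omega>"
proof -
  have d: "0 < d" using N by (simp add: odd_pos)
  have oN: "odd N" using N by auto
  have "N \<le> d" using N d by (cases r) auto
  hence \<omega>d: "\<bar>\<omega>\<bar> + \<delta> < int d" using \<omega> by linarith
  show ?thesis
    using subsampled_ambiguity[OF oN N(2) d z \<omega>, where p = p and l = l]
      subsampled_ambiguity[OF N(1) _ d z \<omega>d, where r = 1 and p = 0 and l = l]
    by (simp add: mask_transform_eq[OF d])
qed

text \<open>
  Discrete version of the noiseless measurement, with the signal truncated to \<open>cset s\<close> and the mask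
  replaced by its trigonometric interpolant.
\<close>

definition model_field :: "nat \<Rightarrow> nat \<Rightarrow> (int \<Rightarrow> complex) \<Rightarrow> (real \<Rightarrow> complex) \<Rightarrow> int \<Rightarrow> int \<Rightarrow> complex" where
  "model_field d s x m \<omega> l = (\<Sum>p\<in>cset s. x p * cis (- (2 * pi / real d * of_int l * of_int (\<omega> - p))) * dft d (mask_samples d m) (\<omega> - p))"

text \<open>The entry in row \<alpha> and column \<omega> of the transformed data matrix of the
  algorithm, where \<open>M j l\<close> belongs to frequency j and shift l.\<close>

definition dft2 :: "nat \<Rightarrow> nat \<Rightarrow> (int \<Rightarrow> int \<Rightarrow> complex) \<Rightarrow> int \<Rightarrow> int \<Rightarrow> complex" where
  "dft2 d K M \<alpha> \<omega> = (\<Sum>j\<in>cset K. (\<Sum>l\<in>cset d. dft_coeff d \<alpha> l * M j l) * dft_coeff K \<omega> j)"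

text \<open>The transform in the shift variable isolates a single off-diagonal of the lifted matrix.
  The congruence p' = p + l modulo d is an equality since |l + p - p'| < 2 s \<le> d.\<close>

lemma dft_model_field:
  assumes d: "odd d" and s: "odd s" "2 * s \<le> d" and l: "\<bar>l\<bar> < int s"
  shows "(\<Sum>t\<in>cset d. dft_coeff d (- l) t * of_real ((cmod (model_field d s x m \<omega> t))\<^sup>2))
    = (\<Sum>p\<in>cset s. (if p + l \<in> cset s then x p * cnj (x (p + l)) else 0) *
        (dft d (mask_samples d m) (\<omega> - p) * cnj (dft d (mask_samples d m) (\<omega> - p + (- l)))))"
proof -
  define zh where "zh = dft d (mask_samples d m)"
  have d0: "0 < d" using d by (simp add: odd_pos)
  have e: "of_real ((cmod (model_field d s x m \<omega> t))\<^sup>2) = (\<Sum>p\<in>cset s. \<Sum>p'\<in>cset s. x p * cnj (x p') * zh (\<omega> - p) * cnj (zh (\<omega> - p')) *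
       cis (2 * pi * of_int (t * (p - p')) / real d))" for t
  proof -
    have e: "x p * cis (- (2 * pi / real d * of_int t * of_int (\<omega> - p))) * zh (\<omega> - p) * cnj (x p' * cis (- (2 * pi / real d * of_int t * of_int (\<omega> - p'))) * zh (\<omega> - p'))
      = x p * cnj (x p') * zh (\<omega> - p) * cnj (zh (\<omega> - p')) * cis (2 * pi * of_int (t * (p - p')) / real d)" for p p'
    proof -
      have "cis (- (2 * pi / real d * of_int t * of_int (\<omega> - p))) * cis (2 * pi / real d * of_int t * of_int (\<omega> - p')) = cis (2 * pi * of_int (t * (p - p')) / real d)"
        unfolding cis_mult by (rule arg_cong[where f = cis]) (simp add: algebra_simps diff_divide_distrib)
      thus ?thesis by (simp add: cis_cnj mult_ac)
    qed
    show ?thesis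
      unfolding model_field_def complex_norm_square cnj_sum sum_product zh_def[symmetric] e ..
  qed
  have inner: "(\<Sum>t\<in>cset d. dft_coeff d (- l) t * cis (2 * pi * of_int (t * (p - p')) / real d))
      = (if p' = p + l then 1 else 0)" if p: "p \<in> cset s" "p' \<in> cset s" for p p'
  proof -
    have e: "dft_coeff d (- l) t * cis (2 * pi * of_int (t * (p - p')) / real d) = of_real (1 / real d) * cis (2 * pi * of_int (t * (l + p - p')) / real d)" for t
    proof -
      have "cis (- (2 * pi * of_int (- l * t) / real d)) * cis (2 * pi * of_int (t * (p - p')) / real d) = cis (2 * pi * of_int (t * (l + p - p')) / real d)"
        unfolding cis_mult by (rule arg_cong[where f = cis]) (simp add: algebra_simps diff_divide_distrib add_divide_distrib)
      thus ?thesis by (simp only: dft_coeff_def mult.assoc)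
    qed
    have "(\<Sum>t\<in>cset d. dft_coeff d (- l) t * cis (2 * pi * of_int (t * (p - p')) / real d)) = (if int d dvd (l + p - p') then 1 else 0)"
      unfolding e sum_scaled_cis_cset[OF d] using d0 by simp
    also have "int d dvd (l + p - p') \<longleftrightarrow> p' = p + l"
    proof
      assume a: "int d dvd l + p - p'"
      have "\<bar>l + p - p'\<bar> < int d" using p l s int_odd_offset[OF s(1)] by (auto simp: cset_odd)
      hence "l + p - p' = 0" using dvd_imp_le_int[OF _ a] by fastforce
      thus "p' = p + l" by simp
    qed simp
    finally show ?thesis .
  qed
  have "(\<Sum>t\<in>cset d. dft_coeff d (- l) t * of_real ((cmod (model_field d s x m \<omega> t))\<^sup>2))
     = (\<Sum>t\<in>cset d. \<Sum>p\<in>cset s. \<Sum>p'\<in>cset s. x p * cnj (x p') * zh (\<omega> - p) * cnj (zh (\<omega> - p')) *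
         (dft_coeff d (- l) t * cis (2 * pi * of_int (t * (p - p')) / real d)))"
    unfolding e sum_distrib_left by (intro sum.cong refl) (simp only: mult_ac)
  also have "\<dots> = (\<Sum>p\<in>cset s. \<Sum>p'\<in>cset s. \<Sum>t\<in>cset d. x p * cnj (x p') * zh (\<omega> - p) * cnj (zh (\<omega> - p')) *
         (dft_coeff d (- l) t * cis (2 * pi * of_int (t * (p - p')) / real d)))"
    by (subst sum.swap, subst (2) sum.swap) (rule refl)
  also have "\<dots> = (\<Sum>p\<in>cset s. \<Sum>p'\<in>cset s. if p' = p + l then x p * cnj (x (p + l)) * zh (\<omega> - p) * cnj (zh (\<omega> - p + (- l))) else 0)"
    unfolding sum_distrib_left[symmetric]
  proof (intro sum.cong refl)
    fix p p' assume p: "p \<in> cset s" "p' \<in> cset s"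
    have h: "zh (\<omega> - (p + l)) = zh (\<omega> - p - l)" by (rule arg_cong[where f = zh]) simp
    show "x p * cnj (x p') * zh (\<omega> - p) * cnj (zh (\<omega> - p')) *
         (\<Sum>t\<in>cset d. dft_coeff d (- l) t * cis (2 * pi * of_int (t * (p - p')) / real d))
       = (if p' = p + l then x p * cnj (x (p + l)) * zh (\<omega> - p) * cnj (zh (\<omega> - p + (- l))) else 0)"
      unfolding inner[OF p] by (cases "p' = p + l") (simp_all add: h)
  qed
  also have "\<dots> = (\<Sum>p\<in>cset s. (if p + l \<in> cset s then x p * cnj (x (p + l)) else 0) * (zh (\<omega> - p) * cnj (zh (\<omega> - p + (- l)))))"
    by (intro sum.cong refl) (simp add: sum.delta mult_ac)
  finally show ?thesis by (simp add: zh_def)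
qed

text \<open>The transform over frequencies turns each mask product into the same mask transform
  times a phase depending on p. That phase is d times an entry of W, so dividing by the mask
  transform leaves a linear system with matrix W.\<close>

lemma dft2_model_field:
  assumes d: "odd d" "d = K * r" and s: "odd s" "2 * s \<le> d" and l: "\<bar>l\<bar> < int s" and \<omega>: "\<bar>\<omega>\<bar> + \<delta> < int K"
    and z: "\<And>p p'. p \<in> cset d \<Longrightarrow> p' \<in> cset d \<Longrightarrow> mask_samples d m p \<noteq> 0 \<Longrightarrow> mask_samples d m p' \<noteq> 0 \<Longrightarrow> \<bar>p' - p\<bar> \<le> \<delta>"
  shows "dft2 d K (\<lambda>j t. of_real ((cmod (model_field d s x m (j * int r) t))\<^sup>2)) (- l) \<omega>
    = of_nat d * mask_transform d m (- l) \<omega> *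
      (\<Sum>p\<in>cset s. dft_coeff d \<omega> p * (if p + l \<in> cset s then x p * cnj (x (p + l)) else 0))"
proof -
  define zh where "zh = dft d (mask_samples d m)"
  define h where "h p = (if p + l \<in> cset s then x p * cnj (x (p + l)) else 0)" for p
  have d0: "0 < d" using d by (simp add: odd_pos)
  have "dft2 d K (\<lambda>j t. of_real ((cmod (model_field d s x m (j * int r) t))\<^sup>2)) (- l) \<omega>
     = (\<Sum>j\<in>cset K. \<Sum>p\<in>cset s. h p * (dft_coeff K \<omega> j * (zh (j * int r - p) * cnj (zh (j * int r - p + (- l))))))"
    unfolding dft2_def dft_model_field[OF d(1) s l] h_def[symmetric] zh_def[symmetric] sum_distrib_right
    by (intro sum.cong refl) (simp only: mult_ac)
  also have "\<dots> = (\<Sum>p\<in>cset s. h p * (\<Sum>j\<in>cset K. dft_coeff K \<omega> j * (zh (j * int r - p) * cnj (zh (j * int r - p + (- l))))))"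
    by (subst sum.swap) (simp only: sum_distrib_left)
  also have "\<dots> = (\<Sum>p\<in>cset s. h p * (cis (- (2 * pi * of_int (\<omega> * p) / real d)) * mask_transform d m (- l) \<omega>))"
    unfolding zh_def
    by (intro sum.cong refl arg_cong[where f = "\<lambda>y. _ * y"]) (rule subsampled_mask_transform[OF d \<omega> z])
  also have "\<dots> = of_nat d * mask_transform d m (- l) \<omega> * (\<Sum>p\<in>cset s. dft_coeff d \<omega> p * h p)"
    unfolding sum_distrib_left using d0 by (intro sum.cong refl) (simp add: dft_coeff_def)
  finally show ?thesis by (simp add: h_def)
qed

section \<open>Propagation of errors through the two discrete transforms\<close>

lemma sum_cauchy_schwarz_card:
  fixes f :: "'a \<Rightarrow> complex"
  shows "(cmod (\<Sum>i\<in>A. f i))\<^sup>2 \<le> real (card A) * (\<Sum>i\<in>A. (cmod (f i))\<^sup>2)"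
proof -
  have "(cmod (\<Sum>i\<in>A. f i))\<^sup>2 \<le> (\<Sum>i\<in>A. 1 * cmod (f i))\<^sup>2" by (intro power_mono) (auto intro: norm_sum)
  also have "\<dots> \<le> (\<Sum>i\<in>A. 1\<^sup>2) * (\<Sum>i\<in>A. (cmod (f i))\<^sup>2)" by (rule Cauchy_Schwarz_ineq_sum)
  finally show ?thesis by simp
qed

lemma dft_parseval:
  assumes K: "odd K"
  shows "(\<Sum>\<omega>\<in>cset K. (cmod (\<Sum>j\<in>cset K. g j * dft_coeff K \<omega> j))\<^sup>2) = (\<Sum>j\<in>cset K. (cmod (g j))\<^sup>2) / real K"
proof -
  have K0: "0 < K" using K by (simp add: odd_pos)
  have inner: "(\<Sum>\<omega>\<in>cset K. dft_coeff K \<omega> j * cnj (dft_coeff K \<omega> k)) = (if k = j then of_real (1 / real K) else 0)"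
    if jk: "j \<in> cset K" "k \<in> cset K" for j k
  proof -
    have e: "dft_coeff K \<omega> j * cnj (dft_coeff K \<omega> k) = of_real (1 / (real K)\<^sup>2) * cis (2 * pi * of_int (\<omega> * (k - j)) / real K)" for \<omega>
    proof -
      have "cis (- (2 * pi * of_int (\<omega> * j) / real K)) * cis (2 * pi * of_int (\<omega> * k) / real K) = cis (2 * pi * of_int (\<omega> * (k - j)) / real K)"
        unfolding cis_mult by (rule arg_cong[where f = cis]) (simp add: algebra_simps diff_divide_distrib)
      thus ?thesis unfolding dft_coeff_def by (simp add: cis_cnj power2_eq_square)
    qed
    have "(\<Sum>\<omega>\<in>cset K. dft_coeff K \<omega> j * cnj (dft_coeff K \<omega> k)) = (if int K dvd (k - j) then of_real (1 / real K) else 0)"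
      unfolding e sum_scaled_cis_cset[OF K] using K0 by (simp add: power2_eq_square)
    also have "int K dvd (k - j) \<longleftrightarrow> k = j"
    proof
      assume a: "int K dvd k - j"
      have "\<bar>k - j\<bar> < int K" using jk int_odd_offset[OF K] by (auto simp: cset_odd[OF K])
      with a show "k = j" using zdvd_imp_le[of "int K" "\<bar>k - j\<bar>"] by auto
    qed simp
    finally show ?thesis .
  qed
  have "complex_of_real (\<Sum>\<omega>\<in>cset K. (cmod (\<Sum>j\<in>cset K. g j * dft_coeff K \<omega> j))\<^sup>2)
     = (\<Sum>\<omega>\<in>cset K. \<Sum>j\<in>cset K. \<Sum>k\<in>cset K. g j * cnj (g k) * (dft_coeff K \<omega> j * cnj (dft_coeff K \<omega> k)))"
    unfolding of_real_sum complex_norm_square cnj_sum sum_product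
    by (intro sum.cong refl) (simp add: mult_ac)
  also have "\<dots> = (\<Sum>j\<in>cset K. \<Sum>k\<in>cset K. \<Sum>\<omega>\<in>cset K. g j * cnj (g k) * (dft_coeff K \<omega> j * cnj (dft_coeff K \<omega> k)))"
    by (subst sum.swap, subst (2) sum.swap) (rule refl)
  also have "\<dots> = (\<Sum>j\<in>cset K. \<Sum>k\<in>cset K. if k = j then g j * cnj (g j) * of_real (1 / real K) else 0)"
    unfolding sum_distrib_left[symmetric] by (intro sum.cong refl) (simp only: inner split: if_split, simp)
  also have "\<dots> = of_real ((\<Sum>j\<in>cset K. (cmod (g j))\<^sup>2) / real K)"
    unfolding of_real_divide of_real_sum complex_norm_square by (simp add: sum_divide_distrib)
  finally show ?thesis by (rule of_real_eq_iff[THEN iffD1])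
qed

text \<open>Parseval is used in the frequency variable, which is summed over, but Cauchy-Schwarz in
  the shift variable, because \<alpha> is fixed. The normalization of the transforms supplies the
  factors 1/K and 1/d.\<close>

lemma dft2_bound:
  assumes "odd K" "odd d"
  shows "(\<Sum>\<omega>\<in>cset K. (cmod (dft2 d K E \<alpha> \<omega>))\<^sup>2) \<le> (\<Sum>j\<in>cset K. \<Sum>l\<in>cset d. (cmod (E j l))\<^sup>2) / (real d * real K)"
proof -
  have d0: "0 < d" and K0: "0 < K" using assms by (simp_all add: odd_pos)
  have "(\<Sum>\<omega>\<in>cset K. (cmod (dft2 d K E \<alpha> \<omega>))\<^sup>2) = (\<Sum>j\<in>cset K. (cmod (\<Sum>l\<in>cset d. dft_coeff d \<alpha> l * E j l))\<^sup>2) / real K"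
    unfolding dft2_def by (rule dft_parseval[OF assms(1)])
  also have "\<dots> \<le> (\<Sum>j\<in>cset K. (\<Sum>l\<in>cset d. (cmod (E j l))\<^sup>2) / real d) / real K"
  proof (intro divide_right_mono sum_mono)
    fix j
    have "(cmod (\<Sum>l\<in>cset d. dft_coeff d \<alpha> l * E j l))\<^sup>2 \<le> real d * (\<Sum>l\<in>cset d. (cmod (dft_coeff d \<alpha> l * E j l))\<^sup>2)"
      using sum_cauchy_schwarz_card[of "\<lambda>l. dft_coeff d \<alpha> l * E j l" "cset d"] by (simp add: card_cset[OF assms(2)])
    also have "\<dots> = (\<Sum>l\<in>cset d. (cmod (E j l))\<^sup>2) / real d"
      unfolding sum_distrib_left sum_divide_distrib
      using d0 by (intro sum.cong refl) (simp add: dft_coeff_def norm_mult norm_divide field_simps power2_eq_square)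
    finally show "(cmod (\<Sum>l\<in>cset d. dft_coeff d \<alpha> l * E j l))\<^sup>2 \<le> (\<Sum>l\<in>cset d. (cmod (E j l))\<^sup>2) / real d" .
  qed simp
  also have "\<dots> = (\<Sum>j\<in>cset K. \<Sum>l\<in>cset d. (cmod (E j l))\<^sup>2) / (real d * real K)"
    by (simp add: sum_divide_distrib)
  finally show ?thesis .
qed

subsection \<open>Discretization error of the measurements\<close>

lemma has_sum_finite_sum:
  fixes g :: "'i \<Rightarrow> 'a \<Rightarrow> complex"
  assumes "finite I" "\<And>i. i \<in> I \<Longrightarrow> (g i has_sum s i) A"
  shows "((\<lambda>n. \<Sum>i\<in>I. g i n) has_sum (\<Sum>i\<in>I. s i)) A"
  using assms by (induction I rule: finite_induct) (auto intro!: has_sum_add)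

text \<open>The discrete form of Poisson summation: inserting the Fourier series at the sample
  points folds all frequencies congruent to q onto q.\<close>

lemma dft_aliasing:
  assumes m: "C_smooth k m" "supp m \<subseteq> {-pi<..<pi}" "2 \<le> k" and d: "odd d"
  shows "((\<lambda>n. if int d dvd n - q then fourier_coeff m n else 0) has_sum dft d (mask_samples d m) q) UNIV"
proof -
  have d0: "0 < d" using d by (simp add: odd_pos)
  have "((\<lambda>n. \<Sum>p\<in>cset d. dft_coeff d q p * (fourier_coeff m n * cis (of_int n * (2 * pi * of_int p / real d))))
     has_sum (\<Sum>p\<in>cset d. dft_coeff d q p * m (2 * pi * of_int p / real d))) UNIV"
  proof (intro has_sum_finite_sum has_sum_cmult_right fourier_series[OF m])
    fix p assume "p \<in> cset d"
    hence "\<bar>real_of_int p\<bar> \<le> real d / 2" by (auto simp: cset_def)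
    hence "2 * pi * \<bar>real_of_int p\<bar> \<le> 2 * pi * (real d / 2)" by (intro mult_left_mono) auto
    hence "\<bar>2 * pi * of_int p / real d\<bar> \<le> pi" using d0 by (simp add: abs_mult field_simps)
    thus "2 * pi * of_int p / real d \<in> {-pi..pi}" unfolding atLeastAtMost_iff by linarith
  qed simp
  moreover have "(\<Sum>p\<in>cset d. dft_coeff d q p * (fourier_coeff m n * cis (of_int n * (2 * pi * of_int p / real d))))
     = (if int d dvd n - q then fourier_coeff m n else 0)" for n
  proof -
    have e: "dft_coeff d q p * (fourier_coeff m n * cis (of_int n * (2 * pi * of_int p / real d)))
       = fourier_coeff m n * of_real (1 / real d) * cis (2 * pi * of_int (p * (n - q)) / real d)" for p
    proof -
      have "cis (- (2 * pi * of_int (q * p) / real d)) * cis (of_int n * (2 * pi * of_int p / real d)) = cis (2 * pi * of_int (p * (n - q)) / real d)"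
        unfolding cis_mult by (rule arg_cong[where f = cis]) (simp add: algebra_simps diff_divide_distrib)
      thus ?thesis by (simp add: dft_coeff_def mult_ac)
    qed
    show ?thesis unfolding e sum_scaled_cis_cset[OF d] using d0 by simp
  qed
  ultimately show ?thesis by (simp add: dft_def mask_samples_def)
qed

lemma has_sum_norm_le:
  fixes g :: "'a \<Rightarrow> complex"
  assumes "(g has_sum s) A" "\<And>F. finite F \<Longrightarrow> F \<subseteq> A \<Longrightarrow> (\<Sum>n\<in>F. cmod (g n)) \<le> B"
  shows "cmod s \<le> B"
proof -
  have "(\<lambda>n. cmod (g n)) summable_on A"
    by (rule nonneg_bdd_above_summable_on) (auto intro!: bdd_aboveI[of _ B] assms(2))
  hence "cmod (infsum g A) \<le> infsum (\<lambda>n. cmod (g n)) A" by (rule norm_infsum_bound)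
  also have "\<dots> \<le> B" by (rule infsum_le_finite_sums) (use \<open>(\<lambda>n. cmod (g n)) summable_on A\<close> assms(2) in auto)
  finally show ?thesis using infsumI[OF assms(1)] by simp
qed

text \<open>An alias has the form n = q + d j with j nonzero. From |q| \<le> 9d/16 it follows that d
  |j| \<le> 16 |n| / 7 \<le> 3 |n|, so the decay of the coefficients bounds it by C (3 / (d |j|))^k,
  and the sum over j is at most 5 times the value at |j| = 1.\<close>

lemma dft_aliasing_error:
  assumes m: "C_smooth k m" "supp m \<subseteq> {-pi<..<pi}" "2 \<le> k" and d: "odd d"
    and C: "0 \<le> C" "\<And>n. cmod (fourier_coeff m n) * \<bar>of_int n\<bar> ^ k \<le> C" and q: "16 * \<bar>q\<bar> \<le> 9 * int d"
  shows "cmod (dft d (mask_samples d m) q - fourier_coeff m q) \<le> 5 * C * 3 ^ k / real d ^ k"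
proof -
  have d0: "0 < d" using d by (simp add: odd_pos)
  let ?g = "\<lambda>n. if int d dvd n - q then fourier_coeff m n else 0"
  have "(?g has_sum (dft d (mask_samples d m) q - sum ?g {q})) (UNIV - {q})"
    by (rule has_sum_Diff[OF dft_aliasing[OF m d] has_sum_finite]) auto
  hence hs: "(?g has_sum (dft d (mask_samples d m) q - fourier_coeff m q)) (UNIV - {q})" by simp
  show ?thesis
  proof (rule has_sum_norm_le[OF hs])
    fix F assume F: "finite F" "F \<subseteq> UNIV - {q}"
    define F' where "F' = {n\<in>F. int d dvd n - q}"
    have fF': "finite F'" using F by (simp add: F'_def)
    define j where "j n = (n - q) div int d" for n
    have j1: "n = q + int d * j n" if "n \<in> F'" for n
      using that by (auto simp: F'_def j_def)
    have j2: "j n \<noteq> 0" if "n \<in> F'" for n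
    proof
      assume "j n = 0"
      with j1[OF that] have "n = q" by simp
      thus False using that F(2) by (auto simp: F'_def)
    qed
    note j = j1 j2
    have inj: "inj_on j F'"
    proof (rule inj_onI)
      fix x y assume xy: "x \<in> F'" "y \<in> F'" "j x = j y"
      have "x = q + int d * j x" by (rule j(1)[OF xy(1)])
      also have "\<dots> = q + int d * j y" by (simp only: xy(3))
      also have "\<dots> = y" by (rule j(1)[OF xy(2), symmetric])
      finally show "x = y" .
    qed
    have "(\<Sum>n\<in>F. cmod (?g n)) = (\<Sum>n\<in>F'. cmod (fourier_coeff m n))"
      unfolding F'_def using F(1) by (simp add: sum.inter_filter if_distrib[of cmod] cong: if_cong)
    also have "\<dots> \<le> (\<Sum>n\<in>F'. C * 3 ^ k / real d ^ k * (1 / (of_int (j n))\<^sup>2))"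
    proof (rule sum_mono)
      fix n assume n: "n \<in> F'"
      have j1: "1 \<le> \<bar>j n\<bar>" using j(2)[OF n] by simp
      have "int d * \<bar>j n\<bar> = \<bar>n - q\<bar>" using arg_cong[OF j(1)[OF n], of "\<lambda>n. \<bar>n - q\<bar>"] by (simp add: abs_mult)
      hence "int d * \<bar>j n\<bar> \<le> \<bar>n\<bar> + \<bar>q\<bar>" by simp
      moreover have "int d * 1 \<le> int d * \<bar>j n\<bar>" using j1 by (intro mult_left_mono) auto
      ultimately have "int d * \<bar>j n\<bar> \<le> 3 * \<bar>n\<bar>" using q by linarith
      hence "real_of_int (int d * \<bar>j n\<bar>) \<le> real_of_int (3 * \<bar>n\<bar>)" by (rule of_int_le_iff[THEN iffD2])
      hence dj: "real d * \<bar>of_int (j n)\<bar> \<le> 3 * \<bar>real_of_int n\<bar>" by simp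
      have jr: "1 \<le> \<bar>real_of_int (j n)\<bar>" using j1 by linarith
      have "cmod (fourier_coeff m n) * (real d ^ k * (of_int (j n))\<^sup>2)
        \<le> cmod (fourier_coeff m n) * (real d ^ k * \<bar>of_int (j n)\<bar> ^ k)"
      proof (intro mult_left_mono)
        have "\<bar>real_of_int (j n)\<bar> ^ 2 \<le> \<bar>of_int (j n)\<bar> ^ k" by (rule power_increasing[OF m(3) jr])
        thus "(real_of_int (j n))\<^sup>2 \<le> \<bar>of_int (j n)\<bar> ^ k" by simp
      qed auto
      also have "\<dots> = cmod (fourier_coeff m n) * (real d * \<bar>of_int (j n)\<bar>) ^ k" by (simp add: power_mult_distrib)
      also have "\<dots> \<le> cmod (fourier_coeff m n) * (3 * \<bar>of_int n\<bar>) ^ k"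
        by (intro mult_left_mono power_mono dj) auto
      also have "\<dots> = 3 ^ k * (cmod (fourier_coeff m n) * \<bar>of_int n\<bar> ^ k)" by (simp add: power_mult_distrib)
      also have "\<dots> \<le> 3 ^ k * C" by (intro mult_left_mono C) auto
      finally show "cmod (fourier_coeff m n) \<le> C * 3 ^ k / real d ^ k * (1 / (of_int (j n))\<^sup>2)"
        using d0 j(2)[OF n] by (simp add: field_simps)
    qed
    also have "\<dots> = C * 3 ^ k / real d ^ k * (\<Sum>i\<in>j ` F'. 1 / (of_int i)\<^sup>2)"
      unfolding sum.reindex[OF inj] by (simp add: sum_distrib_left)
    also have "\<dots> \<le> C * 3 ^ k / real d ^ k * 5"
      by (intro mult_left_mono sum_inverse_squares_ints_le_5) (use C fF' in auto)
    finally show "(\<Sum>n\<in>F. cmod (?g n)) \<le> 5 * C * 3 ^ k / real d ^ k" by (simp add: mult_ac)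
  qed
qed

text \<open>The error splits into coefficients of f outside the index set and aliasing of the mask.
  In the first part the decay of f is uniform and the mask coefficients are summable; in the second
  the roles are exchanged. Neither part loses a power of d, and both bounds are uniform in frequency
  and shift.\<close>

lemma model_field_error:
  assumes f: "C_smooth k f" "supp f \<subseteq> {-a<..<a}" and m: "C_smooth k m" "supp m \<subseteq> {-b<..<b}"
    and ab: "2 \<le> k" "0 < a" "0 < b" "a + b < pi"
  obtains D B where "0 \<le> D" "0 \<le> B"
    "\<And>d s \<omega> l. odd d \<Longrightarrow> odd s \<Longrightarrow> real d \<le> 10 * real s \<Longrightarrow> 8 * s \<le> d \<Longrightarrow> 2 * \<bar>\<omega>\<bar> \<le> int d \<Longrightarrow> l \<in> cset d \<Longrightarrow>
       cmod ((LBINT x. f x * m (x - 2 * pi / real d * of_int l) * cis (- (x * of_int \<omega>))) / of_real (2 * pi)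
         - model_field d s (fourier_coeff f) m \<omega> l) \<le> D / real d ^ k \<and>
       cmod ((LBINT x. f x * m (x - 2 * pi / real d * of_int l) * cis (- (x * of_int \<omega>))) / of_real (2 * pi)) \<le> B"
proof -
  have sf: "supp f \<subseteq> {-pi<..<pi}" and sm: "supp m \<subseteq> {-pi<..<pi}" using assms by auto
  obtain Cf where Cf: "0 \<le> Cf" "\<And>n. cmod (fourier_coeff f n) * \<bar>of_int n\<bar> ^ k \<le> Cf"
    using fourier_coeff_decay[OF f(1) sf] by blast
  obtain Cm where Cm: "0 \<le> Cm" "\<And>n. cmod (fourier_coeff m n) * \<bar>of_int n\<bar> ^ k \<le> Cm"
    using fourier_coeff_decay[OF m(1) sm] by blast
  note sumf = fourier_coeff_abs_summable[OF f(1) sf ab(1)] and summ = fourier_coeff_abs_summable[OF m(1) sm ab(1)]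
  define Mf where "Mf = infsum (\<lambda>n. cmod (fourier_coeff f n)) UNIV"
  define Mm where "Mm = infsum (\<lambda>n. cmod (fourier_coeff m n)) UNIV"
  have M0: "0 \<le> Mf" "0 \<le> Mm" by (auto simp: Mf_def Mm_def infsum_nonneg)
  have Mf: "(\<Sum>n\<in>F. cmod (fourier_coeff f n)) \<le> Mf" if "finite F" for F
    unfolding Mf_def using that by (intro finite_sum_le_infsum sumf) auto
  have Mm: "(\<Sum>n\<in>F. cmod (fourier_coeff m (\<omega> - n))) \<le> Mm" if "finite F" for F \<omega>
  proof -
    have "(\<Sum>n\<in>F. cmod (fourier_coeff m (\<omega> - n))) = (\<Sum>n\<in>(\<lambda>n. \<omega> - n) ` F. cmod (fourier_coeff m n))"
      by (subst sum.reindex) (auto simp: inj_on_def)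
    also have "\<dots> \<le> Mm" unfolding Mm_def using that by (intro finite_sum_le_infsum summ) auto
    finally show ?thesis .
  qed
  have mM: "cmod (fourier_coeff m n) \<le> Mm" for n using Mm[of "{0}" n] by simp
  \<comment> \<open>The 20 arises because an index n outside the truncation satisfies s \<le> 2 |n|,
    while d \<le> 10 s. The factor 5 * 3^k is the aliasing constant.\<close>
  define D where "D = Cf * 20 ^ k * Mm + Mf * (5 * Cm * 3 ^ k)"
  show ?thesis
  proof (rule that[of D "Mf * Mm"])
    show "0 \<le> D" using M0 Cf Cm by (simp add: D_def)
    show "0 \<le> Mf * Mm" using M0 by simp
    fix d s :: nat and \<omega> l :: int
    assume ds: "odd d" "odd s" "real d \<le> 10 * real s" "8 * s \<le> d" and \<omega>: "2 * \<bar>\<omega>\<bar> \<le> int d" and l: "l \<in> cset d"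
    have d0: "0 < d" using ds by (simp add: odd_pos)
    let ?t = "2 * pi / real d * of_int l"
    let ?G = "(LBINT x. f x * m (x - ?t) * cis (- (x * of_int \<omega>))) / of_real (2 * pi)"
    let ?h = "\<lambda>n. fourier_coeff f n * cis (- (?t * of_int (\<omega> - n))) * fourier_coeff m (\<omega> - n)"
    let ?T = "model_field d s (fourier_coeff f) m \<omega> l"
    have t: "\<bar>?t\<bar> \<le> pi"
    proof -
      have "\<bar>real_of_int l\<bar> \<le> real d / 2" using l by (auto simp: cset_def)
      hence "2 * pi * \<bar>real_of_int l\<bar> \<le> 2 * pi * (real d / 2)" by (intro mult_left_mono) auto
      thus ?thesis using d0 by (simp add: abs_mult field_simps)
    qed
    have hs: "(?h has_sum ?G) UNIV"
      by (rule measurement_fourier_expansion[OF f m ab t])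
    have "cmod ?G \<le> Mf * Mm"
    proof (rule has_sum_norm_le[OF hs])
      fix F :: "int set" assume "finite F"
      have "(\<Sum>n\<in>F. cmod (?h n)) \<le> (\<Sum>n\<in>F. cmod (fourier_coeff f n) * Mm)"
        by (intro sum_mono) (auto simp: norm_mult intro!: mult_left_mono mM)
      also have "\<dots> \<le> Mf * Mm"
        unfolding sum_distrib_right[symmetric] using Mf[OF \<open>finite F\<close>] M0 by (intro mult_right_mono)
      finally show "(\<Sum>n\<in>F. cmod (?h n)) \<le> Mf * Mm" .
    qed
    moreover have "cmod (?G - (\<Sum>n\<in>cset s. ?h n)) \<le> Cf * 20 ^ k / real d ^ k * Mm"
    proof (rule has_sum_norm_le)
      show "(?h has_sum (?G - (\<Sum>n\<in>cset s. ?h n))) (UNIV - cset s)"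
        by (rule has_sum_Diff[OF hs has_sum_finite]) auto
      fix F assume F: "finite F" "F \<subseteq> UNIV - cset s"
      have fn: "cmod (fourier_coeff f n) \<le> Cf * 20 ^ k / real d ^ k" if "n \<in> F" for n
      proof -
        have "n \<notin> cset s" using F that by auto
        hence "offset s < \<bar>n\<bar>" by (auto simp: cset_odd[OF ds(2)])
        hence "int s \<le> 2 * \<bar>n\<bar>" using int_odd_offset[OF ds(2)] by linarith
        hence "real s \<le> 2 * \<bar>real_of_int n\<bar>" by linarith
        hence dn: "real d \<le> 20 * \<bar>real_of_int n\<bar>" using ds(3) by linarith
        have "cmod (fourier_coeff f n) * real d ^ k \<le> cmod (fourier_coeff f n) * (20 * \<bar>of_int n\<bar>) ^ k"
          by (intro mult_left_mono power_mono dn) auto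
        also have "\<dots> = 20 ^ k * (cmod (fourier_coeff f n) * \<bar>of_int n\<bar> ^ k)" by (simp add: power_mult_distrib)
        also have "\<dots> \<le> 20 ^ k * Cf" by (intro mult_left_mono Cf) auto
        finally show ?thesis using d0 by (simp add: field_simps)
      qed
      have "(\<Sum>n\<in>F. cmod (?h n)) \<le> (\<Sum>n\<in>F. Cf * 20 ^ k / real d ^ k * cmod (fourier_coeff m (\<omega> - n)))"
        unfolding norm_mult norm_cis mult_1_right by (intro sum_mono mult_right_mono fn) auto
      also have "\<dots> \<le> Cf * 20 ^ k / real d ^ k * Mm"
        unfolding sum_distrib_left[symmetric] using Mm[OF F(1)] Cf(1) by (intro mult_left_mono) auto
      finally show "(\<Sum>n\<in>F. cmod (?h n)) \<le> Cf * 20 ^ k / real d ^ k * Mm" .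
    qed
    moreover have "cmod ((\<Sum>n\<in>cset s. ?h n) - ?T) \<le> Mf * (5 * Cm * 3 ^ k / real d ^ k)"
    proof -
      have "(\<Sum>n\<in>cset s. ?h n) - ?T = (\<Sum>n\<in>cset s. fourier_coeff f n * cis (- (?t * of_int (\<omega> - n))) *
          (fourier_coeff m (\<omega> - n) - dft d (mask_samples d m) (\<omega> - n)))"
        by (simp add: model_field_def sum_subtractf[symmetric] right_diff_distrib)
      also have "cmod \<dots> \<le> (\<Sum>n\<in>cset s. cmod (fourier_coeff f n) * (5 * Cm * 3 ^ k / real d ^ k))"
      proof (rule sum_norm_le)
        fix n assume n: "n \<in> cset s"
        \<comment> \<open>Origin of 9/16: frequencies reach d/2 and coefficient indices s/2 \<le>
          d/16, and 1/2 + 1/16 = 9/16.\<close>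
        have arith: "16 * w \<le> 9 * D" if "2 * v \<le> S" "8 * S \<le> D" "w \<le> u + v" "2 * u \<le> D"
          for u v w S D :: int using that by linarith
        have "2 * \<bar>n\<bar> \<le> int s" using n int_odd_offset[OF ds(2)] by (auto simp: cset_odd[OF ds(2)])
        moreover have "8 * int s \<le> int d" using iffD2[OF of_nat_le_iff[where 'a = int] ds(4)] by simp
        ultimately have "16 * \<bar>\<omega> - n\<bar> \<le> 9 * int d"
          by (rule arith[OF _ _ abs_triangle_ineq4 \<omega>])
        hence "cmod (dft d (mask_samples d m) (\<omega> - n) - fourier_coeff m (\<omega> - n)) \<le> 5 * Cm * 3 ^ k / real d ^ k"
          by (rule dft_aliasing_error[OF m(1) sm ab(1) ds(1) Cm])
        thus "cmod (fourier_coeff f n * cis (- (?t * of_int (\<omega> - n))) * (fourier_coeff m (\<omega> - n) - dft d (mask_samples d m) (\<omega> - n)))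
           \<le> cmod (fourier_coeff f n) * (5 * Cm * 3 ^ k / real d ^ k)"
          unfolding norm_mult norm_cis mult_1_right by (intro mult_left_mono) (simp_all add: norm_minus_commute)
      qed
      also have "\<dots> \<le> Mf * (5 * Cm * 3 ^ k / real d ^ k)"
        unfolding sum_distrib_right[symmetric] using Cm(1) by (intro mult_right_mono Mf) auto
      finally show ?thesis .
    qed
    moreover have "D / real d ^ k = Cf * 20 ^ k / real d ^ k * Mm + Mf * (5 * Cm * 3 ^ k / real d ^ k)"
      by (simp add: D_def add_divide_distrib)
    moreover have "cmod (?G - ?T) \<le> cmod (?G - (\<Sum>n\<in>cset s. ?h n)) + cmod ((\<Sum>n\<in>cset s. ?h n) - ?T)"
      using norm_triangle_ineq[of "?G - (\<Sum>n\<in>cset s. ?h n)" "(\<Sum>n\<in>cset s. ?h n) - ?T"] by simp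
    ultimately show "cmod (?G - ?T) \<le> D / real d ^ k \<and> cmod ?G \<le> Mf * Mm" by linarith
  qed
qed

text \<open>A difference of squared moduli factors into the field error and a sum of moduli that is
  bounded independently of d, so the rate is preserved. The factor (2 pi)^2 undoes the normalization
  of the Fourier coefficients.\<close>

lemma measurement_model_error:
  assumes f: "C_smooth k f" "supp f \<subseteq> {-a<..<a}" and m: "C_smooth k m" "supp m \<subseteq> {-b<..<b}"
    and ab: "2 \<le> k" "0 < a" "0 < b" "a + b < pi"
  obtains E where "0 \<le> E"
    "\<And>d s \<eta> \<omega> l. odd d \<Longrightarrow> odd s \<Longrightarrow> real d \<le> 10 * real s \<Longrightarrow> 8 * s \<le> d \<Longrightarrow> 2 * \<bar>\<omega>\<bar> \<le> int d \<Longrightarrow> l \<in> cset d \<Longrightarrow>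
       cmod (measurement d m f \<eta> \<omega> l - \<eta> \<omega> l
         - of_real (4 * pi\<^sup>2) * of_real ((cmod (model_field d s (fourier_coeff f) m \<omega> l))\<^sup>2)) \<le> E / real d ^ k"
proof -
  obtain D B where DB: "0 \<le> D" "0 \<le> B"
    "\<And>d s \<omega> l. odd d \<Longrightarrow> odd s \<Longrightarrow> real d \<le> 10 * real s \<Longrightarrow> 8 * s \<le> d \<Longrightarrow> 2 * \<bar>\<omega>\<bar> \<le> int d \<Longrightarrow> l \<in> cset d \<Longrightarrow>
       cmod ((LBINT x. f x * m (x - 2 * pi / real d * of_int l) * cis (- (x * of_int \<omega>))) / of_real (2 * pi)
         - model_field d s (fourier_coeff f) m \<omega> l) \<le> D / real d ^ k \<and>
       cmod ((LBINT x. f x * m (x - 2 * pi / real d * of_int l) * cis (- (x * of_int \<omega>))) / of_real (2 * pi)) \<le> B"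
    using model_field_error[OF assms] by blast
  show ?thesis
  proof (rule that[of "4 * pi\<^sup>2 * (D * (2 * B + D))"])
    show "0 \<le> 4 * pi\<^sup>2 * (D * (2 * B + D))" using DB by simp
    fix d s :: nat and \<eta> :: "int \<Rightarrow> int \<Rightarrow> complex" and \<omega> l :: int
    assume ds: "odd d" "odd s" "real d \<le> 10 * real s" "8 * s \<le> d" "2 * \<bar>\<omega>\<bar> \<le> int d" "l \<in> cset d"
    define I where "I = (LBINT x. f x * m (x - 2 * pi / real d * of_int l) * cis (- (x * of_int \<omega>)))"
    define G where "G = I / of_real (2 * pi)"
    define T where "T = model_field d s (fourier_coeff f) m \<omega> l"
    have GT: "cmod (G - T) \<le> D / real d ^ k" and G: "cmod G \<le> B"
      using DB(3)[OF ds] by (auto simp: G_def T_def I_def)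
    have d1: "1 \<le> real d ^ k" using ds(1) by (intro one_le_power) (simp add: odd_pos Suc_leI)
    have "D / real d ^ k \<le> D" 
    proof -
      have "D / real d ^ k \<le> D / 1" by (rule divide_left_mono) (use d1 DB(1) in linarith)+
      thus ?thesis by (simp only: div_by_1)
    qed
    hence T: "cmod T \<le> B + D" using norm_triangle_ineq2[of T G] GT G by (simp add: norm_minus_commute)
    have IG: "I = of_real (2 * pi) * G" by (simp add: G_def)
    have "cmod (of_real ((cmod I)\<^sup>2) - of_real (4 * pi\<^sup>2) * of_real ((cmod T)\<^sup>2)) = \<bar>(cmod I)\<^sup>2 - 4 * pi\<^sup>2 * (cmod T)\<^sup>2\<bar>"
      by (simp only: of_real_mult[symmetric] of_real_diff[symmetric] norm_of_real)
    also have "(cmod I)\<^sup>2 - 4 * pi\<^sup>2 * (cmod T)\<^sup>2 = 4 * pi\<^sup>2 * ((cmod G - cmod T) * (cmod G + cmod T))"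
      by (simp add: IG norm_mult power_mult_distrib algebra_simps power2_eq_square)
    also have "\<bar>\<dots>\<bar> = 4 * pi\<^sup>2 * (\<bar>cmod G - cmod T\<bar> * (cmod G + cmod T))" by (simp add: abs_mult)
    also have "\<dots> \<le> 4 * pi\<^sup>2 * (D / real d ^ k * (2 * B + D))"
      using order_trans[OF norm_triangle_ineq3[of G T] GT] G T DB by (intro mult_left_mono mult_mono) auto
    also have "\<dots> = 4 * pi\<^sup>2 * (D * (2 * B + D)) / real d ^ k" by simp
    finally show "cmod (measurement d m f \<eta> \<omega> l - \<eta> \<omega> l
         - of_real (4 * pi\<^sup>2) * of_real ((cmod (model_field d s (fourier_coeff f) m \<omega> l))\<^sup>2)) \<le> 4 * pi\<^sup>2 * (D * (2 * B + D)) / real d ^ k"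
      by (simp add: measurement_def I_def T_def)
  qed
qed

subsection \<open>Error of the lifted matrix\<close>

lemma dft2_add: "dft2 d K (\<lambda>j l. M j l + N j l) \<alpha> \<omega> = dft2 d K M \<alpha> \<omega> + dft2 d K N \<alpha> \<omega>"
  by (simp add: dft2_def distrib_left distrib_right sum.distrib)

lemma dft2_cmult: "dft2 d K (\<lambda>j l. c * M j l) \<alpha> \<omega> = c * dft2 d K M \<alpha> \<omega>"
  by (simp add: dft2_def sum_distrib_left sum_distrib_right mult_ac)

lemma subsample_eq:
  assumes "d = K * r" "0 < K"
  shows "subsample K d M = cmat K d (\<lambda>j l. M (j * int r) l)"
proof -
  have "j * int d div int K = j * int r" for j
  proof -
    have e: "j * int d = int K * (j * int r)" using assms(1) by simp
    show ?thesis unfolding e using assms(2) by (intro nonzero_mult_div_cancel_left) simp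
  qed
  thus ?thesis by (simp add: subsample_def)
qed

lemma cset_mono: "m \<le> n \<Longrightarrow> cset m \<subseteq> cset n"
  by (auto simp: cset_def)

lemma mem_cset_double:
  assumes "0 < s"
  shows "l \<in> cset (2 * s - 1) \<longleftrightarrow> \<bar>l\<bar> < int s"
proof -
  have o: "odd (2 * s - 1)" using assms by simp
  have "int (2 * s - 1) = 2 * int s - 1" using assms by (simp add: of_nat_diff)
  hence "offset (2 * s - 1) = int s - 1" using int_odd_offset[OF o] by linarith
  thus ?thesis unfolding cset_odd[OF o] by auto
qed

text \<open>Two nonzero samples both satisfy |2 pi p / d| < b, so their indices differ by less than
  d b / pi. This is the meaning of \<delta>.\<close>

lemma mask_samples_support:
  assumes m: "supp m \<subseteq> {-b<..<b}" and d: "0 < d" and \<delta>: "\<delta> = \<lfloor>real d * b / pi\<rfloor>"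
    and p: "mask_samples d m p \<noteq> 0" "mask_samples d m p' \<noteq> 0"
  shows "\<bar>p' - p\<bar> \<le> \<delta>"
proof -
  have bound: "2 * pi * \<bar>real_of_int q\<bar> < real d * b" if "mask_samples d m q \<noteq> 0" for q
  proof -
    have "2 * pi * of_int q / real d \<in> supp m"
      using supp_zero[of "2 * pi * of_int q / real d" m] that by (auto simp: mask_samples_def)
    hence "2 * pi * of_int q / real d \<in> {-b<..<b}" using m by blast
    hence "\<bar>2 * pi * of_int q / real d\<bar> < b" unfolding greaterThanLessThan_iff by linarith
    thus ?thesis using d by (simp add: abs_mult field_simps)
  qed
  have "2 * pi * \<bar>real_of_int p' - real_of_int p\<bar> \<le> 2 * pi * (\<bar>real_of_int p'\<bar> + \<bar>real_of_int p\<bar>)"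
    by (intro mult_left_mono) auto
  hence "2 * pi * \<bar>real_of_int p' - real_of_int p\<bar> \<le> 2 * (real d * b)"
    using bound[OF p(1)] bound[OF p(2)] by (simp add: algebra_simps)
  hence "real_of_int \<bar>p' - p\<bar> \<le> real d * b / pi" by (simp add: field_simps)
  thus ?thesis unfolding \<delta> by (simp only: le_floor_iff)
qed

text \<open>The model part of the data is inverted exactly; noise and discretization error are both
  collected in E and merely transformed and divided.\<close>

lemma alg_C_decomposition:
  fixes M :: "int \<Rightarrow> int \<Rightarrow> complex" and x :: "int \<Rightarrow> complex"
  assumes d: "odd d" "d = K * r" and s: "odd s" "2 * s \<le> d" and \<kappa>: "0 < \<kappa>" "2 * \<kappa> - 1 \<le> K" "\<kappa> + \<delta> = K"
    and z: "\<And>p p'. mask_samples d m p \<noteq> 0 \<Longrightarrow> mask_samples d m p' \<noteq> 0 \<Longrightarrow> \<bar>p' - p\<bar> \<le> int \<delta>"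
    and mt: "\<And>\<omega> l. \<omega> \<in> cset (2 * \<kappa> - 1) \<Longrightarrow> l \<in> cset (2 * s - 1) \<Longrightarrow> mask_transform d m l \<omega> \<noteq> 0"
  defines "E \<equiv> \<lambda>j t. M (j * int r) t - of_real (4 * pi\<^sup>2) * of_real ((cmod (model_field d s x m (j * int r) t))\<^sup>2)"
  shows "alg_C d K \<kappa> s m (subsample K d M) = cmat (2 * \<kappa> - 1) (2 * s - 1)
     (\<lambda>\<omega> l. (\<Sum>p\<in>cset s. dft_coeff d \<omega> p * (if p + l \<in> cset s then x p * cnj (x (p + l)) else 0))
        + of_real (1 / (4 * pi\<^sup>2 * real d)) * dft2 d K E (- l) \<omega> / mask_transform d m (- l) \<omega>)"
proof -
  have K: "odd K" using d by auto
  have K0: "0 < K" and d0: "0 < d" using K d(1) by (simp_all add: odd_pos)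
  have o\<kappa>: "odd (2 * \<kappa> - 1)" and os: "odd (2 * s - 1)" using \<kappa> s by (auto simp: odd_pos)
  let ?M = "\<lambda>j t. M (j * int r) t"
  have Yt: "dft_mat d * transpose_mat (subsample K d M) * transpose_mat (dft_mat K) = cmat d K (dft2 d K ?M)"
    unfolding subsample_eq[OF d(2) K0] dft_mat_def cmat_transpose cmat_mult[OF d(1)] cmat_mult[OF K]
    by (simp add: dft2_def[abs_def])
  have eq: "dft2 d K ?M (- l) \<omega> = of_real (4 * pi\<^sup>2) * (of_nat d * mask_transform d m (- l) \<omega> *
      (\<Sum>p\<in>cset s. dft_coeff d \<omega> p * (if p + l \<in> cset s then x p * cnj (x (p + l)) else 0))) + dft2 d K E (- l) \<omega>"
    if \<omega>: "\<omega> \<in> cset (2 * \<kappa> - 1)" and l: "l \<in> cset (2 * s - 1)" for \<omega> l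
  proof -
    have "\<bar>l\<bar> < int s" using l mem_cset_double[OF odd_pos[OF s(1)]] by blast
    \<comment> \<open>The number of frequencies retained by the algorithm is chosen for this:
      |\<omega>| \<le> \<kappa> - 1 and \<kappa> + \<delta> = K.\<close>
    moreover have "\<bar>\<omega>\<bar> + int \<delta> < int K" 
      using \<omega> mem_cset_double[OF \<kappa>(1)] \<kappa>(3) by fastforce
    ultimately have "dft2 d K (\<lambda>j t. of_real ((cmod (model_field d s x m (j * int r) t))\<^sup>2)) (- l) \<omega> = of_nat d * mask_transform d m (- l) \<omega> *
      (\<Sum>p\<in>cset s. dft_coeff d \<omega> p * (if p + l \<in> cset s then x p * cnj (x (p + l)) else 0))"
      by (intro dft2_model_field[OF d s]) (use z in auto)
    moreover have "?M = (\<lambda>j t. of_real (4 * pi\<^sup>2) * of_real ((cmod (model_field d s x m (j * int r) t))\<^sup>2) + E j t)"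
      by (simp add: E_def)
    ultimately show ?thesis by (simp only: dft2_add dft2_cmult)
  qed
  show ?thesis
    unfolding alg_C_def Let_def Yt
  proof (rule cmat_cong[OF o\<kappa> os])
    fix \<omega> l assume \<omega>: "\<omega> \<in> cset (2 * \<kappa> - 1)" and l: "l \<in> cset (2 * s - 1)"
    have l': "- l \<in> cset (2 * s - 1)" by (rule cset_uminus[OF l])
    have "2 * s - 1 \<le> d" using s(2) by linarith
    hence "- l \<in> cset d" "\<omega> \<in> cset K"
      using subsetD[OF cset_mono l'] subsetD[OF cset_mono[OF \<kappa>(2)] \<omega>] by blast+
    hence e: "entry (cmat d K (dft2 d K ?M)) (- l) \<omega> = dft2 d K ?M (- l) \<omega>"
      by (rule entry_cmat[OF d(1) K])
    have nz: "mask_transform d m (- l) \<omega> \<noteq> 0" by (rule mt[OF \<omega> l'])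
    show "of_real (1 / (4 * pi\<^sup>2 * real d)) * entry (cmat d K (dft2 d K ?M)) (- l) \<omega> / mask_transform d m (- l) \<omega>
     = (\<Sum>p\<in>cset s. dft_coeff d \<omega> p * (if p + l \<in> cset s then x p * cnj (x (p + l)) else 0))
        + of_real (1 / (4 * pi\<^sup>2 * real d)) * dft2 d K E (- l) \<omega> / mask_transform d m (- l) \<omega>"
      unfolding e eq[OF \<omega> l] using nz d0 by (simp add: field_simps)
  qed
qed

text \<open>The target is Hermitian, so averaging with the adjoint averages two errors with the same
  bound. For indices in \<open>cset s\<close> the band condition of \<open>Lambda_mat\<close> always
  holds.\<close>

lemma alg_A_entry_error:
  fixes x :: "int \<Rightarrow> complex"
  assumes s: "odd s" "s \<le> d" "odd d" and ij: "i \<in> cset s" "j \<in> cset s"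
    and V: "\<And>p l. p \<in> cset s \<Longrightarrow> l \<in> cset (2 * s - 1) \<Longrightarrow> p + l \<in> cset s \<Longrightarrow>
      cmod (entry (left_pinv (W_mat d \<kappa> s) * alg_C d K \<kappa> s m Y) p l - x p * cnj (x (p + l))) \<le> \<tau>"
  shows "cmod (entry (alg_A d K \<kappa> s m Y) i j - x i * cnj (x j)) \<le> \<tau>"
proof -
  define V where "V = left_pinv (W_mat d \<kappa> s) * alg_C d K \<kappa> s m Y"
  define g where "g i j = (if i \<in> cset s \<and> \<bar>j - i\<bar> \<le> int s - 1 then entry V i (j - i) else 0)" for i j
  have A: "alg_A d K \<kappa> s m Y = (1 / 2) \<cdot>\<^sub>m (cmat d d g + mat_adjoint (cmat d d g))"
    by (simp add: alg_A_def Let_def Lambda_mat_def V_def[symmetric] g_def[abs_def])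
  also have "\<dots> = cmat d d (\<lambda>i j. (g i j + cnj (g j i)) / 2)"
    unfolding cmat_adjoint cmat_add by (rule eq_matI) (auto simp: cmat_def)
  finally have A: "alg_A d K \<kappa> s m Y = cmat d d (\<lambda>i j. (g i j + cnj (g j i)) / 2)" .
  have ij': "i \<in> cset d" "j \<in> cset d" using ij cset_mono[OF s(2)] by auto
  have diff: "j - i \<in> cset (2 * s - 1)" "\<bar>j - i\<bar> \<le> int s - 1" if "i \<in> cset s" "j \<in> cset s" for i j
  proof -
    show *: "\<bar>j - i\<bar> \<le> int s - 1" using that int_odd_offset[OF s(1)] by (auto simp: cset_odd[OF s(1)])
    thus "j - i \<in> cset (2 * s - 1)" using mem_cset_double[OF odd_pos[OF s(1)]] by fastforce
  qed
  have g: "cmod (g i j - x i * cnj (x j)) \<le> \<tau>" if ij: "i \<in> cset s" "j \<in> cset s" for i j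
    using V[of i "j - i", folded V_def] diff[OF ij] ij by (simp add: g_def)
  have "entry (alg_A d K \<kappa> s m Y) i j - x i * cnj (x j)
     = ((g i j - x i * cnj (x j)) + cnj (g j i - x j * cnj (x i))) / 2"
    unfolding A entry_cmat[OF s(3,3) ij'] by (simp add: field_simps)
  also have "cmod \<dots> \<le> (cmod (g i j - x i * cnj (x j)) + cmod (g j i - x j * cnj (x i))) / 2"
    unfolding norm_divide using norm_triangle_ineq[of "g i j - x i * cnj (x j)" "cnj (g j i - x j * cnj (x i))"]
    unfolding complex_mod_cnj by (simp add: divide_right_mono)
  also have "\<dots> \<le> \<tau>" using g[OF ij] g[OF ij(2,1)] by simp
  finally show ?thesis .
qed

text \<open>The factor d in front of \<epsilon> is the price of passing from a uniform bound to a
  sum of squares over K d entries. One factor 1/d of the denominator comes from the two transforms,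
  the other from the normalization of C.\<close>

lemma alg_A_error:
  fixes M \<eta> :: "int \<Rightarrow> int \<Rightarrow> complex" and x :: "int \<Rightarrow> complex"
  assumes d: "odd d" "d = K * 3" and s: "odd s" "2 * s \<le> d"
    and \<kappa>: "0 < \<kappa>" "2 * \<kappa> - 1 \<le> K" "\<kappa> + \<delta> = K" "s \<le> 2 * \<kappa> - 1"
    and z: "\<And>p p'. mask_samples d m p \<noteq> 0 \<Longrightarrow> mask_samples d m p' \<noteq> 0 \<Longrightarrow> \<bar>p' - p\<bar> \<le> int \<delta>"
    and mu: "0 < mu2 d \<kappa> s m"
    and \<epsilon>: "0 \<le> \<epsilon>" "\<And>j t. j \<in> cset K \<Longrightarrow> t \<in> cset d \<Longrightarrow>
       cmod (M (j * 3) t - \<eta> (j * 3) t - of_real (4 * pi\<^sup>2) * of_real ((cmod (model_field d s x m (j * 3) t))\<^sup>2)) \<le> \<epsilon>"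
    and ij: "i \<in> cset s" "j \<in> cset s"
  shows "cmod (entry (alg_A d K \<kappa> s m (subsample K d M)) i j - x i * cnj (x j))
    \<le> (frobenius_norm (subsample K d \<eta>) + real d * \<epsilon>) / ((real d)\<^sup>2 * mu2 d \<kappa> s m * sigma_min (W_mat d \<kappa> s))"
proof -
  let ?\<mu> = "mu2 d \<kappa> s m" and ?\<sigma> = "sigma_min (W_mat d \<kappa> s)"
  define R where "R = frobenius_norm (subsample K d \<eta>)"
  have R0: "0 \<le> R" by (simp add: R_def frobenius_norm_def sum_nonneg)
  have K: "odd K" using d by auto
  have K0: "0 < K" and d0: "0 < d" and s0: "0 < s" using K d(1) s(1) by (simp_all add: odd_pos)
  have o\<kappa>: "odd (2 * \<kappa> - 1)" and os: "odd (2 * s - 1)" using \<kappa> s by (auto simp: odd_pos)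
  have inj: "v = 0\<^sub>v s" if "v \<in> carrier_vec s" "W_mat d \<kappa> s *\<^sub>v v = 0\<^sub>v (2 * \<kappa> - 1)" for v
    by (rule W_mat_injective[OF s(1) \<kappa>(4) _ \<kappa>(1) that]) (use \<kappa>(2) d K0 in linarith)
  have \<sigma>: "0 < ?\<sigma>"
  proof (rule sigma_min_pos)
    show "W_mat d \<kappa> s \<in> carrier_mat (2 * \<kappa> - 1) s" by (simp add: W_mat_def)
  qed (use s0 inj in auto)
  have mt: "?\<mu> \<le> cmod (mask_transform d m l \<omega>)" if "\<omega> \<in> cset (2 * \<kappa> - 1)" "l \<in> cset (2 * s - 1)" for \<omega> l
    unfolding mu2_def using that by (intro Min_le) (auto intro!: image_eqI[of _ _ "(\<omega>, l)"])
  define E where "E j t = M (j * int 3) t - of_real (4 * pi\<^sup>2) * of_real ((cmod (model_field d s x m (j * int 3) t))\<^sup>2)" for j t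
  define H where "H p l = (if p + l \<in> cset s then x p * cnj (x (p + l)) else 0)" for p l
  define Err where "Err \<omega> l = of_real (1 / (4 * pi\<^sup>2 * real d)) * dft2 d K E (- l) \<omega> / mask_transform d m (- l) \<omega>" for \<omega> l
  have C: "alg_C d K \<kappa> s m (subsample K d M) = cmat (2 * \<kappa> - 1) (2 * s - 1) (\<lambda>\<omega> l. (\<Sum>p\<in>cset s. dft_coeff d \<omega> p * H p l) + Err \<omega> l)"
    unfolding H_def[abs_def] Err_def[abs_def] E_def[abs_def]
  proof (rule alg_C_decomposition[OF d s \<kappa>(1-3) z])
    fix \<omega> l assume "\<omega> \<in> cset (2 * \<kappa> - 1)" "l \<in> cset (2 * s - 1)"
    thus "mask_transform d m l \<omega> \<noteq> 0" using mt[of \<omega> l] mu by auto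
  qed
  have sumE: "(\<Sum>j\<in>cset K. \<Sum>t\<in>cset d. (cmod (E j t))\<^sup>2) \<le> 2 * R\<^sup>2 + 2 * (real K * real d * \<epsilon>\<^sup>2)"
  proof -
    have "(\<Sum>j\<in>cset K. \<Sum>t\<in>cset d. (cmod (E j t))\<^sup>2) \<le> (\<Sum>j\<in>cset K. \<Sum>t\<in>cset d. 2 * (cmod (\<eta> (j * 3) t))\<^sup>2 + 2 * \<epsilon>\<^sup>2)"
    proof (intro sum_mono)
      fix j t assume jt: "j \<in> cset K" "t \<in> cset d"
      have "E j t = \<eta> (j * 3) t + (M (j * 3) t - \<eta> (j * 3) t - of_real (4 * pi\<^sup>2) * of_real ((cmod (model_field d s x m (j * 3) t))\<^sup>2))"
        by (simp add: E_def)
      hence "cmod (E j t) \<le> cmod (\<eta> (j * 3) t) + \<epsilon>" using \<epsilon>(2)[OF jt] norm_triangle_le by (metis add_left_mono)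
      hence "(cmod (E j t))\<^sup>2 \<le> (cmod (\<eta> (j * 3) t) + \<epsilon>)\<^sup>2" by (intro power_mono) auto
      also have "\<dots> \<le> 2 * (cmod (\<eta> (j * 3) t))\<^sup>2 + 2 * \<epsilon>\<^sup>2"
        using sum_squares_bound[of "cmod (\<eta> (j * 3) t)" \<epsilon>] by (simp add: power2_sum)
      finally show "(cmod (E j t))\<^sup>2 \<le> 2 * (cmod (\<eta> (j * 3) t))\<^sup>2 + 2 * \<epsilon>\<^sup>2" .
    qed
    also have "\<dots> = 2 * (\<Sum>j\<in>cset K. \<Sum>t\<in>cset d. (cmod (\<eta> (j * 3) t))\<^sup>2) + 2 * (real K * real d * \<epsilon>\<^sup>2)"
      by (simp add: sum.distrib sum_distrib_left card_cset[OF K] card_cset[OF d(1)] mult_ac)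
    also have "(\<Sum>j\<in>cset K. \<Sum>t\<in>cset d. (cmod (\<eta> (j * 3) t))\<^sup>2) = R\<^sup>2"
      unfolding R_def subsample_eq[OF d(2) K0] by (simp add: frobenius_norm_cmat[OF K d(1)])
    finally show ?thesis .
  qed
  have dK: "real K = real d / 3" using d by simp
  have Err: "(\<Sum>\<omega>\<in>cset (2 * \<kappa> - 1). (cmod (Err \<omega> l))\<^sup>2) \<le> ((R + real d * \<epsilon>) / ((real d)\<^sup>2 * ?\<mu>))\<^sup>2" if l: "l \<in> cset (2 * s - 1)" for l
  proof -
    let ?c = "1 / (4 * pi\<^sup>2 * real d * ?\<mu>)"
    have "(\<Sum>\<omega>\<in>cset (2 * \<kappa> - 1). (cmod (Err \<omega> l))\<^sup>2) \<le> (\<Sum>\<omega>\<in>cset (2 * \<kappa> - 1). ?c\<^sup>2 * (cmod (dft2 d K E (- l) \<omega>))\<^sup>2)"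
    proof (rule sum_mono)
      fix \<omega> assume \<omega>: "\<omega> \<in> cset (2 * \<kappa> - 1)"
      have "?\<mu> \<le> cmod (mask_transform d m (- l) \<omega>)" by (rule mt[OF \<omega> cset_uminus[OF l]])
      hence "cmod (Err \<omega> l) \<le> 1 / (4 * pi\<^sup>2 * real d) * cmod (dft2 d K E (- l) \<omega>) / ?\<mu>"
        unfolding Err_def norm_mult norm_divide norm_of_real using mu
        by (intro frac_le) auto
      also have "\<dots> = ?c * cmod (dft2 d K E (- l) \<omega>)" by simp
      finally show "(cmod (Err \<omega> l))\<^sup>2 \<le> ?c\<^sup>2 * (cmod (dft2 d K E (- l) \<omega>))\<^sup>2"
        using power_mono[of "cmod (Err \<omega> l)" "?c * cmod (dft2 d K E (- l) \<omega>)" 2]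
        by (simp only: power_mult_distrib norm_ge_zero)
    qed
    also have "\<dots> \<le> ?c\<^sup>2 * (\<Sum>\<omega>\<in>cset K. (cmod (dft2 d K E (- l) \<omega>))\<^sup>2)"
      unfolding sum_distrib_left[symmetric] by (intro mult_left_mono sum_mono2 cset_mono \<kappa>) auto
    also have "\<dots> \<le> ?c\<^sup>2 * ((2 * R\<^sup>2 + 2 * (real K * real d * \<epsilon>\<^sup>2)) / (real d * real K))"
    proof (intro mult_left_mono order_trans[OF dft2_bound[OF K d(1)]] divide_right_mono sumE)
    qed auto
    \<comment> \<open>With K = d/3 the factors collect into this form; 16 pi^4 outweighs 6, so the
      numerical constant is discarded next.\<close>
    also have "\<dots> = (6 / (16 * pi ^ 4)) * ((R\<^sup>2 + (real d * \<epsilon>)\<^sup>2 / 3) / ((real d)\<^sup>2 * ?\<mu>)\<^sup>2)"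
      using d0 mu unfolding dK by (simp add: field_simps power2_eq_square power4_eq_xxxx)
    also have "\<dots> \<le> 1 * ((R + real d * \<epsilon>)\<^sup>2 / ((real d)\<^sup>2 * ?\<mu>)\<^sup>2)"
    proof (intro mult_mono divide_right_mono)
      have "(3::real) ^ 4 \<le> pi ^ 4" using pi_gt3 by (intro power_mono) auto
      thus "6 / (16 * pi ^ 4) \<le> 1" by simp
      have "0 \<le> 2 * R * (real d * \<epsilon>)" using R0 \<epsilon> by simp
      moreover have "0 \<le> (real d * \<epsilon>)\<^sup>2" by simp
      ultimately show "R\<^sup>2 + (real d * \<epsilon>)\<^sup>2 / 3 \<le> (R + real d * \<epsilon>)\<^sup>2" unfolding power2_sum by linarith
    qed auto
    finally show ?thesis by (simp add: power_divide)
  qed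
  have V: "cmod (entry (left_pinv (W_mat d \<kappa> s) * alg_C d K \<kappa> s m (subsample K d M)) p l - x p * cnj (x (p + l)))
       \<le> (R + real d * \<epsilon>) / ((real d)\<^sup>2 * ?\<mu> * ?\<sigma>)"
    if p: "p \<in> cset s" and l: "l \<in> cset (2 * s - 1)" and pl: "p + l \<in> cset s" for p l
  proof -
    let ?D = "cmod (entry (left_pinv (W_mat d \<kappa> s) * alg_C d K \<kappa> s m (subsample K d M)) p l - H p l)"
    have "?\<sigma>\<^sup>2 * ?D\<^sup>2 \<le> (\<Sum>\<omega>\<in>cset (2 * \<kappa> - 1). (cmod (Err \<omega> l))\<^sup>2)"
      unfolding C W_mat_def
      by (rule left_pinv_recovery[OF o\<kappa> s(1) os _ p l]) (use inj in \<open>simp add: W_mat_def\<close>)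
    also note Err[OF l]
    finally have "(?\<sigma> * ?D)\<^sup>2 \<le> ((R + real d * \<epsilon>) / ((real d)\<^sup>2 * ?\<mu>))\<^sup>2" by (simp only: power_mult_distrib)
    hence "?\<sigma> * ?D \<le> (R + real d * \<epsilon>) / ((real d)\<^sup>2 * ?\<mu>)"
      by (rule power2_le_imp_le) (use R0 \<epsilon> mu in simp)
    hence "?D \<le> (R + real d * \<epsilon>) / ((real d)\<^sup>2 * ?\<mu>) / ?\<sigma>" using \<sigma> by (simp only: pos_le_divide_eq mult.commute)
    thus ?thesis using pl by (simp add: H_def)
  qed
  have "s \<le> d" using s by simp
  thus ?thesis using alg_A_entry_error[OF s(1) _ d(1) ij V] by (simp add: R_def)
qed

subsection \<open>Synchronization and the final estimate\<close>

text \<open>The difference is (u - v) plus a radial correction of size ||v| - |u||, each at most |u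
  - v|. If v = 0, its argument is the default 0 and the trivial bound 2 |u| suffices.\<close>

lemma phase_error:
  fixes u v :: complex
  shows "cmod (u - of_real (cmod u) * cis (Arg v)) \<le> 2 * cmod (u - v)"
proof (cases "v = 0")
  case True
  have "cmod (u - of_real (cmod u) * cis (Arg v)) \<le> cmod u + cmod (of_real (cmod u) * cis (Arg v))"
    by (rule norm_triangle_ineq4)
  also have "\<dots> = 2 * cmod u" by (simp add: norm_mult)
  finally show ?thesis using True by simp
next
  case False
  hence v: "v = of_real (cmod v) * cis (Arg v)" by (simp add: cis_Arg sgn_eq)
  have eq: "u - of_real (cmod u) * cis (Arg v) = (u - v) + of_real (cmod v - cmod u) * cis (Arg v)"
    by (subst (2) v) (simp add: algebra_simps)
  have "cmod (of_real (cmod v - cmod u) * cis (Arg v)) = \<bar>cmod v - cmod u\<bar>"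
    by (simp only: norm_mult norm_of_real norm_cis mult_1_right)
  hence "cmod (u - of_real (cmod u) * cis (Arg v)) \<le> cmod (u - v) + \<bar>cmod v - cmod u\<bar>"
    unfolding eq using norm_triangle_ineq[of "u - v" "of_real (cmod v - cmod u) * cis (Arg v)"] by (simp only:)
  also have "\<bar>cmod v - cmod u\<bar> \<le> cmod (u - v)"
    using norm_triangle_ineq3[of v u] by (simp add: norm_minus_commute)
  finally show ?thesis by simp
qed

text \<open>One factor |x - sqrt y| is enlarged to x + sqrt y. This bounds squared magnitude errors
  linearly, with no lower bound on x or y.\<close>

lemma sqrt_diff_bound:
  fixes x y :: real
  assumes "0 \<le> x" "0 \<le> y"
  shows "(x - sqrt y)\<^sup>2 \<le> \<bar>x\<^sup>2 - y\<bar>"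
proof -
  have "(x - sqrt y)\<^sup>2 = \<bar>x - sqrt y\<bar> * \<bar>x - sqrt y\<bar>" by (simp add: power2_eq_square)
  also have "\<dots> \<le> \<bar>x - sqrt y\<bar> * (x + sqrt y)"
  proof (rule mult_left_mono)
    have "0 \<le> sqrt y" using assms by simp
    thus "\<bar>x - sqrt y\<bar> \<le> x + sqrt y" using assms by linarith
  qed simp
  also have "\<dots> = \<bar>(x - sqrt y) * (x + sqrt y)\<bar>" using assms by (simp add: abs_mult)
  also have "(x - sqrt y) * (x + sqrt y) = x\<^sup>2 - y" using assms by (simp add: algebra_simps power2_eq_square)
  finally show ?thesis .
qed

text \<open>
  The reference entry is the largest reconstructed magnitude; if it is nevertheless much
  smaller than the true magnitude at the target, that magnitude itself is of the order of the error.
\<close>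

lemma synchronization_error:
  fixes x0 xn A0 An v :: complex
  assumes e0: "cmod (A0 - x0 * cnj x0) \<le> \<tau>" and en: "cmod (An - xn * cnj xn) \<le> \<tau>"
    and ev: "cmod (v - xn * cnj x0) \<le> \<tau>" and max: "cmod An \<le> cmod A0"
    and \<theta>: "cis \<theta> * x0 = of_real (cmod x0)"
  shows "(cmod (cis \<theta> * xn - of_real (sqrt (cmod An)) * cis (Arg v)))\<^sup>2 \<le> 24 * \<tau>"
proof -
  have t0: "0 \<le> \<tau>" using order_trans[OF norm_ge_zero e0] .
  define q where "q = cmod (cis \<theta> * xn - of_real (cmod xn) * cis (Arg v))"
  have nn: "cmod (xn * cnj xn) = (cmod xn)\<^sup>2" "cmod (x0 * cnj x0) = (cmod x0)\<^sup>2"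
    by (simp_all add: norm_mult power2_eq_square)
  have An: "\<bar>(cmod xn)\<^sup>2 - cmod An\<bar> \<le> \<tau>"
    using order_trans[OF norm_triangle_ineq3 en] unfolding nn by (simp add: abs_minus_commute)
  have A0: "\<bar>(cmod x0)\<^sup>2 - cmod A0\<bar> \<le> \<tau>"
    using order_trans[OF norm_triangle_ineq3 e0] unfolding nn by (simp add: abs_minus_commute)
  have q2: "q \<le> 2 * cmod xn"
    using norm_triangle_ineq4[of "cis \<theta> * xn" "of_real (cmod xn) * cis (Arg v)"] by (simp add: q_def norm_mult)
  \<comment> \<open>Multiplication by |x0| turns the phase difference into the one between xn times
    the conjugate of x0 and its approximation v, so \<open>phase_error\<close> applies without
    dividing by x0.\<close>
  have "cmod x0 * q \<le> 2 * \<tau>"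
  proof (cases "x0 = 0")
    case False
    have "cis \<theta> * (x0 * cnj x0) = of_real (cmod x0) * cnj x0" using \<theta> by (simp flip: mult.assoc)
    hence "(cis \<theta> * of_real (cmod x0)) * of_real (cmod x0) = cnj x0 * of_real (cmod x0)"
      by (simp add: complex_norm_square[symmetric] power2_eq_square mult_ac)
    hence c: "of_real (cmod x0) * cis \<theta> = cnj x0" using False by (simp add: mult_ac)
    have "cmod x0 * q = cmod (of_real (cmod x0) * (cis \<theta> * xn - of_real (cmod xn) * cis (Arg v)))"
      by (simp add: q_def norm_mult)
    also have "of_real (cmod x0) * (cis \<theta> * xn - of_real (cmod xn) * cis (Arg v))
      = (of_real (cmod x0) * cis \<theta>) * xn - of_real (cmod (xn * cnj x0)) * cis (Arg v)"
      by (simp add: algebra_simps norm_mult)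
    also have "\<dots> = xn * cnj x0 - of_real (cmod (xn * cnj x0)) * cis (Arg v)"
      unfolding c by (simp add: mult.commute)
    also have "cmod \<dots> \<le> 2 * cmod (xn * cnj x0 - v)" by (rule phase_error)
    also have "\<dots> \<le> 2 * \<tau>" using ev by (simp add: norm_minus_commute)
    finally show ?thesis .
  qed (use t0 in simp)
  have q0: "0 \<le> q" by (simp add: q_def)
  \<comment> \<open>If |xn| \<le> 2 |x0|, then q^2 \<le> 4 |x0| q \<le> 8 \<tau>. Otherwise
    maximality gives |xn|^2 \<le> |x0|^2 + 2 \<tau>, hence |xn|^2 \<le> 8 \<tau> / 3 and q^2 \<le>
    32 \<tau> / 3, rounded up to 11 \<tau>. The final 24 is 2 * 11 + 2 * 1, the last summand being
    the magnitude error.\<close>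
  have "q\<^sup>2 \<le> 11 * \<tau>"
  proof (cases "cmod xn \<le> 2 * cmod x0")
    case True
    have "q\<^sup>2 \<le> 2 * cmod xn * q" unfolding power2_eq_square using q2 q0 by (intro mult_right_mono)
    also have "\<dots> \<le> 4 * cmod x0 * q" using True q0 by (intro mult_right_mono) auto
    finally show ?thesis using \<open>cmod x0 * q \<le> 2 * \<tau>\<close> t0 by linarith
  next
    case False
    hence "(2 * cmod x0)\<^sup>2 \<le> (cmod xn)\<^sup>2" by (intro power_mono) auto
    hence "4 * (cmod x0)\<^sup>2 \<le> (cmod xn)\<^sup>2" by (simp add: power_mult_distrib)
    hence "3 * (cmod xn)\<^sup>2 \<le> 8 * \<tau>" using An A0 max by linarith
    moreover have "q\<^sup>2 \<le> (2 * cmod xn)\<^sup>2" using q2 q0 by (intro power_mono)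
    ultimately show ?thesis using t0 by (simp add: power_mult_distrib)
  qed
  define r where "r = cmod xn - sqrt (cmod An)"
  have r: "r\<^sup>2 \<le> \<tau>" unfolding r_def using sqrt_diff_bound[of "cmod xn" "cmod An"] An by simp
  have eq: "cis \<theta> * xn - of_real (sqrt (cmod An)) * cis (Arg v)
      = (cis \<theta> * xn - of_real (cmod xn) * cis (Arg v)) + of_real r * cis (Arg v)"
    by (simp add: r_def algebra_simps)
  have "cmod (of_real r * cis (Arg v)) = \<bar>r\<bar>" by (simp only: norm_mult norm_of_real norm_cis mult_1_right)
  hence "cmod (cis \<theta> * xn - of_real (sqrt (cmod An)) * cis (Arg v)) \<le> q + \<bar>r\<bar>"
    unfolding eq using norm_triangle_ineq[of "cis \<theta> * xn - of_real (cmod xn) * cis (Arg v)" "of_real r * cis (Arg v)"]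
    by (simp only: q_def)
  hence "(cmod (cis \<theta> * xn - of_real (sqrt (cmod An)) * cis (Arg v)))\<^sup>2 \<le> (q + \<bar>r\<bar>)\<^sup>2"
    by (intro power_mono) auto
  also have "\<dots> \<le> 2 * q\<^sup>2 + 2 * r\<^sup>2" using sum_squares_bound[of q "\<bar>r\<bar>"] by (simp add: power2_sum)
  also have "\<dots> \<le> 24 * \<tau>" using r \<open>q\<^sup>2 \<le> 11 * \<tau>\<close> by simp
  finally show ?thesis .
qed

text \<open>At the starting index the path has one term and phase 0, so only the magnitude error
  remains; \<open>cis 0\<close> and 24 match the form of the general case.\<close>

lemma synchronization_error_reference:
  fixes x0 A0 :: complex
  assumes e0: "cmod (A0 - x0 * cnj x0) \<le> \<tau>" and \<theta>: "cis \<theta> * x0 = of_real (cmod x0)"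
  shows "(cmod (cis \<theta> * x0 - of_real (sqrt (cmod A0)) * cis 0))\<^sup>2 \<le> 24 * \<tau>"
proof -
  have t0: "0 \<le> \<tau>" using order_trans[OF norm_ge_zero e0] .
  have "cis \<theta> * x0 - of_real (sqrt (cmod A0)) * cis 0 = of_real (cmod x0 - sqrt (cmod A0))"
    by (simp add: \<theta>)
  hence "(cmod (cis \<theta> * x0 - of_real (sqrt (cmod A0)) * cis 0))\<^sup>2 = (cmod x0 - sqrt (cmod A0))\<^sup>2"
    by (simp only: norm_of_real power2_abs)
  also have "\<dots> \<le> \<bar>(cmod x0)\<^sup>2 - cmod A0\<bar>" by (intro sqrt_diff_bound) auto
  also have "\<dots> \<le> \<tau>" using order_trans[OF norm_triangle_ineq3 e0]
    by (simp add: norm_mult power2_eq_square abs_minus_commute)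
  finally show ?thesis using t0 by simp
qed

lemma rotation_to_positive:
  obtains \<theta> where "\<theta> \<in> {0..2 * pi}" "cis \<theta> * x = of_real (cmod x)"
proof -
  \<comment> \<open>\<open>Arg\<close> takes values in (-pi, pi]; the case distinction moves its
    negative into [0, 2 pi].\<close>
  define \<theta> where "\<theta> = (if Arg x \<le> 0 then - Arg x else 2 * pi - Arg x)"
  have "\<theta> \<in> {0..2 * pi}" using Arg_bounded[of x] by (auto simp: \<theta>_def)
  moreover have "cis \<theta> = cis (- Arg x)"
    using cis_add_2pi_int[of "- Arg x" 1] by (auto simp: \<theta>_def)
  moreover have "cis (- Arg x) * x = of_real (cmod x)"
  proof (cases "x = 0")
    case False
    hence "x = of_real (cmod x) * cis (Arg x)" by (simp add: cis_Arg sgn_eq)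
    hence "cis (- Arg x) * x = of_real (cmod x) * (cis (- Arg x) * cis (Arg x))"
      by (metis mult.assoc mult.commute)
    thus ?thesis by (simp add: cis_mult)
  qed simp
  ultimately show ?thesis using that by metis
qed

lemma selection_path_short:
  assumes "selection_path a \<beta> \<gamma> n c ns" "\<bar>n - c\<bar> < \<gamma>"
  shows "ns = (if c = n then [c] else [c, n])"
  using assms by cases auto

section \<open>L2 distances up to a global phase\<close>

lemma L2_norm_square: "(L2_norm g)\<^sup>2 = (LBINT x:{-pi..pi}. (cmod (g x))\<^sup>2)"
proof -
  have "0 \<le> (LBINT x:{-pi..pi}. (cmod (g x))\<^sup>2)"
    unfolding set_lebesgue_integral_def by (intro integral_nonneg_AE AE_I2) auto
  thus ?thesis by (simp add: L2_norm_def)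
qed

text \<open>The squared distance is a constant minus 2 Re (cis \<theta> * c) with a fixed inner
  product c, hence continuous on a compact interval. This justifies writing a minimum over
  \<theta>.\<close>

lemma L2_distance_attains_min:
  assumes f: "continuous_on UNIV f" and g: "continuous_on UNIV g"
  obtains \<theta> where "is_arg_min (\<lambda>\<theta>. (L2_norm (\<lambda>x. cis \<theta> * f x - g x))\<^sup>2) (\<lambda>\<theta>. \<theta> \<in> {0..2 * pi}) \<theta>"
proof -
  define c where "c = (LBINT x:{-pi..pi}. f x * cnj (g x))"
  have i1: "set_integrable lborel {-pi..pi} (\<lambda>x. (cmod (f x))\<^sup>2 + (cmod (g x))\<^sup>2)"
    by (intro set_integrable_continuous_pi continuous_intros f g)
  have i2: "set_integrable lborel {-pi..pi} (\<lambda>x. cis \<theta> * (f x * cnj (g x)))" for \<theta>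
    by (intro set_integrable_continuous_pi continuous_intros f g)
  have i3: "set_integrable lborel {-pi..pi} (\<lambda>x. 2 * Re (cis \<theta> * (f x * cnj (g x))))" for \<theta>
    by (intro set_integrable_continuous_pi continuous_intros f g)
  have "(L2_norm (\<lambda>x. cis \<theta> * f x - g x))\<^sup>2 = (LBINT x:{-pi..pi}. (cmod (f x))\<^sup>2 + (cmod (g x))\<^sup>2) - 2 * Re (cis \<theta> * c)" for \<theta>
  proof -
    have "(cmod (cis \<theta> * u - w))\<^sup>2 = ((cmod u)\<^sup>2 + (cmod w)\<^sup>2) - 2 * Re (cis \<theta> * (u * cnj w))" for u w
    proof -
      have "(cmod (v - w))\<^sup>2 = ((cmod v)\<^sup>2 + (cmod w)\<^sup>2) - 2 * Re (v * cnj w)" for v w :: complex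
        unfolding cmod_power2 by (simp add: power2_eq_square algebra_simps)
      from this[of "cis \<theta> * u" w] show ?thesis by (simp only: norm_mult norm_cis mult_1 mult.assoc)
    qed
    hence "(L2_norm (\<lambda>x. cis \<theta> * f x - g x))\<^sup>2 = (LBINT x:{-pi..pi}. ((cmod (f x))\<^sup>2 + (cmod (g x))\<^sup>2) - 2 * Re (cis \<theta> * (f x * cnj (g x))))"
      unfolding L2_norm_square by (simp only:)
    also have "\<dots> = (LBINT x:{-pi..pi}. (cmod (f x))\<^sup>2 + (cmod (g x))\<^sup>2) - (LBINT x:{-pi..pi}. 2 * Re (cis \<theta> * (f x * cnj (g x))))"
      by (rule set_integral_diff(2)[OF i1 i3])
    also have "(LBINT x:{-pi..pi}. 2 * Re (cis \<theta> * (f x * cnj (g x)))) = 2 * (LBINT x:{-pi..pi}. Re (cis \<theta> * (f x * cnj (g x))))"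
      by (rule set_integral_mult_right)
    also have "(LBINT x:{-pi..pi}. Re (cis \<theta> * (f x * cnj (g x)))) = Re (LBINT x:{-pi..pi}. cis \<theta> * (f x * cnj (g x)))"
      using integral_Re[OF i2[unfolded set_integrable_def], of \<theta>]
      unfolding set_lebesgue_integral_def real_scaleR_def by (simp only: scaleR_complex.sel)
    also have "(LBINT x:{-pi..pi}. cis \<theta> * (f x * cnj (g x))) = cis \<theta> * c"
      unfolding c_def by (rule set_integral_mult_right)
    finally show ?thesis .
  qed
  moreover have "continuous_on {0..2 * pi} (\<lambda>\<theta>. (LBINT x:{-pi..pi}. (cmod (f x))\<^sup>2 + (cmod (g x))\<^sup>2) - 2 * Re (cis \<theta> * c))"
    by (intro continuous_intros)
  ultimately have "continuous_on {0..2 * pi} (\<lambda>\<theta>. (L2_norm (\<lambda>x. cis \<theta> * f x - g x))\<^sup>2)" by (simp only:)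
  hence "\<exists>\<theta>\<in>{0..2 * pi}. \<forall>\<theta>'\<in>{0..2 * pi}. (L2_norm (\<lambda>x. cis \<theta> * f x - g x))\<^sup>2 \<le> (L2_norm (\<lambda>x. cis \<theta>' * f x - g x))\<^sup>2"
    by (intro continuous_attains_inf) auto
  then obtain \<theta> where "\<theta> \<in> {0..2 * pi}"
    "\<And>\<theta>'. \<theta>' \<in> {0..2 * pi} \<Longrightarrow> (L2_norm (\<lambda>x. cis \<theta> * f x - g x))\<^sup>2 \<le> (L2_norm (\<lambda>x. cis \<theta>' * f x - g x))\<^sup>2"
    by blast
  thus ?thesis by (intro that[of \<theta>]) (auto simp: is_arg_min_def not_less)
qed

text \<open>The high frequencies are controlled uniformly by the series tail, the low ones by
  Parseval; (u + v)^2 \<le> 2 u^2 + 2 v^2 joins them.\<close>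

lemma L2_error_split:
  assumes f: "C_smooth k f" "supp f \<subseteq> {-pi<..<pi}" "2 \<le> k" "1 \<le> N"
    and C: "\<And>n. cmod (fourier_coeff f n) * \<bar>of_int n\<bar> ^ k \<le> C"
    and c: "\<And>n. n \<in> {- int N..int N} \<Longrightarrow> (cmod (cis \<theta> * fourier_coeff f n - c n))\<^sup>2 \<le> \<epsilon>"
  shows "(L2_norm (\<lambda>x. cis \<theta> * f x - (\<Sum>n\<in>{- int N..int N}. c n * cis (of_int n * x))))\<^sup>2
     \<le> 16 * pi * C\<^sup>2 / real N ^ (2 * k - 2) + 4 * pi * (real (2 * N + 1) * \<epsilon>)"
proof -
  let ?I = "{- int N..int N}"
  define P where "P x = (\<Sum>n\<in>?I. fourier_coeff f n * cis (of_int n * x))" for x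
  define Q where "Q x = (\<Sum>n\<in>?I. (cis \<theta> * fourier_coeff f n - c n) * cis (of_int n * x))" for x
  define T where "T = 2 * C / real N ^ (k - 1)"
  note cf = C_smooth_continuous[OF f(1)]
  have tail: "cmod (f x - P x) \<le> T" if "x \<in> {-pi..pi}" for x
    unfolding P_def T_def by (rule fourier_series_truncation[OF f(1-3) that f(4) C])
  have Qc: "continuous_on UNIV Q" unfolding Q_def by (intro continuous_intros)
  have split: "cis \<theta> * f x - (\<Sum>n\<in>?I. c n * cis (of_int n * x)) = cis \<theta> * (f x - P x) + Q x" for x
  proof -
    have "Q x = cis \<theta> * P x - (\<Sum>n\<in>?I. c n * cis (of_int n * x))"
      unfolding P_def Q_def left_diff_distrib sum_subtractf sum_distrib_left by (simp only: mult.assoc)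
    thus ?thesis by (simp only: right_diff_distrib) simp
  qed
  have pt: "(cmod (cis \<theta> * (f x - P x) + Q x))\<^sup>2 \<le> 2 * T\<^sup>2 + 2 * (cmod (Q x))\<^sup>2" if x: "x \<in> {-pi..pi}" for x
  proof -
    have "cmod (cis \<theta> * (f x - P x) + Q x) \<le> T + cmod (Q x)"
      using norm_triangle_ineq[of "cis \<theta> * (f x - P x)" "Q x"] tail[OF x] unfolding norm_mult norm_cis mult_1 by linarith
    hence "(cmod (cis \<theta> * (f x - P x) + Q x))\<^sup>2 \<le> (T + cmod (Q x))\<^sup>2" by (intro power_mono) auto
    also have "\<dots> \<le> 2 * T\<^sup>2 + 2 * (cmod (Q x))\<^sup>2" using sum_squares_bound[of T "cmod (Q x)"] by (simp add: power2_sum)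
    finally show ?thesis .
  qed
  have Pc: "continuous_on UNIV P" unfolding P_def by (intro continuous_intros)
  have "(L2_norm (\<lambda>x. cis \<theta> * f x - (\<Sum>n\<in>?I. c n * cis (of_int n * x))))\<^sup>2
     = (LBINT x:{-pi..pi}. (cmod (cis \<theta> * (f x - P x) + Q x))\<^sup>2)"
    unfolding L2_norm_square split ..
  also have "\<dots> \<le> (LBINT x:{-pi..pi}. 2 * T\<^sup>2 + 2 * (cmod (Q x))\<^sup>2)"
  proof (rule set_integral_mono)
    show "set_integrable lborel {-pi..pi} (\<lambda>x. (cmod (cis \<theta> * (f x - P x) + Q x))\<^sup>2)"
      by (intro set_integrable_continuous_pi continuous_intros cf Pc Qc)
    show "set_integrable lborel {-pi..pi} (\<lambda>x. 2 * T\<^sup>2 + 2 * (cmod (Q x))\<^sup>2)"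
      by (intro set_integrable_continuous_pi continuous_intros Qc)
  qed (rule pt)
  also have "\<dots> = (LBINT x:{-pi..pi}. 2 * T\<^sup>2) + 2 * (LBINT x:{-pi..pi}. (cmod (Q x))\<^sup>2)"
  proof -
    have "set_integrable lborel {-pi..pi} (\<lambda>x. 2 * T\<^sup>2)" "set_integrable lborel {-pi..pi} (\<lambda>x. 2 * (cmod (Q x))\<^sup>2)"
      by (intro set_integrable_continuous_pi continuous_intros Qc)+
    thus ?thesis by (simp add: set_integral_add(2))
  qed
  also have "(LBINT x:{-pi..pi}. 2 * T\<^sup>2) = 4 * pi * T\<^sup>2" by (simp add: set_lebesgue_integral_def)
  also have "(LBINT x:{-pi..pi}. (cmod (Q x))\<^sup>2) = 2 * pi * (\<Sum>n\<in>?I. (cmod (cis \<theta> * fourier_coeff f n - c n))\<^sup>2)"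
    unfolding Q_def by (rule trig_poly_parseval) simp
  finally have "(L2_norm (\<lambda>x. cis \<theta> * f x - (\<Sum>n\<in>?I. c n * cis (of_int n * x))))\<^sup>2
     \<le> 4 * pi * T\<^sup>2 + 4 * pi * (\<Sum>n\<in>?I. (cmod (cis \<theta> * fourier_coeff f n - c n))\<^sup>2)" by simp
  moreover have "4 * pi * (\<Sum>n\<in>?I. (cmod (cis \<theta> * fourier_coeff f n - c n))\<^sup>2) \<le> 4 * pi * (real (2 * N + 1) * \<epsilon>)"
  proof (rule mult_left_mono)
    have "(\<Sum>n\<in>?I. (cmod (cis \<theta> * fourier_coeff f n - c n))\<^sup>2) \<le> of_nat (card ?I) * \<epsilon>"
      by (rule sum_bounded_above) (rule c)
    also have "card ?I = 2 * N + 1" by simp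
    finally show "(\<Sum>n\<in>?I. (cmod (cis \<theta> * fourier_coeff f n - c n))\<^sup>2) \<le> real (2 * N + 1) * \<epsilon>" .
  qed simp
  moreover have "4 * pi * T\<^sup>2 = 16 * pi * C\<^sup>2 / real N ^ (2 * k - 2)"
  proof -
    have "2 * k - 2 = (k - 1) * 2" by simp
    thus ?thesis by (simp add: T_def power_divide power_mult_distrib power_mult)
  qed
  ultimately show ?thesis by linarith
qed

text \<open>From s \<ge> 3 d / (8 pi) comes d \<le> 10 s. The lower bound on \<delta> keeps 2
  \<kappa> below 4 d / 21 and thus inside the K available frequencies; the upper bound keeps it
  above d/6 > s + 1, so W has at least as many rows as columns.\<close>

lemma reconstruction_parameters:
  fixes d s \<delta> K \<kappa> :: nat
  assumes d: "odd d" "3 dvd d" and s: "int s = \<lceil>real d * (3 / 4) / (2 * pi)\<rceil>" "odd s" "real s < real d / 8 - 1"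
    and \<delta>: "5 * real d / 21 < real \<delta>" "real \<delta> < real d / 4" and K: "K = d div 3" "\<kappa> = K - \<delta>"
  shows "d = K * 3" "8 * s \<le> d" "real d \<le> 10 * real s" "3 \<le> s" "0 < \<kappa>" "\<kappa> + \<delta> = K" "2 * \<kappa> - 1 \<le> K" "s \<le> 2 * \<kappa> - 1"
proof -
  show dK: "d = K * 3" using d K by simp
  show "8 * s \<le> d"
  proof -
    have "real (8 * s) \<le> real d" using s(3) by simp
    thus ?thesis by (simp only: of_nat_le_iff)
  qed
  have "real d * (3 / 4) / (2 * pi) \<le> real_of_int \<lceil>real d * (3 / 4) / (2 * pi)\<rceil>" by (rule le_of_int_ceiling)
  also have "\<dots> = real s" unfolding s(1)[symmetric] by simp
  finally have "real d * (3 / 4) \<le> real s * (2 * pi)" by (simp add: field_simps)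
  also have "\<dots> \<le> real s * (2 * 3.15)" using pi_approx by (intro mult_left_mono) auto
  finally show ds: "real d \<le> 10 * real s" by simp
  have "1 \<le> s" using s(2) by (simp add: odd_pos Suc_leI)
  hence "1 \<le> real s" by simp
  \<comment> \<open>For s = 1 the bounds d \<le> 10 s and s < d/8 - 1 would give d \<le> 10 and d >
    16.\<close>
  hence "1 < real s" using ds s(3) by linarith
  hence "2 \<le> s" by simp
  thus "3 \<le> s" using s(2) by (cases "s = 2") auto
  have rK: "real K = real d / 3" using dK by simp
  have d0: "0 < real d" using odd_pos[OF d(1)] by simp
  have "real \<delta> < real K" unfolding rK using \<delta>(2) d0 by linarith
  hence \<delta>K: "\<delta> < K" by simp
  thus "0 < \<kappa>" "\<kappa> + \<delta> = K" using K(2) by auto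
  hence "real \<kappa> + real \<delta> = real d / 3" using rK by (simp only: of_nat_add[symmetric])
  hence r\<kappa>: "2 * real \<kappa> = 2 * real d / 3 - 2 * real \<delta>" by (simp add: field_simps)
  have "2 * real \<kappa> \<le> real K" unfolding r\<kappa> rK using \<delta>(1) d0 by linarith
  hence "real (2 * \<kappa>) \<le> real K" by simp
  hence "2 * \<kappa> \<le> K" by (simp only: of_nat_le_iff)
  thus "2 * \<kappa> - 1 \<le> K" by simp
  have "real s + 1 \<le> 2 * real \<kappa>" unfolding r\<kappa> using s(3) \<delta>(2) d0 by linarith
  hence "real (s + 1) \<le> real (2 * \<kappa>)" by simp
  hence "s + 1 \<le> 2 * \<kappa>" by (simp only: of_nat_le_iff)
  thus "s \<le> 2 * \<kappa> - 1" by simp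
qed

text \<open>All paths start at the same index, so a single rotation making the true coefficient
  there nonnegative serves every target.\<close>

lemma alg2_coefficient_error:
  assumes s: "odd s" and out: "alg2_output d K \<kappa> s \<beta> m Y fe"
    and A: "\<And>i j. i \<in> cset s \<Longrightarrow> j \<in> cset s \<Longrightarrow> cmod (entry (alg_A d K \<kappa> s m Y) i j - x i * cnj (x j)) \<le> \<tau>"
  obtains c \<theta> where "fe = (\<lambda>t. \<Sum>n\<in>cset s. c n * cis (of_int n * t))" "\<theta> \<in> {0..2 * pi}"
    "\<And>n. n \<in> cset s \<Longrightarrow> (cmod (cis \<theta> * x n - c n))\<^sup>2 \<le> 24 * \<tau>"
proof -
  define B where "B = alg_A d K \<kappa> s m Y"
  define a where "a = alg_magnitude B"
  obtain n0 ns where n0: "is_arg_max a (\<lambda>n. n \<in> cset s) n0"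
    and ns: "\<And>n. n \<in> cset s \<Longrightarrow> selection_path a (int \<beta>) (2 * int s - 1) n n0 (ns n)"
    and fe: "fe = (\<lambda>t. \<Sum>n\<in>cset s. complex_of_real (a n) * cis (path_phase B (ns n)) * cis (of_int n * t))"
    using out unfolding alg2_output_def Let_def B_def[symmetric] a_def[symmetric] by blast
  have n0s: "n0 \<in> cset s" using n0 by (simp add: is_arg_max_def)
  have amax: "a n \<le> a n0" if "n \<in> cset s" for n using n0 that by (auto simp: is_arg_max_def not_less)
  have max: "cmod (entry B n n) \<le> cmod (entry B n0 n0)" if "n \<in> cset s" for n
    using amax[OF that] by (simp add: a_def alg_magnitude_def)
  obtain \<theta> where \<theta>: "\<theta> \<in> {0..2 * pi}" "cis \<theta> * x n0 = of_real (cmod (x n0))"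
    using rotation_to_positive by blast
  define c where "c n = complex_of_real (a n) * cis (path_phase B (ns n))" for n
  have "(cmod (cis \<theta> * x n - c n))\<^sup>2 \<le> 24 * \<tau>" if n: "n \<in> cset s" for n
  proof -
    have "\<bar>n - n0\<bar> < 2 * int s - 1"
      using n n0s int_odd_offset[OF s] odd_pos[OF s] by (auto simp: cset_odd[OF s])
    hence p: "ns n = (if n0 = n then [n0] else [n0, n])" by (rule selection_path_short[OF ns[OF n]])
    have a: "a i = sqrt (cmod (entry B i i))" for i by (simp add: a_def alg_magnitude_def)
    show ?thesis
    proof (cases "n0 = n")
      case True
      have "c n = of_real (sqrt (cmod (entry B n0 n0))) * cis 0"
        unfolding c_def p a using True by (simp add: path_phase_def)
      thus ?thesis
        using synchronization_error_reference[OF A[OF n0s n0s, folded B_def] \<theta>(2)] True by simp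
    next
      case False
      have "c n = of_real (sqrt (cmod (entry B n n))) * cis (Arg (entry B n n0))"
        unfolding c_def p a using False by (simp add: path_phase_def)
      thus ?thesis
        using synchronization_error[OF A[OF n0s n0s, folded B_def] A[OF n n, folded B_def] A[OF n n0s, folded B_def] max[OF n] \<theta>(2)]
        by simp
    qed
  qed
  thus ?thesis using that[of c \<theta>] \<theta>(1) by (simp add: fe c_def)
qed

text \<open>Here s is the number of coefficients and \<nu> stands for \<mu> times \<sigma>. One
  factor d pays for the summation and the other for the discretization error; the noise term retains
  a spare 1/d, which is dropped.\<close>

lemma scaled_entry_error:
  fixes d s R E \<nu> :: real
  assumes "1 \<le> d" "0 \<le> s" "s \<le> d" "0 \<le> R" "0 \<le> E" "0 < \<nu>"
  shows "s * ((R + d * (E / d ^ k)) / (d\<^sup>2 * \<nu>)) \<le> R / \<nu> + E / (\<nu> * d ^ k)"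
proof -
  have "s * ((R + d * (E / d ^ k)) / (d\<^sup>2 * \<nu>)) \<le> d * ((R + d * (E / d ^ k)) / (d\<^sup>2 * \<nu>))"
    using assms by (intro mult_right_mono) auto
  also have "\<dots> = R / \<nu> / d + E / (\<nu> * d ^ k)" using assms by (simp add: field_simps power2_eq_square)
  also have "R / \<nu> / d \<le> R / \<nu> / 1" using assms by (intro divide_left_mono) auto
  finally show ?thesis by simp
qed

theorem theorem2:
  fixes k :: nat and b :: real and f m :: "real \<Rightarrow> complex"
  assumes "b = 3 / 4"
    and "k \<ge> 4"
    and "C_smooth k m"
    and "supp m \<subseteq> {-b<..<b}"
  shows "\<exists>C::real. \<forall>(a::real) (\<beta>::nat) (d::nat) (s::nat) (\<delta>::nat) (K::nat) (\<kappa>::nat)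
            (\<eta> :: int \<Rightarrow> int \<Rightarrow> complex) (fe :: real \<Rightarrow> complex).
     0 < a \<longrightarrow> a < pi - 3 / 4 \<longrightarrow> 0 < \<beta> \<longrightarrow> f \<in> signal_class k a \<beta> \<longrightarrow>
     odd d \<longrightarrow> 3 dvd d \<longrightarrow>
     int s = \<lceil>real d * b / (2 * pi)\<rceil> \<longrightarrow> odd s \<longrightarrow>
     int \<delta> = \<lfloor>real d * b / pi\<rfloor> \<longrightarrow>
     real \<beta> < real s - 1 / 2 \<longrightarrow>
     real s < real d / 8 - 1 \<longrightarrow>
     5 * real d / 21 < real \<delta> \<longrightarrow> real \<delta> < real d / 4 \<longrightarrow>
     K = d div 3 \<longrightarrow> \<kappa> = K - \<delta> \<longrightarrow>
     mu2 d \<kappa> s m > 0 \<longrightarrow>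
     alg2_output d K \<kappa> s \<beta> m (subsample K d (measurement d m f \<eta>)) fe \<longrightarrow>
     (\<exists>\<theta>. is_arg_min (\<lambda>\<theta>. (L2_norm (\<lambda>x. cis \<theta> * f x - fe x))\<^sup>2) (\<lambda>\<theta>. \<theta> \<in> {0..2 * pi}) \<theta> \<and>
          (L2_norm (\<lambda>x. cis \<theta> * f x - fe x))\<^sup>2
            \<le> C * (1 / (mu2 d \<kappa> s m * sigma_min (W_mat d \<kappa> s) * real d ^ k)
                   + frobenius_norm (subsample K d \<eta>) / (mu2 d \<kappa> s m * sigma_min (W_mat d \<kappa> s))
                   + (1 / real d) ^ (2 * k - 2)))"
proof (cases "\<exists>a \<beta>. 0 < a \<and> a < pi - 3 / 4 \<and> f \<in> signal_class k a \<beta>")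
  case False
  thus ?thesis by blast
next
  case True
  \<comment> \<open>The constant may depend on f but not on a. If f lies in some class, one
    admissible a0 is fixed here and all constants are built from it; the estimates hold for every
    other parameter choice.\<close>
  then obtain a0 \<beta>0 where a0: "0 < a0" "a0 < pi - 3 / 4" "f \<in> signal_class k a0 \<beta>0" by blast
  hence f: "C_smooth k f" "supp f \<subseteq> {-a0<..<a0}" by (auto simp: signal_class_def)
  have k2: "2 \<le> k" using assms by simp
  have b0: "0 < b" "a0 + b < pi" using assms(1) a0 by auto
  have sf: "supp f \<subseteq> {-pi<..<pi}" using f(2) b0 by auto
  obtain Cf where Cf: "0 \<le> Cf" "\<And>n. cmod (fourier_coeff f n) * \<bar>of_int n\<bar> ^ k \<le> Cf"
    using fourier_coeff_decay[OF f(1) sf] by blast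
  obtain E where E: "0 \<le> E"
    "\<And>d s \<eta> \<omega> l. odd d \<Longrightarrow> odd s \<Longrightarrow> real d \<le> 10 * real s \<Longrightarrow> 8 * s \<le> d \<Longrightarrow> 2 * \<bar>\<omega>\<bar> \<le> int d \<Longrightarrow> l \<in> cset d \<Longrightarrow>
       cmod (measurement d m f \<eta> \<omega> l - \<eta> \<omega> l
         - of_real (4 * pi\<^sup>2) * of_real ((cmod (model_field d s (fourier_coeff f) m \<omega> l))\<^sup>2)) \<le> E / real d ^ k"
    using measurement_model_error[OF f assms(3,4) k2 a0(1) b0] by blast
  \<comment> \<open>The factor 30 converts N into d: s = 2 N + 1 \<le> 3 N and d \<le> 10 s. The 96
    pi below is 4 pi from the L2 estimate times 24 from synchronization.\<close>
  define C1 where "C1 = 16 * pi * Cf\<^sup>2 * 30 ^ (2 * k - 2)"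
  define C where "C = C1 + 96 * pi * (1 + E)"
  have C10: "0 \<le> C1" by (simp add: C1_def)
  have CC: "C1 \<le> C" "96 * pi \<le> C" "96 * pi * E \<le> C"
  proof -
    have "96 * pi * (1 + E) = 96 * pi + 96 * pi * E" by (simp add: algebra_simps)
    moreover have "0 \<le> 96 * pi" "0 \<le> 96 * pi * E" using E(1) by auto
    ultimately show "C1 \<le> C" "96 * pi \<le> C" "96 * pi * E \<le> C" using C10 unfolding C_def by linarith+
  qed
  show ?thesis
  proof (rule exI[of _ C], intro allI impI)
    fix a :: real and \<beta> d s \<delta> K \<kappa> :: nat and \<eta> :: "int \<Rightarrow> int \<Rightarrow> complex" and fe :: "real \<Rightarrow> complex"
    assume d: "odd d" "3 dvd d" and s: "int s = \<lceil>real d * b / (2 * pi)\<rceil>" "odd s"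
      and \<delta>: "int \<delta> = \<lfloor>real d * b / pi\<rfloor>" and s8: "real s < real d / 8 - 1"
      and \<delta>': "5 * real d / 21 < real \<delta>" "real \<delta> < real d / 4" and K: "K = d div 3" "\<kappa> = K - \<delta>"
      and mu: "0 < mu2 d \<kappa> s m"
      and out: "alg2_output d K \<kappa> s \<beta> m (subsample K d (measurement d m f \<eta>)) fe"
    let ?\<mu> = "mu2 d \<kappa> s m" and ?\<sigma> = "sigma_min (W_mat d \<kappa> s)" and ?R = "frobenius_norm (subsample K d \<eta>)"
    note par = reconstruction_parameters[OF d s(1)[unfolded assms(1)] s(2) s8 \<delta>' K]
    have d1: "1 \<le> real d" using odd_pos[OF d(1)] by simp
    have oK: "odd K" using d(1) par(1) by auto
    have \<epsilon>0: "0 \<le> E / real d ^ k" using E(1) by simp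
    define \<tau> where "\<tau> = (?R + real d * (E / real d ^ k)) / ((real d)\<^sup>2 * (?\<mu> * ?\<sigma>))"
    have A: "cmod (entry (alg_A d K \<kappa> s m (subsample K d (measurement d m f \<eta>))) i j - fourier_coeff f i * cnj (fourier_coeff f j)) \<le> \<tau>"
      if ij: "i \<in> cset s" "j \<in> cset s" for i j
      unfolding \<tau>_def mult.assoc[symmetric]
    proof (rule alg_A_error[OF d(1) par(1) s(2) _ par(5,7,6,8) _ mu \<epsilon>0 _ ij])
      show "2 * s \<le> d" using par(2) by simp
      show "\<bar>p' - p\<bar> \<le> int \<delta>" if "mask_samples d m p \<noteq> 0" "mask_samples d m p' \<noteq> 0" for p p'
        by (rule mask_samples_support[OF assms(4) odd_pos[OF d(1)] \<delta> that])
      fix j t assume jt: "j \<in> cset K" "t \<in> cset d"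
      have "2 * \<bar>j\<bar> \<le> int K" using jt(1) int_odd_offset[OF oK] by (auto simp: cset_odd[OF oK])
      hence "2 * \<bar>j * 3\<bar> \<le> int d" using par(1) by (simp add: abs_mult)
      thus "cmod (measurement d m f \<eta> (j * 3) t - \<eta> (j * 3) t
         - of_real (4 * pi\<^sup>2) * of_real ((cmod (model_field d s (fourier_coeff f) m (j * 3) t))\<^sup>2)) \<le> E / real d ^ k"
        by (rule E(2)[OF d(1) s(2) par(3,2) _ jt(2)])
    qed
    obtain c \<theta>0 where fe: "fe = (\<lambda>t. \<Sum>n\<in>cset s. c n * cis (of_int n * t))" and \<theta>0: "\<theta>0 \<in> {0..2 * pi}"
      and c: "\<And>n. n \<in> cset s \<Longrightarrow> (cmod (cis \<theta>0 * fourier_coeff f n - c n))\<^sup>2 \<le> 24 * \<tau>"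
      using alg2_coefficient_error[OF s(2) out A] by blast
    have \<sigma>: "0 < ?\<sigma>"
    proof (rule sigma_min_pos)
      show "W_mat d \<kappa> s \<in> carrier_mat (2 * \<kappa> - 1) s" by (simp add: W_mat_def)
      show "0 < s" using par(4) by simp
      show "v = 0\<^sub>v s" if "v \<in> carrier_vec s" "W_mat d \<kappa> s *\<^sub>v v = 0\<^sub>v (2 * \<kappa> - 1)" for v
        by (rule W_mat_injective[OF s(2) par(8) _ par(5) that]) (use par(1,7) in linarith)
    qed
    define N where "N = nat (offset s)"
    have offs: "int N = offset s" using offset_nonneg[OF s(2)] by (simp add: N_def)
    have cs: "cset s = {- int N..int N}" by (simp add: cset_odd[OF s(2)] offs)
    have sN: "s = 2 * N + 1" using int_odd_offset[OF s(2)] offs by linarith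
    have N1: "1 \<le> N" using sN par(4) by linarith
    have "real s \<le> 3 * real N" using N1 by (simp add: sN)
    hence dN: "real d / 30 \<le> real N" using par(3) by linarith
    have "(L2_norm (\<lambda>x. cis \<theta>0 * f x - fe x))\<^sup>2 \<le> 16 * pi * Cf\<^sup>2 / real N ^ (2 * k - 2) + 4 * pi * (real (2 * N + 1) * (24 * \<tau>))"
      unfolding fe cs by (rule L2_error_split[OF f(1) sf k2 N1 Cf(2)]) (use c cs in blast)
    also have "\<dots> = 16 * pi * Cf\<^sup>2 / real N ^ (2 * k - 2) + 96 * pi * (real s * \<tau>)"
      by (simp add: sN)
    also have "\<dots> \<le> C1 * (1 / real d) ^ (2 * k - 2) + 96 * pi * (?R / (?\<mu> * ?\<sigma>) + E / (?\<mu> * ?\<sigma> * real d ^ k))"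
    proof (rule add_mono)
      have "(real d / 30) ^ (2 * k - 2) \<le> real N ^ (2 * k - 2)" using dN d1 by (intro power_mono) auto
      hence "16 * pi * Cf\<^sup>2 / real N ^ (2 * k - 2) \<le> 16 * pi * Cf\<^sup>2 / (real d / 30) ^ (2 * k - 2)"
        using d1 N1 by (intro divide_left_mono) auto
      also have "\<dots> = C1 * (1 / real d) ^ (2 * k - 2)" by (simp add: C1_def power_divide)
      finally show "16 * pi * Cf\<^sup>2 / real N ^ (2 * k - 2) \<le> C1 * (1 / real d) ^ (2 * k - 2)" .
      have "real s * \<tau> \<le> ?R / (?\<mu> * ?\<sigma>) + E / (?\<mu> * ?\<sigma> * real d ^ k)"
        unfolding \<tau>_def using mu \<sigma> par(2) E(1) d1
        by (intro scaled_entry_error) (auto simp: frobenius_norm_def sum_nonneg)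
      thus "96 * pi * (real s * \<tau>) \<le> 96 * pi * (?R / (?\<mu> * ?\<sigma>) + E / (?\<mu> * ?\<sigma> * real d ^ k))"
        by (intro mult_left_mono) auto
    qed
    also have "\<dots> \<le> C * (1 / (?\<mu> * ?\<sigma> * real d ^ k) + ?R / (?\<mu> * ?\<sigma>) + (1 / real d) ^ (2 * k - 2))"
    proof -
      have R0: "0 \<le> ?R" by (simp add: frobenius_norm_def sum_nonneg)
      have "96 * pi * (?R / (?\<mu> * ?\<sigma>) + E / (?\<mu> * ?\<sigma> * real d ^ k))
          = 96 * pi * (?R / (?\<mu> * ?\<sigma>)) + 96 * pi * E * (1 / (?\<mu> * ?\<sigma> * real d ^ k))"
        by (simp add: algebra_simps)
      moreover have "96 * pi * (?R / (?\<mu> * ?\<sigma>)) \<le> C * (?R / (?\<mu> * ?\<sigma>))"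
        using CC R0 mu \<sigma> by (intro mult_right_mono) auto
      moreover have "96 * pi * E * (1 / (?\<mu> * ?\<sigma> * real d ^ k)) \<le> C * (1 / (?\<mu> * ?\<sigma> * real d ^ k))"
        using CC mu \<sigma> by (intro mult_right_mono) auto
      moreover have "C1 * (1 / real d) ^ (2 * k - 2) \<le> C * (1 / real d) ^ (2 * k - 2)"
        using CC by (intro mult_right_mono) auto
      ultimately show ?thesis by (simp only: distrib_left)
    qed
    finally have bound: "(L2_norm (\<lambda>x. cis \<theta>0 * f x - fe x))\<^sup>2
       \<le> C * (1 / (?\<mu> * ?\<sigma> * real d ^ k) + ?R / (?\<mu> * ?\<sigma>) + (1 / real d) ^ (2 * k - 2))" .
    \<comment> \<open>The bound was proved for the particular rotation \<theta>0; the minimizing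
      angle can only do better.\<close>
    have "continuous_on UNIV fe" unfolding fe by (intro continuous_intros)
    then obtain \<theta> where \<theta>: "is_arg_min (\<lambda>\<theta>. (L2_norm (\<lambda>x. cis \<theta> * f x - fe x))\<^sup>2) (\<lambda>\<theta>. \<theta> \<in> {0..2 * pi}) \<theta>"
      using L2_distance_attains_min[OF C_smooth_continuous[OF f(1)]] by blast
    hence "(L2_norm (\<lambda>x. cis \<theta> * f x - fe x))\<^sup>2 \<le> (L2_norm (\<lambda>x. cis \<theta>0 * f x - fe x))\<^sup>2"
      using \<theta>0 unfolding is_arg_min_def by (meson not_less)
    with bound \<theta> show "\<exists>\<theta>. is_arg_min (\<lambda>\<theta>. (L2_norm (\<lambda>x. cis \<theta> * f x - fe x))\<^sup>2) (\<lambda>\<theta>. \<theta> \<in> {0..2 * pi}) \<theta> \<and>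
          (L2_norm (\<lambda>x. cis \<theta> * f x - fe x))\<^sup>2
            \<le> C * (1 / (?\<mu> * ?\<sigma> * real d ^ k) + ?R / (?\<mu> * ?\<sigma>) + (1 / real d) ^ (2 * k - 2))"
      by (intro exI[of _ \<theta>] conjI) (auto intro: order_trans)
  qed
qed

end
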